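(* Let $(M^n,g,J)$ be a closed, connected almost Hermitian manifold of real dimension $n\geq 6$. If $Y(M,g,J)<0$, then $J$ is not integrable.
   Context: An almost Hermitian manifold $(M^n,g,J)$ is a smooth manifold of real dimension $n$ with a Riemannian metric $g$ and an almost complex structure $J$ satisfying $g(JX,JY)=g(X,Y)$. With $\nabla$ the Levi-Civita connection, set $R(X,Y)Z:=\nabla_{[X,Y]}Z-[\nabla_X,\nabla_Y]Z$, $\operatorname{Ric}(X,Y):=\operatorname{tr}\{Z\mapsto R(X,Z)Y\}$, $\operatorname{Ric}^*(X,Y):=\operatorname{tr}\{Z\mapsto -J(R(X,Z)(JY))\}$ ($*$-Ricci tensor), $R_g:=\operatorname{tr}_g\operatorname{Ric}$ (scalar curvature), $R_g^*:=\operatorname{tr}_g\operatorname{Ric}^*$ ($*$-scalar curvature). The holomorphic d-scalar curvature of $(M^n,g,J)$ is the function $S_J:=R_g-R_g^*$. Let $p=\frac{2n}{n-2}$ and define $$Q_{g,J}(u):=\frac{\int_M \left(4|du|_g^2+S_Ju^2\right)dV_g}{\|u\|_p^2},\qquad \|u\|_p:=\Big(\int_M|u|^p\,dV_g\Big)^{1/p},$$ $$Y(M,g,J):=\inf\{Q_{g,J}(u): u\in C^\infty(M),\ u>0\}.$$ $J$ is integrable iff its Nijenhuis tensor $N_J(X,Y):=[JX,JY]-[X,Y]-J[JX,Y]-J[X,JY]$ vanishes. *)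

theory Defs
  imports "HOL-Analysis.Analysis" "HOL-Library.Function_Algebras"
begin

text \<open>
  A manifold is a type \<open>'a\<close> (Hausdorff, second countable) together with a smooth atlas, modelled
  on \<open>real ^ 'n\<close>; its dimension is \<open>CARD('n)\<close>. The atlas need not be maximal. The pointwise
  operations of \<open>Function_Algebras\<close> provide the additive structure of tangent vectors and
  vector fields.
\<close>

section \<open>Smooth manifolds\<close>

text \<open>\<open>Ck_on k S f\<close> is used for open \<open>S\<close> only.\<close>

primrec Ck_on :: "nat \<Rightarrow> (real ^ 'n) set \<Rightarrow> (real ^ 'n \<Rightarrow> 'b::real_normed_vector) \<Rightarrow> bool" where
  "Ck_on 0 S f \<longleftrightarrow> continuous_on S f"
| "Ck_on (Suc k) S f \<longleftrightarrow>
     f differentiable_on S \<and> (\<forall>i. Ck_on k S (\<lambda>x. frechet_derivative f (at x) (axis i 1)))"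

definition smooth_on :: "(real ^ 'n) set \<Rightarrow> (real ^ 'n \<Rightarrow> 'b::real_normed_vector) \<Rightarrow> bool" where
  "smooth_on S f \<longleftrightarrow> (\<forall>k. Ck_on k S f)"

text \<open>A chart is a pair of its domain and its coordinate map (only the values of the latter on
  the domain matter).\<close>

type_synonym ('a, 'n) chart = "'a set \<times> ('a \<Rightarrow> (real, 'n) vec)"

definition is_chart :: "('a::topological_space, 'n::finite) chart \<Rightarrow> bool" where
  "is_chart c \<longleftrightarrow> open (fst c) \<and> open (snd c ` fst c) \<and>
     (\<exists>\<psi>. homeomorphism (fst c) (snd c ` fst c) (snd c) \<psi>)"

definition chart_inv :: "('a, 'n::finite) chart \<Rightarrow> real ^ 'n \<Rightarrow> 'a" where
  "chart_inv c = inv_into (fst c) (snd c)"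

definition transition :: "('a, 'n::finite) chart \<Rightarrow> ('a, 'n) chart \<Rightarrow> real ^ 'n \<Rightarrow> real ^ 'n" where
  "transition c d = snd d \<circ> chart_inv c"

definition smooth_atlas :: "('a::topological_space, 'n::finite) chart set \<Rightarrow> bool" where
  "smooth_atlas A \<longleftrightarrow> (\<forall>c\<in>A. is_chart c) \<and> (\<Union>c\<in>A. fst c) = UNIV \<and>
     (\<forall>c\<in>A. \<forall>d\<in>A. smooth_on (snd c ` (fst c \<inter> fst d)) (transition c d))"

definition charts_at :: "('a, 'n::finite) chart set \<Rightarrow> 'a \<Rightarrow> ('a, 'n) chart set" where
  "charts_at A p = {c \<in> A. p \<in> fst c}"

text \<open>An arbitrary chart around \<open>p\<close>; everything defined through it below is independent of the
  choice.\<close>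

definition chart_at :: "('a, 'n::finite) chart set \<Rightarrow> 'a \<Rightarrow> ('a, 'n) chart" where
  "chart_at A p = (SOME c. c \<in> charts_at A p)"

definition smooth_fun :: "('a, 'n::finite) chart set \<Rightarrow> ('a \<Rightarrow> real) \<Rightarrow> bool" where
  "smooth_fun A f \<longleftrightarrow> (\<forall>c\<in>A. smooth_on (snd c ` fst c) (f \<circ> chart_inv c))"


section \<open>Tangent vectors and vector fields\<close>

text \<open>A tangent vector at \<open>p\<close> is the family of its coordinate vectors in all charts around \<open>p\<close>,
  related by the Jacobians of the transition maps; the entries for other charts are set to \<open>0\<close>.\<close>

type_synonym ('a, 'n) tvec = "('a, 'n) chart \<Rightarrow> (real, 'n) vec"
type_synonym ('a, 'n) vfield = "'a \<Rightarrow> ('a, 'n) tvec"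

definition tangent_space :: "('a, 'n::finite) chart set \<Rightarrow> 'a \<Rightarrow> ('a, 'n) tvec set" where
  "tangent_space A p = {v. (\<forall>c. c \<notin> charts_at A p \<longrightarrow> v c = 0) \<and>
     (\<forall>c\<in>charts_at A p. \<forall>d\<in>charts_at A p.
        v d = frechet_derivative (transition c d) (at (snd c p)) (v c))}"

definition tscale :: "real \<Rightarrow> ('a, 'n::finite) tvec \<Rightarrow> ('a, 'n) tvec" where
  "tscale r v = (\<lambda>c. r *\<^sub>R v c)"

text \<open>The \<open>i\<close>-th coordinate vector at \<open>p\<close> of the chart \<open>c\<close>.\<close>

definition coord_vec :: "('a, 'n::finite) chart set \<Rightarrow> ('a, 'n) chart \<Rightarrow> 'a \<Rightarrow> 'n \<Rightarrow> ('a, 'n) tvec" where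
  "coord_vec A c p i = (\<lambda>d. if d \<in> charts_at A p
     then frechet_derivative (transition c d) (at (snd c p)) (axis i 1) else 0)"

definition vf_scale :: "('a \<Rightarrow> real) \<Rightarrow> ('a, 'n::finite) vfield \<Rightarrow> ('a, 'n) vfield" where
  "vf_scale f X = (\<lambda>p. tscale (f p) (X p))"

definition vf_rep :: "('a, 'n::finite) chart \<Rightarrow> ('a, 'n) vfield \<Rightarrow> real ^ 'n \<Rightarrow> real ^ 'n" where
  "vf_rep c X = (\<lambda>x. X (chart_inv c x) c)"

definition smooth_vf :: "('a, 'n::finite) chart set \<Rightarrow> ('a, 'n) vfield \<Rightarrow> bool" where
  "smooth_vf A X \<longleftrightarrow> (\<forall>p. X p \<in> tangent_space A p) \<and>
     (\<forall>c\<in>A. smooth_on (snd c ` fst c) (vf_rep c X))"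

definition differential :: "('a, 'n::finite) chart set \<Rightarrow> ('a \<Rightarrow> real) \<Rightarrow> 'a \<Rightarrow> ('a, 'n) tvec \<Rightarrow> real" where
  "differential A f p v = (let c = chart_at A p
     in frechet_derivative (f \<circ> chart_inv c) (at (snd c p)) (v c))"

definition vf_apply :: "('a, 'n::finite) chart set \<Rightarrow> ('a, 'n) vfield \<Rightarrow> ('a \<Rightarrow> real) \<Rightarrow> 'a \<Rightarrow> real" where
  "vf_apply A X f = (\<lambda>p. differential A f p (X p))"

definition lie_bracket ::
  "('a, 'n::finite) chart set \<Rightarrow> ('a, 'n) vfield \<Rightarrow> ('a, 'n) vfield \<Rightarrow> ('a, 'n) vfield" where
  "lie_bracket A X Y = (\<lambda>p c. if c \<in> charts_at A p
     then frechet_derivative (vf_rep c Y) (at (snd c p)) (X p c)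
        - frechet_derivative (vf_rep c X) (at (snd c p)) (Y p c) else 0)"

text \<open>Some smooth vector field with the value \<open>v\<close> at \<open>p\<close>.\<close>

definition vf_ext :: "('a, 'n::finite) chart set \<Rightarrow> 'a \<Rightarrow> ('a, 'n) tvec \<Rightarrow> ('a, 'n) vfield" where
  "vf_ext A p v = (SOME X. smooth_vf A X \<and> X p = v)"


section \<open>Almost Hermitian structures\<close>

type_synonym ('a, 'n) metric = "'a \<Rightarrow> ('a, 'n) tvec \<Rightarrow> ('a, 'n) tvec \<Rightarrow> real"
type_synonym ('a, 'n) endo = "'a \<Rightarrow> ('a, 'n) tvec \<Rightarrow> ('a, 'n) tvec"

definition gram :: "('a, 'n::finite) chart set \<Rightarrow> ('a, 'n) metric \<Rightarrow> ('a, 'n) chart \<Rightarrow> 'a \<Rightarrow> real ^ 'n ^ 'n" where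
  "gram A g c p = (\<chi> i j. g p (coord_vec A c p i) (coord_vec A c p j))"

definition riemannian_metric :: "('a, 'n::finite) chart set \<Rightarrow> ('a, 'n) metric \<Rightarrow> bool" where
  "riemannian_metric A g \<longleftrightarrow>
     (\<forall>p. \<forall>u\<in>tangent_space A p. \<forall>v\<in>tangent_space A p. \<forall>w\<in>tangent_space A p. \<forall>r.
        g p (u + v) w = g p u w + g p v w \<and> g p (tscale r u) v = r * g p u v \<and>
        g p u v = g p v u) \<and>
     (\<forall>p. \<forall>v\<in>tangent_space A p. v \<noteq> 0 \<longrightarrow> g p v v > 0) \<and>
     (\<forall>c\<in>A. \<forall>i j. smooth_on (snd c ` fst c) (\<lambda>x. gram A g c (chart_inv c x) $ i $ j))"

definition almost_complex_structure :: "('a, 'n::finite) chart set \<Rightarrow> ('a, 'n) endo \<Rightarrow> bool" where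
  "almost_complex_structure A J \<longleftrightarrow>
     (\<forall>p. \<forall>v\<in>tangent_space A p. \<forall>w\<in>tangent_space A p. \<forall>r.
        J p v \<in> tangent_space A p \<and> J p (v + w) = J p v + J p w \<and>
        J p (tscale r v) = tscale r (J p v) \<and> J p (J p v) = - v) \<and>
     (\<forall>c\<in>A. \<forall>i. smooth_on (snd c ` fst c)
        (\<lambda>x. J (chart_inv c x) (coord_vec A c (chart_inv c x) i) c))"

definition almost_hermitian ::
  "('a, 'n::finite) chart set \<Rightarrow> ('a, 'n) metric \<Rightarrow> ('a, 'n) endo \<Rightarrow> bool" where
  "almost_hermitian A g J \<longleftrightarrow> riemannian_metric A g \<and> almost_complex_structure A J \<and>
     (\<forall>p. \<forall>v\<in>tangent_space A p. \<forall>w\<in>tangent_space A p. g p (J p v) (J p w) = g p v w)"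

definition vf_endo :: "('a, 'n::finite) endo \<Rightarrow> ('a, 'n) vfield \<Rightarrow> ('a, 'n) vfield" where
  "vf_endo J X = (\<lambda>p. J p (X p))"

definition nijenhuis :: "('a, 'n::finite) chart set \<Rightarrow> ('a, 'n) endo \<Rightarrow>
    ('a, 'n) vfield \<Rightarrow> ('a, 'n) vfield \<Rightarrow> ('a, 'n) vfield" where
  "nijenhuis A J X Y = lie_bracket A (vf_endo J X) (vf_endo J Y) - lie_bracket A X Y
     - vf_endo J (lie_bracket A (vf_endo J X) Y) - vf_endo J (lie_bracket A X (vf_endo J Y))"

definition integrable_acs :: "('a, 'n::finite) chart set \<Rightarrow> ('a, 'n) endo \<Rightarrow> bool" where
  "integrable_acs A J \<longleftrightarrow> (\<forall>X Y. smooth_vf A X \<longrightarrow> smooth_vf A Y \<longrightarrow> nijenhuis A J X Y = 0)"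


section \<open>Levi-Civita connection and curvature\<close>

definition is_connection :: "('a, 'n::finite) chart set \<Rightarrow>
    (('a, 'n) vfield \<Rightarrow> ('a, 'n) vfield \<Rightarrow> ('a, 'n) vfield) \<Rightarrow> bool" where
  "is_connection A D \<longleftrightarrow>
     (\<forall>X Y Z f. smooth_vf A X \<longrightarrow> smooth_vf A Y \<longrightarrow> smooth_vf A Z \<longrightarrow> smooth_fun A f \<longrightarrow>
        smooth_vf A (D X Y) \<and>
        D (X + Y) Z = D X Z + D Y Z \<and>
        D (vf_scale f X) Y = vf_scale f (D X Y) \<and>
        D X (Y + Z) = D X Y + D X Z \<and>
        D X (vf_scale f Y) = vf_scale (vf_apply A X f) Y + vf_scale f (D X Y))"

definition is_levi_civita :: "('a, 'n::finite) chart set \<Rightarrow> ('a, 'n) metric \<Rightarrow>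
    (('a, 'n) vfield \<Rightarrow> ('a, 'n) vfield \<Rightarrow> ('a, 'n) vfield) \<Rightarrow> bool" where
  "is_levi_civita A g D \<longleftrightarrow> is_connection A D \<and>
     (\<forall>X Y. smooth_vf A X \<longrightarrow> smooth_vf A Y \<longrightarrow> D X Y - D Y X = lie_bracket A X Y) \<and>
     (\<forall>X Y Z. smooth_vf A X \<longrightarrow> smooth_vf A Y \<longrightarrow> smooth_vf A Z \<longrightarrow>
        vf_apply A X (\<lambda>p. g p (Y p) (Z p)) =
          (\<lambda>p. g p (D X Y p) (Z p) + g p (Y p) (D X Z p)))"

text \<open>Unique on smooth vector fields.\<close>

definition levi_civita :: "('a, 'n::finite) chart set \<Rightarrow> ('a, 'n) metric \<Rightarrow>
    ('a, 'n) vfield \<Rightarrow> ('a, 'n) vfield \<Rightarrow> ('a, 'n) vfield" where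
  "levi_civita A g = (SOME D. is_levi_civita A g D)"

definition curvature :: "('a, 'n::finite) chart set \<Rightarrow> ('a, 'n) metric \<Rightarrow>
    ('a, 'n) vfield \<Rightarrow> ('a, 'n) vfield \<Rightarrow> ('a, 'n) vfield \<Rightarrow> ('a, 'n) vfield" where
  "curvature A g X Y Z = (let D = levi_civita A g
     in D (lie_bracket A X Y) Z - (D X (D Y Z) - D Y (D X Z)))"

text \<open>The curvature tensor at \<open>p\<close>; since \<open>curvature\<close> is tensorial, the extensions do not matter.\<close>

definition curvature_at :: "('a, 'n::finite) chart set \<Rightarrow> ('a, 'n) metric \<Rightarrow> 'a \<Rightarrow>
    ('a, 'n) tvec \<Rightarrow> ('a, 'n) tvec \<Rightarrow> ('a, 'n) tvec \<Rightarrow> ('a, 'n) tvec" where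
  "curvature_at A g p x y z = curvature A g (vf_ext A p x) (vf_ext A p y) (vf_ext A p z) p"

text \<open>Trace of an endomorphism of the tangent space, and trace of a bilinear form with respect
  to the metric, computed in coordinates at \<open>p\<close>.\<close>

definition trace_endo ::
  "('a, 'n::finite) chart set \<Rightarrow> 'a \<Rightarrow> (('a, 'n) tvec \<Rightarrow> ('a, 'n) tvec) \<Rightarrow> real" where
  "trace_endo A p F = (let c = chart_at A p in \<Sum>i\<in>UNIV. F (coord_vec A c p i) c $ i)"

definition trace_metric :: "('a, 'n::finite) chart set \<Rightarrow> ('a, 'n) metric \<Rightarrow> 'a \<Rightarrow>
    (('a, 'n) tvec \<Rightarrow> ('a, 'n) tvec \<Rightarrow> real) \<Rightarrow> real" where
  "trace_metric A g p B = (let c = chart_at A p in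
     \<Sum>i\<in>UNIV. \<Sum>j\<in>UNIV. matrix_inv (gram A g c p) $ i $ j * B (coord_vec A c p i) (coord_vec A c p j))"

definition ricci :: "('a, 'n::finite) chart set \<Rightarrow> ('a, 'n) metric \<Rightarrow> 'a \<Rightarrow>
    ('a, 'n) tvec \<Rightarrow> ('a, 'n) tvec \<Rightarrow> real" where
  "ricci A g p x y = trace_endo A p (\<lambda>z. curvature_at A g p x z y)"

definition star_ricci :: "('a, 'n::finite) chart set \<Rightarrow> ('a, 'n) metric \<Rightarrow> ('a, 'n) endo \<Rightarrow> 'a \<Rightarrow>
    ('a, 'n) tvec \<Rightarrow> ('a, 'n) tvec \<Rightarrow> real" where
  "star_ricci A g J p x y = trace_endo A p (\<lambda>z. - J p (curvature_at A g p x z (J p y)))"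

definition scalar_curvature :: "('a, 'n::finite) chart set \<Rightarrow> ('a, 'n) metric \<Rightarrow> 'a \<Rightarrow> real" where
  "scalar_curvature A g p = trace_metric A g p (ricci A g p)"

definition star_scalar_curvature ::
  "('a, 'n::finite) chart set \<Rightarrow> ('a, 'n) metric \<Rightarrow> ('a, 'n) endo \<Rightarrow> 'a \<Rightarrow> real" where
  "star_scalar_curvature A g J p = trace_metric A g p (star_ricci A g J p)"

definition holomorphic_d_scalar ::
  "('a, 'n::finite) chart set \<Rightarrow> ('a, 'n) metric \<Rightarrow> ('a, 'n) endo \<Rightarrow> 'a \<Rightarrow> real" where
  "holomorphic_d_scalar A g J p = scalar_curvature A g p - star_scalar_curvature A g J p"


section \<open>The Yamabe-type constant\<close>

text \<open>The Riemannian measure is determined by having the density \<open>sqrt (det g\<^sub>i\<^sub>j)\<close> in every chart;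
  no orientation is needed.\<close>

definition riemannian_measure ::
  "('a::topological_space, 'n::finite) chart set \<Rightarrow> ('a, 'n) metric \<Rightarrow> 'a measure" where
  "riemannian_measure A g = (THE \<mu>. sets \<mu> = sets borel \<and>
     (\<forall>c\<in>A. \<forall>B\<in>sets borel. B \<subseteq> fst c \<longrightarrow>
        emeasure \<mu> B =
          (\<integral>\<^sup>+x\<in>snd c ` B. ennreal (sqrt (det (gram A g c (chart_inv c x)))) \<partial>lborel)))"

text \<open>The squared norm of the covector \<open>du\<close> is the metric trace of \<open>du \<otimes> du\<close>.\<close>

definition grad_norm_sq :: "('a, 'n::finite) chart set \<Rightarrow> ('a, 'n) metric \<Rightarrow> ('a \<Rightarrow> real) \<Rightarrow> 'a \<Rightarrow> real" where
  "grad_norm_sq A g u p =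
     trace_metric A g p (\<lambda>v w. differential A u p v * differential A u p w)"

definition Lp_norm :: "'a measure \<Rightarrow> real \<Rightarrow> ('a \<Rightarrow> real) \<Rightarrow> real" where
  "Lp_norm \<mu> s u = (\<integral>x. \<bar>u x\<bar> powr s \<partial>\<mu>) powr (1 / s)"

definition yamabe_quotient :: "('a::topological_space, 'n::finite) chart set \<Rightarrow> ('a, 'n) metric \<Rightarrow>
    ('a, 'n) endo \<Rightarrow> ('a \<Rightarrow> real) \<Rightarrow> real" where
  "yamabe_quotient A g J u =
     (let \<mu> = riemannian_measure A g; n = real CARD('n)
      in (\<integral>x. 4 * grad_norm_sq A g u x + holomorphic_d_scalar A g J x * (u x)\<^sup>2 \<partial>\<mu>)
         / (Lp_norm \<mu> (2 * n / (n - 2)) u)\<^sup>2)"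

text \<open>Taken in \<^typ>\<open>ereal\<close>, so that the infimum is meaningful without a boundedness proof.\<close>

definition yamabe_constant :: "('a::topological_space, 'n::finite) chart set \<Rightarrow> ('a, 'n) metric \<Rightarrow>
    ('a, 'n) endo \<Rightarrow> ereal" where
  "yamabe_constant A g J =
     (INF u\<in>{u. smooth_fun A u \<and> (\<forall>x. u x > 0)}. ereal (yamabe_quotient A g J u))"

end

(* Suppose J is integrable. Commuting covariant derivatives past J gives
     S_J = 2 div W + |W|^2 - sum_ij g((D_i J) e_j, (D_j J) e_i),   W = J sum_i (D_i J) e_i,
   for every almost Hermitian metric. Integrability means D_{JX} J = J D_X J, and then the last sum
   is zero. Hence 4 |du|^2 + S_J u^2 = |2 grad u - u W|^2 + div (2 u^2 W), so the numerator of the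
   Yamabe quotient is nonnegative by the divergence theorem, and Y(M, g, J) cannot be negative. *)

theory Submission
  imports Defs "HOL-Combinatorics.Permutations"
begin

section \<open>Calculus of smooth functions\<close>

text \<open>The connection and the measure enter the definitions through \<open>SOME\<close> and
  \<open>THE\<close>, so existence and uniqueness of both must be proved before curvature or
  integrals have a known value. In each chart the metric and the almost complex structure are matrix
  fields on an open subset of R^n, and the formula for S_J becomes an identity between matrix
  products, their derivatives and traces. Raising an index turns J (D_a J) into a skew matrix, so a
  Christoffel term of its contraction cancels by symmetry and an honest divergence remains. W is a
  global field because it is built from the metric trace of the tensor D J. The divergence theorem
  is localised by a partition of unity: the integrand dominates pointwise a sum of divergences of
  fields supported in single charts, each with integral zero. Only this inequality is integrated, so
  no regularity of S_J has to be established: a non-integrable integrand has Bochner integral 0,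
  which is nonnegative as well.\<close>

definition pd :: "'n::finite \<Rightarrow> (real ^ 'n \<Rightarrow> 'b::real_normed_vector) \<Rightarrow> real ^ 'n \<Rightarrow> 'b" where
  "pd i f x = frechet_derivative f (at x) (axis i 1)"

lemma frechet_derivative_cong_open:
  fixes f :: "'a::real_normed_vector \<Rightarrow> 'b::real_normed_vector"
  assumes "open S" "x \<in> S" "\<And>y. y \<in> S \<Longrightarrow> f y = g y"
  shows "frechet_derivative f (at x) = frechet_derivative g (at x)"
proof -
  have "(f has_derivative D) (at x) \<longleftrightarrow> (g has_derivative D) (at x)" for D
    using assms by (metis has_derivative_transform_within_open)
  then show ?thesis
    by (simp add: frechet_derivative_def)
qed

lemma pd_cong:
  assumes "open S" "x \<in> S" "\<And>y. y \<in> S \<Longrightarrow> f y = g y"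
  shows "pd i f x = pd i g x"
  by (simp add: pd_def frechet_derivative_cong_open[OF assms])

lemma frechet_derivative_has_derivative:
  "f differentiable (at x) \<Longrightarrow> (f has_derivative frechet_derivative f (at x)) (at x)"
  using frechet_derivative_works by blast

lemma pd_has_derivative: "(f has_derivative D) (at x) \<Longrightarrow> pd i f x = D (axis i 1)"
  by (metis frechet_derivative_at pd_def)

lemma linear_sum_axis:
  fixes D :: "real ^ 'n::finite \<Rightarrow> 'b::real_vector"
  assumes "linear D"
  shows "D v = (\<Sum>i\<in>UNIV. v $ i *\<^sub>R D (axis i 1))"
proof -
  have "D v = D (\<Sum>i\<in>UNIV. v $ i *\<^sub>R axis i 1)"
    using basis_expansion[of v] by (simp add: scalar_mult_eq_scaleR)
  then show ?thesis
    by (simp add: linear_sum[OF assms] linear_cmul[OF assms])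
qed

lemma frechet_derivative_pd:
  assumes "f differentiable (at x)"
  shows "frechet_derivative f (at x) v = (\<Sum>i\<in>UNIV. v $ i *\<^sub>R pd i f x)"
  unfolding pd_def using assms
  by (intro linear_sum_axis) (simp add: linear_frechet_derivative)

lemma pd_const [simp]: "pd i (\<lambda>x. c) x = 0"
  by (simp add: pd_def)

lemma pd_add:
  assumes "f differentiable (at x)" "g differentiable (at x)"
  shows "pd i (\<lambda>x. f x + g x) x = pd i f x + pd i g x"
proof -
  have "(f has_derivative frechet_derivative f (at x)) (at x)" "(g has_derivative frechet_derivative g (at x)) (at x)"
    using assms frechet_derivative_works by blast+
  from pd_has_derivative[OF has_derivative_add[OF this]] show ?thesis
    by (simp add: pd_def)
qed

lemma pd_bounded_linear:
  assumes "bounded_linear L" "f differentiable (at x)"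
  shows "pd i (\<lambda>x. L (f x)) x = L (pd i f x)"
proof -
  have "(f has_derivative frechet_derivative f (at x)) (at x)"
    using assms(2) frechet_derivative_works by blast
  from pd_has_derivative[OF bounded_linear.has_derivative[OF assms(1) this]] show ?thesis
    by (simp add: pd_def)
qed

lemma pd_bilinear:
  assumes "bounded_bilinear BB" "f differentiable (at x)" "g differentiable (at x)"
  shows "pd i (\<lambda>x. BB (f x) (g x)) x = BB (pd i f x) (g x) + BB (f x) (pd i g x)"
proof -
  have "(f has_derivative frechet_derivative f (at x)) (at x)" "(g has_derivative frechet_derivative g (at x)) (at x)"
    using assms(2,3) frechet_derivative_works by blast+
  from pd_has_derivative[OF bounded_bilinear.FDERIV[OF assms(1) this]] show ?thesis
    by (simp add: pd_def)
qed

lemma pd_sum: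
  assumes "\<And>a. a \<in> I \<Longrightarrow> f a differentiable (at x)"
  shows "pd i (\<lambda>x. \<Sum>a\<in>I. f a x) x = (\<Sum>a\<in>I. pd i (f a) x)"
proof -
  have "((\<lambda>x. \<Sum>a\<in>I. f a x) has_derivative (\<lambda>v. \<Sum>a\<in>I. frechet_derivative (f a) (at x) v)) (at x)"
    using assms by (intro has_derivative_sum frechet_derivative_has_derivative)
  from pd_has_derivative[OF this] show ?thesis
    by (simp add: pd_def)
qed

lemma pd_compose:
  fixes f :: "real ^ 'm::finite \<Rightarrow> 'b::real_normed_vector" and t :: "real ^ 'n::finite \<Rightarrow> real ^ 'm"
  assumes "t differentiable (at x)" "f differentiable (at (t x))"
  shows "pd i (\<lambda>x. f (t x)) x = (\<Sum>j\<in>UNIV. pd i t x $ j *\<^sub>R pd j f (t x))"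
proof -
  have "((f \<circ> t) has_derivative (frechet_derivative f (at (t x)) \<circ> frechet_derivative t (at x))) (at x)"
    using assms by (intro diff_chain_at frechet_derivative_has_derivative)
  from pd_has_derivative[OF this, of i] show ?thesis
    using frechet_derivative_pd[OF assms(2), of "pd i t x"] by (simp add: o_def pd_def)
qed

section \<open>Functions of class C^k on open sets\<close>

lemma Ck_on_Suc:
  assumes "open S"
  shows "Ck_on (Suc k) S f \<longleftrightarrow> (\<forall>x\<in>S. f differentiable (at x)) \<and> (\<forall>i. Ck_on k S (pd i f))"
  using assms by (simp add: differentiable_on_eq_differentiable_at pd_def[abs_def])

declare Ck_on.simps(2) [simp del]

lemma Ck_on_cong:
  assumes "open S" "\<And>x. x \<in> S \<Longrightarrow> f x = g x"
  shows "Ck_on k S f \<longleftrightarrow> Ck_on k S g"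
  using assms(2)
proof (induction k arbitrary: f g)
  case 0
  then show ?case by (simp cong: continuous_on_cong)
next
  case (Suc k)
  have "f differentiable (at x) \<longleftrightarrow> g differentiable (at x)" if "x \<in> S" for x
  proof -
    have "(f has_derivative D) (at x) \<longleftrightarrow> (g has_derivative D) (at x)" for D
      using has_derivative_transform_within_open[OF _ assms(1) that] Suc.prems by metis
    then show ?thesis
      by (simp add: differentiable_def)
  qed
  moreover have "Ck_on k S (pd i f) \<longleftrightarrow> Ck_on k S (pd i g)" for i
    by (rule Suc.IH) (rule pd_cong[OF assms(1)], simp_all add: Suc.prems)
  ultimately show ?case
    by (simp add: Ck_on_Suc[OF assms(1)])
qed

lemma Ck_on_SucD: "open S \<Longrightarrow> Ck_on (Suc k) S f \<Longrightarrow> Ck_on k S f"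
proof (induction k arbitrary: f)
  case 0
  then show ?case
    by (simp add: Ck_on_Suc continuous_at_imp_continuous_on differentiable_imp_continuous_within)
next
  case (Suc k)
  then show ?case by (simp add: Ck_on_Suc)
qed

text \<open>Serves functions glued from pieces, in particular extensions by zero.\<close>

lemma Ck_on_local:
  assumes "open S" "\<And>x. x \<in> S \<Longrightarrow> \<exists>T. open T \<and> x \<in> T \<and> T \<subseteq> S \<and> Ck_on k T f"
  shows "Ck_on k S f"
  using assms(2)
proof (induction k arbitrary: f)
  case 0
  have "isCont f x" if "x \<in> S" for x
    using 0[OF that] by (auto simp: continuous_on_eq_continuous_at)
  then show ?case
    by (simp add: continuous_at_imp_continuous_on)
next
  case (Suc k)
  have "f differentiable (at x)" if "x \<in> S" for x
    using Suc.prems[OF that] by (auto simp: Ck_on_Suc)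
  moreover have "Ck_on k S (pd i f)" for i
  proof (rule Suc.IH)
    fix x assume "x \<in> S"
    from Suc.prems[OF this] show "\<exists>T. open T \<and> x \<in> T \<and> T \<subseteq> S \<and> Ck_on k T (pd i f)"
      by (auto simp: Ck_on_Suc)
  qed
  ultimately show ?case
    by (simp add: Ck_on_Suc[OF assms(1)])
qed

lemma Ck_on_const: "open S \<Longrightarrow> Ck_on k S (\<lambda>x. c)"
  by (induction k arbitrary: c) (simp_all add: Ck_on_Suc pd_def[abs_def])

lemma Ck_on_add: "open S \<Longrightarrow> Ck_on k S f \<Longrightarrow> Ck_on k S g \<Longrightarrow> Ck_on k S (\<lambda>x. f x + g x)"
proof (induction k arbitrary: f g)
  case 0
  then show ?case by (simp add: continuous_on_add)
next
  case (Suc k)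
  have "Ck_on k S (pd i (\<lambda>x. f x + g x))" for i
  proof -
    have "Ck_on k S (\<lambda>x. pd i f x + pd i g x)"
      using Suc by (simp add: Ck_on_Suc)
    then show ?thesis
      using Suc.prems by (subst Ck_on_cong[where g = "\<lambda>x. pd i f x + pd i g x"]) (auto simp: pd_add Ck_on_Suc)
  qed
  then show ?case
    using Suc.prems by (simp add: Ck_on_Suc differentiable_add)
qed

lemma Ck_on_bounded_linear:
  assumes "bounded_linear L"
  shows "open S \<Longrightarrow> Ck_on k S f \<Longrightarrow> Ck_on k S (\<lambda>x. L (f x))"
proof (induction k arbitrary: f)
  case 0
  then show ?case using assms by (simp add: bounded_linear.continuous_on)
next
  case (Suc k)
  have "Ck_on k S (pd i (\<lambda>x. L (f x)))" for i
  proof -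
    have "Ck_on k S (\<lambda>x. L (pd i f x))"
      using Suc by (simp add: Ck_on_Suc)
    then show ?thesis
      using Suc.prems by (subst Ck_on_cong[where g = "\<lambda>x. L (pd i f x)"]) (auto simp: pd_bounded_linear assms Ck_on_Suc)
  qed
  moreover have "(\<lambda>x. L (f x)) differentiable (at x)" if "x \<in> S" for x
    using Suc.prems that bounded_linear.has_derivative[OF assms, of f _ "at x"]
    unfolding Ck_on_Suc[OF Suc.prems(1)] differentiable_def by blast
  ultimately show ?case
    using Suc.prems by (simp add: Ck_on_Suc)
qed

text \<open>One Leibniz rule for every product in use: of reals, scalar with vector, inner product,
  matrix with matrix, matrix with vector.\<close>

lemma Ck_on_bilinear:
  assumes "bounded_bilinear BB"
  shows "open S \<Longrightarrow> Ck_on k S f \<Longrightarrow> Ck_on k S g \<Longrightarrow> Ck_on k S (\<lambda>x. BB (f x) (g x))"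
proof (induction k arbitrary: f g)
  case 0
  then show ?case using assms by (simp add: bounded_bilinear.continuous_on)
next
  case (Suc k)
  have "Ck_on k S (pd i (\<lambda>x. BB (f x) (g x)))" for i
  proof -
    have "Ck_on k S (\<lambda>x. BB (pd i f x) (g x) + BB (f x) (pd i g x))"
      \<comment> \<open>In each summand of the Leibniz rule one factor is differentiated and the
        other is lowered from class k + 1 to class k, so the induction hypothesis at k
        applies.\<close>
      using Suc.prems Ck_on_SucD[OF Suc.prems(1,2)] Ck_on_SucD[OF Suc.prems(1,3)]
      by (intro Ck_on_add Suc.IH) (auto simp: Ck_on_Suc)
    then show ?thesis
      using Suc.prems by (subst Ck_on_cong[where g = "\<lambda>x. BB (pd i f x) (g x) + BB (f x) (pd i g x)"])
        (auto simp: pd_bilinear assms Ck_on_Suc)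
  qed
  moreover have "(\<lambda>x. BB (f x) (g x)) differentiable (at x)" if "x \<in> S" for x
    using Suc.prems that bounded_bilinear.FDERIV[OF assms, of f _ x UNIV g]
    unfolding Ck_on_Suc[OF Suc.prems(1)] differentiable_def by blast
  ultimately show ?case
    using Suc.prems by (simp add: Ck_on_Suc)
qed

lemma Ck_on_sum:
  "open S \<Longrightarrow> (\<And>a. a \<in> I \<Longrightarrow> Ck_on k S (f a)) \<Longrightarrow> Ck_on k S (\<lambda>x. \<Sum>a\<in>I. f a x)"
  by (induction I rule: infinite_finite_induct) (auto intro: Ck_on_const Ck_on_add)

text \<open>The chain rule gives a sum of products of \<open>pd i t\<close> with
  \<open>pd j f\<close> composed with \<open>t\<close>. The induction therefore varies
  \<open>f\<close> and keeps \<open>t\<close> fixed, lowering the class of \<open>t\<close> by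
  one.\<close>

lemma Ck_on_compose:
  fixes f :: "real ^ 'm::finite \<Rightarrow> 'b::real_normed_vector" and t :: "real ^ 'n::finite \<Rightarrow> real ^ 'm"
  assumes "open S" "open T" "t ` S \<subseteq> T"
  shows "Ck_on k T f \<Longrightarrow> Ck_on k S t \<Longrightarrow> Ck_on k S (\<lambda>x. f (t x))"
proof (induction k arbitrary: f)
  case 0
  then show ?case using assms by (auto intro: continuous_on_compose2)
next
  case (Suc k)
  have d: "t differentiable (at x)" "f differentiable (at (t x))" if "x \<in> S" for x
    using Suc.prems that assms by (auto simp: Ck_on_Suc)
  have "Ck_on k S (pd i (\<lambda>x. f (t x)))" for i
  proof -
    have "Ck_on k S (\<lambda>x. pd i t x $ j)" for j
      using Suc.prems assms(1) by (intro Ck_on_bounded_linear[OF bounded_linear_vec_nth]) (auto simp: Ck_on_Suc)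
    then have "Ck_on k S (\<lambda>x. \<Sum>j\<in>UNIV. pd i t x $ j *\<^sub>R pd j f (t x))"
      using Suc.prems Ck_on_SucD[OF assms(1) Suc.prems(2)] assms
      by (intro Ck_on_sum Ck_on_bilinear[OF bounded_bilinear_scaleR] Suc.IH) (auto simp: Ck_on_Suc)
    then show ?thesis
      using d by (subst Ck_on_cong[OF assms(1), where g = "\<lambda>x. \<Sum>j\<in>UNIV. pd i t x $ j *\<^sub>R pd j f (t x)"])
        (auto simp: pd_compose)
  qed
  moreover have "(\<lambda>x. f (t x)) differentiable (at x)" if "x \<in> S" for x
    using differentiable_chain_at[OF d[OF that]] by (simp add: o_def)
  ultimately show ?case
    using assms by (simp add: Ck_on_Suc)
qed

text \<open>The derivative of 1/f is again a product of 1/f with itself and a derivative of f, so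
  induction on the class closes.\<close>

lemma Ck_on_inverse:
  fixes f :: "real ^ 'n::finite \<Rightarrow> real"
  assumes "open S" "\<And>x. x \<in> S \<Longrightarrow> f x \<noteq> 0"
  shows "Ck_on k S f \<Longrightarrow> Ck_on k S (\<lambda>x. inverse (f x))"
proof (induction k)
  case 0
  then show ?case using assms by (auto intro: continuous_on_inverse)
next
  case (Suc k)
  have d: "((\<lambda>x. inverse (f x)) has_derivative (\<lambda>v. - (inverse (f x) * frechet_derivative f (at x) v * inverse (f x)))) (at x)"
    if "x \<in> S" for x
    using Suc.prems that assms
    by (intro Deriv.has_derivative_inverse[OF _ frechet_derivative_has_derivative]) (auto simp: Ck_on_Suc)
  have IH: "Ck_on k S (\<lambda>x. inverse (f x))"
    using Suc Ck_on_SucD assms(1) by blast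
  have "Ck_on k S (pd i (\<lambda>x. inverse (f x)))" for i
  proof -
    have "Ck_on k S (\<lambda>x. (- 1) * (inverse (f x) * pd i f x * inverse (f x)))"
      using Suc.prems IH assms by (intro Ck_on_bilinear[OF bounded_bilinear_mult] Ck_on_const) (auto simp: Ck_on_Suc)
    then show ?thesis
      using pd_has_derivative[OF d] by (subst Ck_on_cong[OF assms(1), where g = "\<lambda>x. (- 1) * (inverse (f x) * pd i f x * inverse (f x))"])
        (auto simp: pd_def)
  qed
  then show ?case
    using d assms(1) by (auto simp: Ck_on_Suc differentiable_def)
qed

section \<open>Smooth functions and smooth matrix fields\<close>

named_theorems smooth_intros

lemma smooth_onI_Ck: "(\<And>k. Ck_on k S f) \<Longrightarrow> smooth_on S f"
  by (simp add: smooth_on_def)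

lemma smooth_on_cong:
  "open S \<Longrightarrow> (\<And>x. x \<in> S \<Longrightarrow> f x = g x) \<Longrightarrow> smooth_on S f \<longleftrightarrow> smooth_on S g"
  unfolding smooth_on_def using Ck_on_cong by blast

lemma smooth_on_local:
  assumes "open S" "\<And>x. x \<in> S \<Longrightarrow> \<exists>T. open T \<and> x \<in> T \<and> T \<subseteq> S \<and> smooth_on T f"
  shows "smooth_on S f"
  unfolding smooth_on_def using assms by (meson Ck_on_local smooth_on_def)

lemma smooth_on_differentiable: "smooth_on S f \<Longrightarrow> open S \<Longrightarrow> x \<in> S \<Longrightarrow> f differentiable (at x)"
  unfolding smooth_on_def using Ck_on_Suc by blast

lemma smooth_on_continuous: "smooth_on S f \<Longrightarrow> continuous_on S f"
  unfolding smooth_on_def using Ck_on.simps(1) by blast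

lemma smooth_on_pd: "smooth_on S f \<Longrightarrow> open S \<Longrightarrow> smooth_on S (pd i f)"
  unfolding smooth_on_def using Ck_on_Suc by blast

lemma smooth_on_const: "open S \<Longrightarrow> smooth_on S (\<lambda>x. c)"
  by (simp add: smooth_on_def Ck_on_const)

lemma smooth_on_bounded_linear: "bounded_linear L \<Longrightarrow> open S \<Longrightarrow> smooth_on S f \<Longrightarrow> smooth_on S (\<lambda>x. L (f x))"
  by (simp add: smooth_on_def Ck_on_bounded_linear)

lemma smooth_on_bilinear:
  "bounded_bilinear BB \<Longrightarrow> open S \<Longrightarrow> smooth_on S f \<Longrightarrow> smooth_on S g \<Longrightarrow> smooth_on S (\<lambda>x. BB (f x) (g x))"
  by (simp add: smooth_on_def Ck_on_bilinear)

lemma smooth_on_add: "open S \<Longrightarrow> smooth_on S f \<Longrightarrow> smooth_on S g \<Longrightarrow> smooth_on S (\<lambda>x. f x + g x)"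
  by (simp add: smooth_on_def Ck_on_add)

lemma smooth_on_minus: "open S \<Longrightarrow> smooth_on S f \<Longrightarrow> smooth_on S (\<lambda>x. - f x)"
  using smooth_on_bounded_linear[OF bounded_linear_minus[OF bounded_linear_ident]] .

lemma smooth_on_diff: "open S \<Longrightarrow> smooth_on S f \<Longrightarrow> smooth_on S g \<Longrightarrow> smooth_on S (\<lambda>x. f x - g x)"
  using smooth_on_add[of S f "\<lambda>x. - g x"] smooth_on_minus[of S g] by simp

lemma smooth_on_sum:
  "open S \<Longrightarrow> (\<And>a. a \<in> I \<Longrightarrow> smooth_on S (f a)) \<Longrightarrow> smooth_on S (\<lambda>x. \<Sum>a\<in>I. f a x)"
  by (simp add: smooth_on_def Ck_on_sum)

lemma smooth_on_compose:
  "open S \<Longrightarrow> open T \<Longrightarrow> t ` S \<subseteq> T \<Longrightarrow> smooth_on T f \<Longrightarrow> smooth_on S t \<Longrightarrow> smooth_on S (\<lambda>x. f (t x))"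
  by (simp add: smooth_on_def Ck_on_compose)

lemma smooth_on_inverse:
  fixes f :: "real ^ 'n::finite \<Rightarrow> real"
  shows "open S \<Longrightarrow> (\<And>x. x \<in> S \<Longrightarrow> f x \<noteq> 0) \<Longrightarrow> smooth_on S f \<Longrightarrow> smooth_on S (\<lambda>x. inverse (f x))"
  by (simp add: smooth_on_def Ck_on_inverse)

lemma smooth_on_divide:
  fixes f :: "real ^ 'n::finite \<Rightarrow> real"
  shows "open S \<Longrightarrow> (\<And>x. x \<in> S \<Longrightarrow> g x \<noteq> 0) \<Longrightarrow> smooth_on S f \<Longrightarrow> smooth_on S g \<Longrightarrow> smooth_on S (\<lambda>x. f x / g x)"
  unfolding divide_inverse by (intro smooth_on_bilinear[OF bounded_bilinear_mult] smooth_on_inverse)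

lemma smooth_on_mult:
  fixes f :: "real ^ 'n::finite \<Rightarrow> real"
  shows "open S \<Longrightarrow> smooth_on S f \<Longrightarrow> smooth_on S g \<Longrightarrow> smooth_on S (\<lambda>x. f x * g x)"
  by (rule smooth_on_bilinear[OF bounded_bilinear_mult])

lemma smooth_on_power:
  fixes f :: "real ^ 'n::finite \<Rightarrow> real"
  shows "open S \<Longrightarrow> smooth_on S f \<Longrightarrow> smooth_on S (\<lambda>x. f x ^ k)"
  by (induction k) (auto intro: smooth_on_const smooth_on_mult)

lemma smooth_on_scaleR:
  "open S \<Longrightarrow> smooth_on S f \<Longrightarrow> smooth_on S g \<Longrightarrow> smooth_on S (\<lambda>x. f x *\<^sub>R g x)"
  by (rule smooth_on_bilinear[OF bounded_bilinear_scaleR])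

lemma smooth_on_prod:
  fixes f :: "'i \<Rightarrow> real ^ 'n::finite \<Rightarrow> real"
  shows "open S \<Longrightarrow> (\<And>a. a \<in> I \<Longrightarrow> smooth_on S (f a)) \<Longrightarrow> smooth_on S (\<lambda>x. \<Prod>a\<in>I. f a x)"
  by (induction I rule: infinite_finite_induct) (auto intro: smooth_on_const smooth_on_mult)

lemma smooth_on_vec_nth:
  "open S \<Longrightarrow> smooth_on S f \<Longrightarrow> smooth_on S (\<lambda>x. f x $ i)"
  by (rule smooth_on_bounded_linear[OF bounded_linear_vec_nth])

lemma bounded_linear_axis: "bounded_linear (axis i :: 'b::real_normed_vector \<Rightarrow> 'b ^ 'm::finite)"
proof (rule bounded_linear_intro[where K = 1])
  show "axis i (x + y) = axis i x + axis i y" for x y :: 'b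
    by (simp add: vec_eq_iff axis_def)
  show "axis i (r *\<^sub>R x) = r *\<^sub>R axis i x" for r and x :: 'b
    by (simp add: vec_eq_iff axis_def)
  show "norm (axis i x :: 'b ^ 'm) \<le> norm x * 1" for x :: 'b
  proof -
    have "norm (axis i x :: 'b ^ 'm) \<le> (\<Sum>j\<in>UNIV. norm ((axis i x :: 'b ^ 'm) $ j))"
      unfolding norm_vec_def by (rule L2_set_le_sum) simp
    also have "\<dots> = (\<Sum>j\<in>UNIV. if j = i then norm x else 0)"
      by (intro sum.cong) (auto simp: axis_def)
    finally show ?thesis by simp
  qed
qed

text \<open>The vector is a finite sum of its components moved into place by the bounded linear maps
  \<open>axis i\<close>. The components may lie in any normed space, so nested use covers
  matrices.\<close>

lemma smooth_on_vec_lambda: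
  assumes "open S" "\<And>i. smooth_on S (\<lambda>x. f x i)"
  shows "smooth_on S (\<lambda>x. \<chi> i. f x i)"
proof -
  have "(\<lambda>x. \<chi> i. f x i) = (\<lambda>x. \<Sum>i\<in>UNIV. axis i (f x i))"
    by (auto simp: fun_eq_iff vec_eq_iff axis_def if_distrib cong: if_cong)
  then show ?thesis
    using assms by (simp add: smooth_on_sum smooth_on_bounded_linear[OF bounded_linear_axis])
qed

lemma smooth_on_id: "open S \<Longrightarrow> smooth_on S (\<lambda>x. x :: real ^ 'n::finite)"
proof (rule smooth_onI_Ck)
  fix k assume "open S"
  have "pd i (\<lambda>x::real ^ 'n. x) = (\<lambda>x. axis i 1)" for i
    by (simp add: fun_eq_iff pd_def)
  with \<open>open S\<close> show "Ck_on k S (\<lambda>x. x :: real ^ 'n)"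
    by (cases k) (auto simp: Ck_on_Suc Ck_on_const)
qed

lemma bounded_bilinear_matrix_matrix_mult:
  "bounded_bilinear ((**) :: real ^ 'm::finite ^ 'k::finite \<Rightarrow> real ^ 'n::finite ^ 'm \<Rightarrow> real ^ 'n ^ 'k)"
  by (rule bilinear_conv_bounded_bilinear[THEN iffD1])
    (auto simp: bilinear_def linear_iff matrix_add_ldistrib matrix_matrix_mult_def vec_eq_iff
      sum.distrib sum_distrib_left algebra_simps)

lemma bounded_bilinear_matrix_vector_mult:
  "bounded_bilinear ((*v) :: real ^ 'm::finite ^ 'k::finite \<Rightarrow> real ^ 'm \<Rightarrow> real ^ 'k)"
  by (rule bilinear_conv_bounded_bilinear[THEN iffD1])
    (auto simp: bilinear_def linear_iff matrix_vector_mult_def vec_eq_iff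
      sum.distrib sum_distrib_left algebra_simps)

lemma bounded_linear_transpose: "bounded_linear (transpose :: real ^ 'm::finite ^ 'k::finite \<Rightarrow> _)"
  by (rule linear_conv_bounded_linear[THEN iffD1]) (auto simp: linear_iff transpose_def vec_eq_iff)

lemmas smooth_on_matrix_mult = smooth_on_bilinear[OF bounded_bilinear_matrix_matrix_mult]
lemmas smooth_on_matrix_vector_mult = smooth_on_bilinear[OF bounded_bilinear_matrix_vector_mult]
lemmas smooth_on_transpose = smooth_on_bounded_linear[OF bounded_linear_transpose]

lemmas [smooth_intros] = smooth_on_const smooth_on_add smooth_on_minus smooth_on_diff smooth_on_sum
  smooth_on_divide smooth_on_mult smooth_on_power smooth_on_scaleR smooth_on_prod smooth_on_vec_nth smooth_on_vec_lambda
  smooth_on_id smooth_on_matrix_mult smooth_on_matrix_vector_mult smooth_on_transpose smooth_on_pd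

lemma smooth_on_det [smooth_intros]:
  fixes G :: "real ^ 'n::finite \<Rightarrow> real ^ 'm::finite ^ 'm"
  assumes "open S" "smooth_on S G"
  shows "smooth_on S (\<lambda>x. det (G x))"
  unfolding det_def using assms by (auto intro!: smooth_intros)

lemma matrix_inv_mult:
  fixes G :: "real ^ 'n::finite ^ 'n"
  assumes "det G \<noteq> 0"
  shows "matrix_inv G ** G = mat 1" "G ** matrix_inv G = mat 1"
  using someI_ex[of "\<lambda>A'. G ** A' = mat 1 \<and> A' ** G = mat 1"] assms invertible_det_nz[of G]
  unfolding invertible_def matrix_inv_def by blast+

text \<open>Cramer's rule makes every entry of the inverse a quotient of determinants of smooth
  matrices.\<close>

lemma smooth_on_matrix_inv [smooth_intros]:
  fixes G :: "real ^ 'n::finite \<Rightarrow> real ^ 'm::finite ^ 'm"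
  assumes "open S" "smooth_on S G" "\<And>x. x \<in> S \<Longrightarrow> det (G x) \<noteq> 0"
  shows "smooth_on S (\<lambda>x. matrix_inv (G x))"
proof -
  let ?H = "\<lambda>x. \<chi> k j. det (\<chi> i l. if l = k then axis j 1 $ i else G x $ i $ l) / det (G x)"
  have "matrix_inv (G x) = ?H x" if "x \<in> S" for x
  proof -
    \<comment> \<open>Column \<open>j\<close> of the inverse solves the linear system with
      right-hand side \<open>axis j 1\<close>.\<close>
    have "matrix_inv (G x) *v axis j 1 = (\<chi> k. det (\<chi> i l. if l = k then axis j 1 $ i else G x $ i $ l) / det (G x))" for j
      using assms(3)[OF that]
      by (subst cramer[symmetric]) (simp_all add: matrix_vector_mul_assoc matrix_inv_mult)
    then show ?thesis
      by (simp add: vec_eq_iff matrix_vector_mult_basis column_def)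
  qed
  moreover have e: "smooth_on S (\<lambda>x. if l = k then axis j 1 $ i else G x $ i $ l)" for i j k l
    using assms by (cases "l = k") (auto intro!: smooth_intros)
  have "smooth_on S ?H"
    using assms by (intro smooth_intros e) auto
  ultimately show ?thesis
    using smooth_on_cong[OF assms(1), of "\<lambda>x. matrix_inv (G x)" ?H] by blast
qed

text \<open>The determinant is multilinear in the rows, so its derivative is the sum over
  \<open>i\<close> of the determinants with row \<open>i\<close> replaced by its derivative.\<close>

lemma has_derivative_det:
  fixes G :: "'a::real_normed_vector \<Rightarrow> real ^ 'n::finite ^ 'n"
  assumes "(G has_derivative D) (at x)"
  shows "((\<lambda>x. det (G x)) has_derivative (\<lambda>v. \<Sum>i\<in>UNIV. det (\<chi> a. if a = i then D v $ i else G x $ a))) (at x)"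
proof -
  have e: "((\<lambda>x. G x $ i $ j) has_derivative (\<lambda>v. D v $ i $ j)) (at x)" for i j
    using bounded_linear.has_derivative[OF bounded_linear_vec_nth bounded_linear.has_derivative[OF bounded_linear_vec_nth assms]] .
  let ?P = "{p. p permutes (UNIV :: 'n set)}"
  have "((\<lambda>x. det (G x)) has_derivative
      (\<lambda>v. \<Sum>p\<in>?P. of_int (sign p) * (\<Sum>i\<in>UNIV. D v $ i $ p i * (\<Prod>j\<in>UNIV - {i}. G x $ j $ p j)))) (at x)"
    unfolding det_def by (intro has_derivative_sum has_derivative_mult_right has_derivative_prod e)
  moreover have "(\<Sum>p\<in>?P. of_int (sign p) * (\<Sum>i\<in>UNIV. D v $ i $ p i * (\<Prod>j\<in>UNIV - {i}. G x $ j $ p j)))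
     = (\<Sum>i\<in>UNIV. det (\<chi> a. if a = i then D v $ i else G x $ a))" for v
  proof -
    have "(\<Prod>a\<in>UNIV. (\<chi> a. if a = i then D v $ i else G x $ a) $ a $ p a) =
        D v $ i $ p i * (\<Prod>j\<in>UNIV - {i}. G x $ j $ p j)" for i p
      by (subst prod.remove[of _ i]) (auto intro!: prod.cong)
    then show ?thesis
      unfolding det_def by (simp add: sum_distrib_left sum.swap[of _ UNIV])
  qed
  ultimately show ?thesis by simp
qed

text \<open>Jacobi's formula, proved by expanding the differentiated row in the rows of
  \<open>G x\<close>.\<close>

lemma pd_det:
  fixes G :: "real ^ 'n::finite \<Rightarrow> real ^ 'm::finite ^ 'm"
  assumes "G differentiable (at x)" "det (G x) \<noteq> 0"
  shows "pd k (\<lambda>x. det (G x)) x = det (G x) * trace (matrix_inv (G x) ** pd k G x)"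
proof -
  let ?H = "matrix_inv (G x)"
  \<comment> \<open>Since \<open>r = (r v* ?H) v* G x\<close>, the new row is a combination of the
    rows of \<open>G x\<close>, and only the coefficient of row \<open>i\<close> survives in the
    determinant.\<close>
  have row: "det (\<chi> a. if a = i then r else G x $ a) = (\<Sum>j\<in>UNIV. r $ j * ?H $ j $ i) * det (G x)" for i and r :: "real ^ 'm"
  proof -
    let ?y = "r v* ?H"
    have "(\<Sum>l\<in>UNIV. ?y $ l *s row l (G x)) = ?y v* G x"
      by (simp add: vec_eq_iff vector_matrix_mult_def row_def mult.commute)
    also have "\<dots> = r"
      by (simp add: vector_matrix_mul_assoc matrix_inv_mult[OF assms(2)])
    finally have "(\<chi> a. if a = i then r else G x $ a) =
        (\<chi> a. if a = i then (\<Sum>l\<in>UNIV. ?y $ l *s row l (G x)) else row a (G x))"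
      by (simp add: vec_eq_iff row_def)
    then show ?thesis
      using cramer_lemma_transpose[of i ?y "G x"]
      by (simp add: vector_matrix_mult_def mult.commute)
  qed
  have "(G has_derivative frechet_derivative G (at x)) (at x)"
    using assms(1) frechet_derivative_works by blast
  from pd_has_derivative[OF has_derivative_det[OF this], of k]
  have "pd k (\<lambda>x. det (G x)) x = (\<Sum>i\<in>UNIV. det (\<chi> a. if a = i then pd k G x $ i else G x $ a))"
    by (simp only: pd_def)
  also have "\<dots> = det (G x) * (\<Sum>i\<in>UNIV. \<Sum>j\<in>UNIV. ?H $ j $ i * pd k G x $ i $ j)"
    unfolding row by (simp add: sum_distrib_right mult.commute sum_distrib_left mult.left_commute)
  also have "(\<Sum>i\<in>UNIV. \<Sum>j\<in>UNIV. ?H $ j $ i * pd k G x $ i $ j) = trace (?H ** pd k G x)"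
    unfolding trace_def matrix_matrix_mult_def by (subst sum.swap) simp
  finally show ?thesis .
qed

section \<open>Symmetry of second partial derivatives\<close>

lemma has_real_derivative_line:
  fixes f :: "real ^ 'n::finite \<Rightarrow> real"
  assumes "f differentiable (at (y + s *\<^sub>R axis i 1))"
  shows "((\<lambda>s. f (y + s *\<^sub>R axis i 1)) has_real_derivative pd i f (y + s *\<^sub>R axis i 1)) (at s)"
proof -
  let ?l = "\<lambda>s. y + s *\<^sub>R axis i 1"
  have "(?l has_derivative (\<lambda>t. t *\<^sub>R axis i 1)) (at s)"
    by (auto intro!: derivative_eq_intros)
  then have "((f \<circ> ?l) has_derivative (frechet_derivative f (at (?l s)) \<circ> (\<lambda>t. t *\<^sub>R axis i 1))) (at s)"
    using assms by (intro diff_chain_at frechet_derivative_has_derivative)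
  moreover have "frechet_derivative f (at (?l s)) (t *\<^sub>R axis i 1) = t * pd i f (?l s)" for t
    using linear_cmul[OF linear_frechet_derivative[OF assms]] by (simp add: pd_def)
  ultimately show ?thesis
    by (simp add: has_field_derivative_def o_def mult.commute[of _ "pd i f (?l s)"])
qed

text \<open>Two applications of the mean value theorem, first in direction \<open>i\<close>, then in
  direction \<open>j\<close>. The left-hand side is symmetric in the directions and the right-hand
  side shows only one order of differentiation, which forces the two orders to agree in the
  limit.\<close>

lemma second_difference:
  fixes f :: "real ^ 'n::finite \<Rightarrow> real"
  assumes f: "smooth_on S f" "open S" and h: "0 < h" "ball x (3 * h) \<subseteq> S"
  shows "\<exists>y. dist y x < 3 * h \<and>
    f (x + h *\<^sub>R axis i 1 + h *\<^sub>R axis j 1) - f (x + h *\<^sub>R axis i 1) - f (x + h *\<^sub>R axis j 1) + f x = h * h * pd j (pd i f) y"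
proof -
  \<comment> \<open>The points reached are at most 2h away from \<open>x\<close>; the radius 3h
    makes the inequality strict.\<close>
  have inS: "x + s *\<^sub>R axis i 1 + t *\<^sub>R axis j 1 \<in> S \<and> dist (x + s *\<^sub>R axis i 1 + t *\<^sub>R axis j 1) x < 3 * h"
    if "0 \<le> s" "s \<le> h" "0 \<le> t" "t \<le> h" for s t
  proof -
    have "norm (s *\<^sub>R axis i 1 + t *\<^sub>R axis j 1 :: real ^ 'n) \<le> s + t"
      using that norm_triangle_ineq[of "s *\<^sub>R axis i 1 :: real ^ 'n" "t *\<^sub>R axis j 1"] by simp
    then have "dist (x + s *\<^sub>R axis i 1 + t *\<^sub>R axis j 1) x < 3 * h"
      using that h by (simp add: dist_norm algebra_simps)
    then show ?thesis
      using h by (auto simp: dist_commute)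
  qed
  have d: "f differentiable (at y)" "pd i f differentiable (at y)" if "y \<in> S" for y
    using smooth_on_differentiable[OF f that] smooth_on_differentiable[OF smooth_on_pd[OF f] f(2) that] by auto
  define F where "F = (\<lambda>s. f ((x + h *\<^sub>R axis j 1) + s *\<^sub>R axis i 1) - f (x + s *\<^sub>R axis i 1))"
  have "\<exists>s. 0 < s \<and> s < h \<and> F h - F 0 = (h - 0) *
      (pd i f ((x + h *\<^sub>R axis j 1) + s *\<^sub>R axis i 1) - pd i f (x + s *\<^sub>R axis i 1))"
  proof (rule MVT2[OF h(1)])
    fix s assume s: "0 \<le> s" "s \<le> h"
    show "(F has_real_derivative (pd i f ((x + h *\<^sub>R axis j 1) + s *\<^sub>R axis i 1) - pd i f (x + s *\<^sub>R axis i 1))) (at s)"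
      unfolding F_def using inS[of s h] inS[of s 0] s h
      by (intro DERIV_diff has_real_derivative_line d) (simp_all add: algebra_simps)
  qed
  then obtain s where s: "0 < s" "s < h" and Fs: "F h - F 0 = h *
      (pd i f ((x + h *\<^sub>R axis j 1) + s *\<^sub>R axis i 1) - pd i f (x + s *\<^sub>R axis i 1))"
    by auto
  have "\<exists>t. 0 < t \<and> t < h \<and> pd i f ((x + s *\<^sub>R axis i 1) + h *\<^sub>R axis j 1) - pd i f ((x + s *\<^sub>R axis i 1) + 0 *\<^sub>R axis j 1) =
       (h - 0) * pd j (pd i f) ((x + s *\<^sub>R axis i 1) + t *\<^sub>R axis j 1)"
    using inS[of s] s by (intro MVT2[OF h(1)] has_real_derivative_line d) auto
  then obtain t where t: "0 < t" "t < h" and ft: "pd i f ((x + s *\<^sub>R axis i 1) + h *\<^sub>R axis j 1) - pd i f (x + s *\<^sub>R axis i 1) =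
       h * pd j (pd i f) ((x + s *\<^sub>R axis i 1) + t *\<^sub>R axis j 1)"
    by auto
  have "dist (x + s *\<^sub>R axis i 1 + t *\<^sub>R axis j 1) x < 3 * h"
    using inS[of s t] s t by simp
  moreover have "F h - F 0 = h * h * pd j (pd i f) ((x + s *\<^sub>R axis i 1) + t *\<^sub>R axis j 1)"
    using Fs ft by (simp add: algebra_simps)
  ultimately show ?thesis
    unfolding F_def by (intro exI[of _ "x + s *\<^sub>R axis i 1 + t *\<^sub>R axis j 1"]) (auto simp: algebra_simps)
qed

lemma pd_commute_real:
  fixes f :: "real ^ 'n::finite \<Rightarrow> real"
  assumes f: "smooth_on S f" "open S" and x: "x \<in> S"
  shows "pd i (pd j f) x = pd j (pd i f) x"
proof (rule ccontr)
  assume ne: "pd i (pd j f) x \<noteq> pd j (pd i f) x"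
  \<comment> \<open>Half the gap: if both mixed derivatives move by less than \<open>e\<close> and
    then coincide, the gap is smaller than itself.\<close>
  define e where "e = \<bar>pd i (pd j f) x - pd j (pd i f) x\<bar> / 2"
  have e: "e > 0" using ne by (simp add: e_def)
  have c: "isCont (pd a (pd b f)) x" for a b
    using smooth_on_continuous[OF smooth_on_pd[OF smooth_on_pd[OF f] f(2)]] f(2) x
    by (simp add: continuous_on_eq_continuous_at)
  obtain d1 where d1: "d1 > 0" "\<And>y. dist y x < d1 \<Longrightarrow> \<bar>pd i (pd j f) y - pd i (pd j f) x\<bar> < e"
    using c[of i j] e unfolding continuous_at_eps_delta dist_real_def by blast
  obtain d2 where d2: "d2 > 0" "\<And>y. dist y x < d2 \<Longrightarrow> \<bar>pd j (pd i f) y - pd j (pd i f) x\<bar> < e"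
    using c[of j i] e unfolding continuous_at_eps_delta dist_real_def by blast
  obtain d3 where d3: "d3 > 0" "ball x d3 \<subseteq> S"
    using f(2) x open_contains_ball by blast
  define h where "h = min d1 (min d2 d3) / 3"
  have h: "h > 0" "ball x (3 * h) \<subseteq> S"
    using d1 d2 d3 by (auto simp: h_def)
  obtain y where y: "dist y x < 3 * h" "f (x + h *\<^sub>R axis i 1 + h *\<^sub>R axis j 1) - f (x + h *\<^sub>R axis i 1) - f (x + h *\<^sub>R axis j 1) + f x = h * h * pd j (pd i f) y"
    using second_difference[OF f h] by blast
  obtain z where z: "dist z x < 3 * h" "f (x + h *\<^sub>R axis j 1 + h *\<^sub>R axis i 1) - f (x + h *\<^sub>R axis j 1) - f (x + h *\<^sub>R axis i 1) + f x = h * h * pd i (pd j f) z"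
    using second_difference[OF f h] by blast
  have "h * h * pd j (pd i f) y = h * h * pd i (pd j f) z"
    using y(2) z(2) by (simp add: algebra_simps)
  then have "pd j (pd i f) y = pd i (pd j f) z"
    using h by simp
  moreover have "\<bar>pd j (pd i f) y - pd j (pd i f) x\<bar> < e" "\<bar>pd i (pd j f) z - pd i (pd j f) x\<bar> < e"
    using d1 d2 y z by (auto simp: h_def)
  ultimately show False
    by (simp add: e_def abs_if split: if_splits)
qed

lemma pd_vec_nth: "f differentiable (at x) \<Longrightarrow> pd i (\<lambda>x. f x $ k) x = pd i f x $ k"
  by (rule pd_bounded_linear[OF bounded_linear_vec_nth])

lemma pd_commute:
  fixes f :: "real ^ 'n::finite \<Rightarrow> real ^ 'm::finite"
  assumes f: "smooth_on S f" "open S" and x: "x \<in> S"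
  shows "pd i (pd j f) x = pd j (pd i f) x"
proof -
  have "pd a (pd b f) x $ k = pd a (pd b (\<lambda>x. f x $ k)) x" for a b k
  proof -
    have "pd a (pd b f) x $ k = pd a (\<lambda>x. pd b f x $ k) x"
      using smooth_on_differentiable[OF smooth_on_pd[OF f] f(2) x] by (simp add: pd_vec_nth)
    also have "\<dots> = pd a (pd b (\<lambda>x. f x $ k)) x"
      using smooth_on_differentiable[OF f] by (intro pd_cong[OF f(2) x]) (simp add: pd_vec_nth)
    finally show ?thesis .
  qed
  moreover have "pd i (pd j (\<lambda>x. f x $ k)) x = pd j (pd i (\<lambda>x. f x $ k)) x" for k
    using f x by (intro pd_commute_real[of S]) (auto intro: smooth_intros)
  ultimately show ?thesis
    by (simp add: vec_eq_iff)
qed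

section \<open>Hermitian geometry in a coordinate domain\<close>

lemmas matrix_mult_simps =
  bounded_bilinear.add_left[OF bounded_bilinear_matrix_matrix_mult]
  bounded_bilinear.add_right[OF bounded_bilinear_matrix_matrix_mult]
  bounded_bilinear.diff_left[OF bounded_bilinear_matrix_matrix_mult]
  bounded_bilinear.diff_right[OF bounded_bilinear_matrix_matrix_mult]
  bounded_bilinear.minus_left[OF bounded_bilinear_matrix_matrix_mult]
  bounded_bilinear.minus_right[OF bounded_bilinear_matrix_matrix_mult]
  bounded_bilinear.zero_left[OF bounded_bilinear_matrix_matrix_mult]
  bounded_bilinear.zero_right[OF bounded_bilinear_matrix_matrix_mult]
  bounded_bilinear.scaleR_left[OF bounded_bilinear_matrix_matrix_mult]
  bounded_bilinear.scaleR_right[OF bounded_bilinear_matrix_matrix_mult]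
  matrix_mul_assoc

lemmas matrix_mult_sum_left = bounded_bilinear.sum_left[OF bounded_bilinear_matrix_matrix_mult]
lemmas matrix_mult_sum_right = bounded_bilinear.sum_right[OF bounded_bilinear_matrix_matrix_mult]

lemmas matrix_vector_simps =
  bounded_bilinear.add_left[OF bounded_bilinear_matrix_vector_mult]
  bounded_bilinear.add_right[OF bounded_bilinear_matrix_vector_mult]
  bounded_bilinear.diff_left[OF bounded_bilinear_matrix_vector_mult]
  bounded_bilinear.diff_right[OF bounded_bilinear_matrix_vector_mult]
  bounded_bilinear.minus_left[OF bounded_bilinear_matrix_vector_mult]
  bounded_bilinear.minus_right[OF bounded_bilinear_matrix_vector_mult]
  bounded_bilinear.scaleR_left[OF bounded_bilinear_matrix_vector_mult]
  bounded_bilinear.scaleR_right[OF bounded_bilinear_matrix_vector_mult]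

lemmas matrix_vector_sum_left = bounded_bilinear.sum_left[OF bounded_bilinear_matrix_vector_mult]
lemmas matrix_vector_sum_right = bounded_bilinear.sum_right[OF bounded_bilinear_matrix_vector_mult]

lemmas linear_transpose = bounded_linear.linear[OF bounded_linear_transpose]

lemmas transpose_simps =
  linear_add[OF linear_transpose]
  linear_diff[OF linear_transpose]
  linear_neg[OF linear_transpose]
  matrix_transpose_mul transpose_transpose

lemmas pd_matrix_mult = pd_bilinear[OF bounded_bilinear_matrix_matrix_mult]
lemmas pd_matrix_vector_mult = pd_bilinear[OF bounded_bilinear_matrix_vector_mult]
lemmas pd_transpose = pd_bounded_linear[OF bounded_linear_transpose]
lemmas pd_scaleR = pd_bilinear[OF bounded_bilinear_scaleR]
lemmas pd_mult = pd_bilinear[OF bounded_bilinear_mult]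
lemmas pd_inner = pd_bilinear[OF bounded_bilinear_inner]
lemmas pd_minus = pd_bounded_linear[OF bounded_linear_minus[OF bounded_linear_ident]]

lemma pd_diff:
  assumes "f differentiable (at x)" "g differentiable (at x)"
  shows "pd i (\<lambda>x. f x - g x) x = pd i f x - pd i g x"
  using pd_add[of f x "\<lambda>x. - g x" i] assms by (simp add: pd_minus)

lemma differentiable_vec_nth:
  "f differentiable (at x) \<Longrightarrow> (\<lambda>x. f x $ i) differentiable (at x)"
  using bounded_linear.has_derivative[OF bounded_linear_vec_nth, of f _ "at x" i]
  unfolding differentiable_def by blast

lemma inner_matrix_vector:
  fixes M :: "real ^ 'n::finite ^ 'm::finite"
  shows "u \<bullet> (M *v v) = (transpose M *v u) \<bullet> v"
  by (metis dot_lmul_matrix transpose_matrix_vector)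

text \<open>The segment from the identity to \<open>M\<close> consists of positive definite
  matrices, hence of invertible ones. The determinant cannot change sign along it and is 1 at the
  identity.\<close>

lemma det_pos_if_positive_definite:
  fixes M :: "real ^ 'n::finite ^ 'n"
  assumes "\<And>v. v \<noteq> 0 \<Longrightarrow> v \<bullet> (M *v v) > 0"
  shows "det M > 0"
proof -
  define F where "F t = t *\<^sub>R M + (1 - t) *\<^sub>R mat 1" for t :: real
  have nz: "det (F t) \<noteq> 0" if "0 \<le> t" "t \<le> 1" for t
  proof
    assume "det (F t) = 0"
    then obtain v where v: "v \<noteq> 0" "F t *v v = 0"
      using matrix_left_invertible_ker[of "F t"] invertible_det_nz[of "F t"] invertible_left_inverse[of "F t"] by auto
    have "0 = v \<bullet> (F t *v v)"
      using v by simp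
    also have "\<dots> = t * (v \<bullet> (M *v v)) + (1 - t) * (v \<bullet> v)"
      by (simp add: F_def matrix_vector_simps inner_add_right)
    finally have "t * (v \<bullet> (M *v v)) + (1 - t) * (v \<bullet> v) = 0" by simp
    moreover have "v \<bullet> (M *v v) > 0" "v \<bullet> v > 0" using assms v by auto
    ultimately have "t = 0 \<and> 1 - t = 0"
      using that by (smt (verit) mult_nonneg_nonneg mult_pos_pos)
    then show False by auto
  qed
  have c: "continuous_on {0..1} (\<lambda>t. det (F t))"
    unfolding det_def F_def by (intro continuous_intros)
  have "det (F 1) > 0"
  proof (rule ccontr)
    assume "\<not> det (F 1) > 0"
    moreover have "det (F 0) = 1" by (simp add: F_def)
    ultimately obtain t where "0 \<le> t" "t \<le> 1" "det (F t) = 0"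
      using IVT2'[of "\<lambda>t. det (F t)" 1 0 0] c by auto
    with nz show False by auto
  qed
  then show ?thesis by (simp add: F_def)
qed

lemma sum_symmetric_skew_zero:
  fixes s a :: "'i \<Rightarrow> 'i \<Rightarrow> real"
  assumes "\<And>i j. s i j = s j i" "\<And>i j. a i j = - a j i"
  shows "(\<Sum>i\<in>I. \<Sum>j\<in>I. s i j * a i j) = 0"
proof -
  have "(\<Sum>i\<in>I. \<Sum>j\<in>I. s i j * a i j) = (\<Sum>i\<in>I. \<Sum>j\<in>I. s j i * a j i)"
    by (rule sum.swap)
  also have "\<dots> = (\<Sum>i\<in>I. \<Sum>j\<in>I. - (s i j * a i j))"
    using assms by (intro sum.cong refl) (metis mult_minus_right)
  also have "\<dots> = - (\<Sum>i\<in>I. \<Sum>j\<in>I. s i j * a i j)"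
    by (simp add: sum_negf)
  finally show ?thesis by simp
qed

section \<open>The Levi-Civita connection of a metric on an open subset of R^n\<close>

locale local_metric =
  fixes U :: "(real ^ 'n::finite) set" and G :: "real ^ 'n \<Rightarrow> real ^ 'n ^ 'n"
  assumes openU: "open U" and smooth_G: "smooth_on U G"
    and G_sym: "x \<in> U \<Longrightarrow> transpose (G x) = G x"
    and G_pos: "x \<in> U \<Longrightarrow> v \<noteq> 0 \<Longrightarrow> v \<bullet> (G x *v v) > 0"
begin

lemmas differentiable = smooth_on_differentiable[OF _ openU]

lemma det_G_pos: "x \<in> U \<Longrightarrow> det (G x) > 0"
  by (intro det_pos_if_positive_definite G_pos)

definition H where "H x = matrix_inv (G x)"

lemma H_G: "x \<in> U \<Longrightarrow> H x ** G x = mat 1" and G_H: "x \<in> U \<Longrightarrow> G x ** H x = mat 1"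
  using det_G_pos[of x] matrix_inv_mult[of "G x"] by (auto simp: H_def)

text \<open>Simplification nests matrix products to the left, so a cancelling pair usually stands
  behind another factor \<open>M\<close>.\<close>

lemma H_G': "x \<in> U \<Longrightarrow> M ** H x ** G x = M" and G_H': "x \<in> U \<Longrightarrow> M ** G x ** H x = M"
  using H_G[of x] G_H[of x] by (simp_all add: matrix_mul_assoc[symmetric])

lemma H_sym: "x \<in> U \<Longrightarrow> transpose (H x) = H x"
  by (metis G_H' G_sym H_G matrix_transpose_mul matrix_mul_lid transpose_mat)

lemma H_nth_sym: "x \<in> U \<Longrightarrow> H x $ i $ j = H x $ j $ i"
  using arg_cong[OF H_sym, of x "\<lambda>M. M $ j $ i"] by (simp add: transpose_def)

text \<open>Christoffel symbols of the first kind; the row index \<open>l\<close> is the lowered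
  one.\<close>

definition K where
  "K i x = (1/2) *\<^sub>R (\<chi> l j. pd i G x $ j $ l + pd j G x $ i $ l - pd l G x $ i $ j)"

text \<open>\<open>Gam i x $ k $ j\<close> is the Christoffel symbol \<open>\<Gamma>\<^sup>k\<^sub>i\<^sub>j\<close>.\<close>

definition Gam where "Gam i x = H x ** K i x"

definition nab where "nab i Y x = pd i Y x + Gam i x *v Y x"

definition dvg where "dvg X x = (\<Sum>i\<in>UNIV. nab i X x $ i)"

text \<open>\<open>Riem i j\<close> is the commutator \<open>[\<nabla>\<^sub>i, \<nabla>\<^sub>j]\<close>, the negative of \<open>curvature\<close> in the convention of the definitions.\<close>

definition Riem where
  "Riem i j x = pd i (Gam j) x - pd j (Gam i) x + Gam i x ** Gam j x - Gam j x ** Gam i x"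

lemma smooth_H: "smooth_on U H"
  unfolding H_def[abs_def] using det_G_pos by (intro smooth_intros openU smooth_G) force

lemma smooth_Gam: "smooth_on U (Gam i)"
  unfolding Gam_def[abs_def] K_def[abs_def] using openU smooth_G smooth_H
  by (intro smooth_intros)

lemma smooth_nab: "smooth_on U Y \<Longrightarrow> smooth_on U (nab i Y)"
  unfolding nab_def[abs_def] using openU smooth_Gam by (intro smooth_intros)

lemma pd_G_sym:
  assumes "x \<in> U" shows "pd i G x $ j $ k = pd i G x $ k $ j"
proof -
  have "pd i G x = pd i (\<lambda>x. transpose (G x)) x"
    using G_sym by (intro pd_cong[OF openU assms]) simp
  also have "\<dots> = transpose (pd i G x)"
    by (intro pd_transpose differentiable[OF smooth_G assms])
  finally have "pd i G x $ j $ k = transpose (pd i G x) $ j $ k"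
    by metis
  then show ?thesis
    by (simp add: transpose_def)
qed

lemma Gam_sym: "x \<in> U \<Longrightarrow> Gam i x $ k $ j = Gam j x $ k $ i"
  by (simp add: Gam_def K_def matrix_matrix_mult_def pd_G_sym[of x _ i j] algebra_simps)

text \<open>The metric is parallel: \<open>G ** Gam i\<close> is the matrix \<open>K i\<close> of
  first-kind symbols, and \<open>K i\<close> plus its transpose is the derivative of
  \<open>G\<close>.\<close>

lemma pd_G: "x \<in> U \<Longrightarrow> pd i G x = G x ** Gam i x + transpose (Gam i x) ** G x"
proof -
  assume x: "x \<in> U"
  have "G x ** Gam i x = K i x"
    using x by (simp add: Gam_def matrix_mul_assoc G_H)
  moreover have "transpose (Gam i x) ** G x = transpose (K i x)"
    using x by (simp add: Gam_def matrix_transpose_mul H_sym H_G' )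
  moreover have "pd i G x = K i x + transpose (K i x)"
    using pd_G_sym[OF x] by (simp add: K_def vec_eq_iff transpose_def algebra_simps)
  ultimately show ?thesis by simp
qed

text \<open>Differentiation of \<open>H ** G = mat 1\<close>; it expresses that the inverse metric
  is parallel too.\<close>

lemma pd_H:
  assumes x: "x \<in> U"
  shows "pd i H x = - (Gam i x ** H x + H x ** transpose (Gam i x))"
proof -
  have "pd i (\<lambda>x. H x ** G x) x = pd i (\<lambda>x. mat 1) x"
    using H_G by (intro pd_cong[OF openU x])
  then have "pd i H x ** G x + H x ** pd i G x = 0"
    using differentiable[OF smooth_H x] differentiable[OF smooth_G x] by (simp add: pd_matrix_mult)
  then have "(pd i H x ** G x) ** H x = (- (H x ** pd i G x)) ** H x"
    by (metis add_eq_0_iff minus_minus)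
  then show ?thesis
    using x by (simp add: G_H' pd_G matrix_mult_simps H_G)
qed

text \<open>By Jacobi's formula the logarithmic derivative of det G is the trace of
  \<open>H ** pd k G\<close>. Metric compatibility splits this into two terms, each with the trace
  of \<open>Gam k\<close>, and the square root halves it.\<close>

lemma pd_sqrt_det:
  assumes x: "x \<in> U"
  shows "pd k (\<lambda>x. sqrt (det (G x))) x = sqrt (det (G x)) * (\<Sum>i\<in>UNIV. Gam i x $ i $ k)"
    and "(\<lambda>x. sqrt (det (G x))) differentiable (at x)"
proof -
  have pos: "det (G x) > 0" using det_G_pos[OF x] .
  have d: "(\<lambda>x. det (G x)) differentiable (at x)"
    using smooth_on_det[OF openU smooth_G] differentiable x by blast
  have sd: "((\<lambda>x. sqrt (det (G x))) has_derivative
      (\<lambda>v. (inverse (sqrt (det (G x))) / 2) * frechet_derivative (\<lambda>x. det (G x)) (at x) v)) (at x)"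
    using pos d by (auto intro!: derivative_eq_intros frechet_derivative_has_derivative simp: field_simps)
  then show "(\<lambda>x. sqrt (det (G x))) differentiable (at x)"
    by (auto simp: differentiable_def)
  have "trace (H x ** pd k G x) = 2 * (\<Sum>i\<in>UNIV. Gam k x $ i $ i)"
  proof -
    have "trace (H x ** (G x ** Gam k x)) = trace (Gam k x)"
      using x by (simp add: matrix_mul_assoc H_G)
    moreover have "trace (H x ** (transpose (Gam k x) ** G x)) = trace ((transpose (Gam k x) ** G x) ** H x)"
      by (rule trace_mul_sym)
    moreover have "trace ((transpose (Gam k x) ** G x) ** H x) = trace (Gam k x)"
      using x by (simp add: G_H' trace_def transpose_def)
    ultimately show ?thesis
      using x by (simp add: pd_G matrix_add_ldistrib trace_add) (simp add: trace_def)
  qed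
  then have "sqrt (det (G x)) * pd k (\<lambda>x. sqrt (det (G x))) x = det (G x) * (\<Sum>i\<in>UNIV. Gam i x $ i $ k)"
    using pd_has_derivative[OF sd, of k] pd_det[OF differentiable[OF smooth_G x], of k] pos
    by (simp add: pd_def[symmetric] H_def[symmetric] Gam_sym[OF x, of k] field_simps)
  then have "sqrt (det (G x)) * pd k (\<lambda>x. sqrt (det (G x))) x =
      sqrt (det (G x)) * (sqrt (det (G x)) * (\<Sum>i\<in>UNIV. Gam i x $ i $ k))"
    using pos by (simp add: mult.assoc[symmetric])
  then show "pd k (\<lambda>x. sqrt (det (G x))) x = sqrt (det (G x)) * (\<Sum>i\<in>UNIV. Gam i x $ i $ k)"
    using pos by simp
qed

text \<open>The Riemannian density times a divergence is a sum of plain partial derivatives. This is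
  what makes a divergence integrable by Lebesgue measure in a chart.\<close>

lemma dvg_sqrt_det:
  assumes x: "x \<in> U" and X: "X differentiable (at x)"
  shows "(\<Sum>i\<in>UNIV. pd i (\<lambda>x. sqrt (det (G x)) * X x $ i) x) = sqrt (det (G x)) * dvg X x"
proof -
  have "pd i (\<lambda>x. sqrt (det (G x)) * X x $ i) x =
      sqrt (det (G x)) * (\<Sum>k\<in>UNIV. Gam k x $ k $ i) * X x $ i + sqrt (det (G x)) * pd i X x $ i" for i
    using pd_sqrt_det[OF x] X differentiable_vec_nth[OF X, of i] by (simp add: pd_mult pd_vec_nth)
  then have "(\<Sum>i\<in>UNIV. pd i (\<lambda>x. sqrt (det (G x)) * X x $ i) x) = sqrt (det (G x)) *
      ((\<Sum>i\<in>UNIV. \<Sum>k\<in>UNIV. Gam k x $ k $ i * X x $ i) + (\<Sum>i\<in>UNIV. pd i X x $ i))"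
    by (simp add: sum.distrib sum_distrib_left sum_distrib_right distrib_left mult.assoc)
  also have "(\<Sum>i\<in>UNIV. \<Sum>k\<in>UNIV. Gam k x $ k $ i * X x $ i) = (\<Sum>k\<in>UNIV. (Gam k x *v X x) $ k)"
    by (subst sum.swap) (simp add: matrix_vector_mult_def)
  finally show ?thesis
    by (simp add: dvg_def nab_def sum.distrib)
qed

text \<open>The second derivatives of \<open>Y\<close> cancel by symmetry and the first derivatives
  cancel between the two product rules, so only a matrix acting on the value of \<open>Y\<close> is
  left.\<close>

lemma nab_commutator:
  assumes x: "x \<in> U" and Y: "smooth_on U Y"
  shows "nab i (nab j Y) x - nab j (nab i Y) x = Riem i j x *v Y x"
proof -
  have e: "pd i (nab j Y) x = pd i (pd j Y) x + (pd i (Gam j) x *v Y x + Gam j x *v pd i Y x)" for i j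
  proof -
    have "pd i (nab j Y) x = pd i (\<lambda>x. pd j Y x + Gam j x *v Y x) x"
      by (simp add: nab_def[abs_def])
    also have "\<dots> = pd i (pd j Y) x + pd i (\<lambda>x. Gam j x *v Y x) x"
      using openU Y smooth_Gam by (intro pd_add differentiable[OF _ x] smooth_intros)
    also have "pd i (\<lambda>x. Gam j x *v Y x) x = pd i (Gam j) x *v Y x + Gam j x *v pd i Y x"
      by (intro pd_matrix_vector_mult differentiable[OF _ x] smooth_Gam Y)
    finally show ?thesis .
  qed
  show ?thesis
    unfolding nab_def[of i "nab j Y"] nab_def[of j "nab i Y"] e
    unfolding nab_def Riem_def
    using pd_commute[OF Y openU x, of i j]
    by (simp add: matrix_vector_simps matrix_vector_mul_assoc[symmetric])
qed

text \<open>The derivative of \<open>G\<close> in the product rule supplies, by \<open>pd_G\<close>,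
  exactly the two Christoffel terms of the covariant derivatives.\<close>

lemma nab_metric:
  assumes x: "x \<in> U" and Y: "Y differentiable (at x)" and Z: "Z differentiable (at x)"
  shows "pd i (\<lambda>x. Y x \<bullet> (G x *v Z x)) x = nab i Y x \<bullet> (G x *v Z x) + Y x \<bullet> (G x *v nab i Z x)"
proof -
  have GZ: "(\<lambda>x. G x *v Z x) differentiable (at x)"
    using bounded_bilinear.FDERIV[OF bounded_bilinear_matrix_vector_mult frechet_derivative_has_derivative[OF differentiable[OF smooth_G x]] frechet_derivative_has_derivative[OF Z]]
    by (auto simp: differentiable_def)
  have "pd i (\<lambda>x. Y x \<bullet> (G x *v Z x)) x =
      pd i Y x \<bullet> (G x *v Z x) + Y x \<bullet> (pd i G x *v Z x + G x *v pd i Z x)"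
    using Y Z GZ differentiable[OF smooth_G x] by (simp add: pd_inner pd_matrix_vector_mult)
  moreover have "Y x \<bullet> (pd i G x *v Z x) = Y x \<bullet> (G x *v (Gam i x *v Z x)) + (Gam i x *v Y x) \<bullet> (G x *v Z x)"
    using x by (simp add: pd_G matrix_vector_simps inner_add_right matrix_vector_mul_assoc[symmetric]
      inner_matrix_vector[of _ "transpose (Gam i x)"] transpose_transpose del: transpose_matrix_vector)
  ultimately show ?thesis
    by (simp add: nab_def matrix_vector_simps inner_add_right inner_add_left)
qed

end

section \<open>Almost Hermitian identities in one chart\<close>

locale local_hermitian = local_metric U G
  for U :: "(real ^ 'n::finite) set" and G +
  fixes J :: "real ^ 'n \<Rightarrow> real ^ 'n ^ 'n"
  assumes smooth_J: "smooth_on U J"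
    and J_J: "x \<in> U \<Longrightarrow> J x ** J x = - mat 1"
    and J_G_J: "x \<in> U \<Longrightarrow> transpose (J x) ** G x ** J x = G x"
begin

definition nabJ where "nabJ i x = pd i J x + Gam i x ** J x - J x ** Gam i x"

text \<open>The endomorphism J (D_a J) with its second index raised. With both indices up,
  skew-adjointness for the metric becomes skewness of the matrix, see \<open>C_skew\<close>.\<close>

definition C where "C a x = J x ** nabJ a x ** H x"

text \<open>\<open>W = J V\<close>, where \<open>V\<close> is the metric trace of \<open>\<nabla>J\<close>.\<close>

definition W where "W x = (\<chi> i. \<Sum>a\<in>UNIV. C a x $ i $ a)"

text \<open>The difference of scalar and star-scalar curvature in coordinates. The star part comes
  with \<open>- J Riem J\<close>, so the subtraction produces the plus sign.\<close>

definition SJ where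
  "SJ x = (\<Sum>i\<in>UNIV. \<Sum>a\<in>UNIV. ((Riem i a x + J x ** Riem i a x ** J x) ** H x) $ i $ a)"

text \<open>The Nijenhuis tensor on coordinate fields, whose own brackets vanish. The first two
  terms come from the bracket of \<open>J X\<close> and \<open>J Y\<close>, the last two from the
  mixed brackets.\<close>

definition nij_zero where
  "nij_zero x \<longleftrightarrow> (\<forall>i j. (\<Sum>b\<in>UNIV. J x $ b $ i *\<^sub>R pd b J x) *v axis j 1
     - (\<Sum>b\<in>UNIV. J x $ b $ j *\<^sub>R pd b J x) *v axis i 1
     - (J x ** pd i J x) *v axis j 1 + (J x ** pd j J x) *v axis i 1 = 0)"

lemma smooth_nabJ: "smooth_on U (nabJ i)"
  unfolding nabJ_def[abs_def] using openU smooth_J smooth_Gam by (intro smooth_intros)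

lemma smooth_C: "smooth_on U (C i)"
  unfolding C_def[abs_def] using openU smooth_J smooth_nabJ smooth_H by (intro smooth_intros)

lemma smooth_W: "smooth_on U W"
  unfolding W_def[abs_def] using openU smooth_C by (intro smooth_intros)

lemma J_J': "x \<in> U \<Longrightarrow> M ** J x ** J x = - M"
  by (simp add: matrix_mul_assoc[symmetric] J_J matrix_mult_simps(6))

text \<open>An isometry with square -1 is skew-adjoint.\<close>

lemma Jt_G: "x \<in> U \<Longrightarrow> transpose (J x) ** G x = - (G x ** J x)"
  using J_G_J[of x] J_J'[of x "transpose (J x) ** G x"] by (metis minus_minus)

lemma Jt_G': "x \<in> U \<Longrightarrow> M ** transpose (J x) ** G x = - (M ** G x ** J x)"
  by (metis Jt_G matrix_mul_assoc matrix_mult_simps(6))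

lemma H_Jt: "x \<in> U \<Longrightarrow> H x ** transpose (J x) = - (J x ** H x)"
proof -
  assume x: "x \<in> U"
  have "H x ** (transpose (J x) ** G x) ** H x = - (H x ** (G x ** J x)) ** H x"
    using x by (simp add: Jt_G matrix_mult_simps)
  then show ?thesis
    using x by (simp add: matrix_mult_simps H_G G_H')
qed

text \<open>Differentiation of J J = -1; the Christoffel terms cancel.\<close>

lemma nabJ_anticomm:
  assumes x: "x \<in> U" shows "nabJ i x ** J x = - (J x ** nabJ i x)"
proof -
  have "pd i (\<lambda>x. J x ** J x) x = pd i (\<lambda>x. - mat 1) x"
    using J_J by (intro pd_cong[OF openU x])
  then have "pd i J x ** J x = - (J x ** pd i J x)"
    using differentiable[OF smooth_J x] by (simp add: pd_matrix_mult eq_neg_iff_add_eq_0)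
  then show ?thesis
    using x by (simp add: nabJ_def matrix_mult_simps J_J' J_J)
qed

text \<open>Differentiation of the skew-adjointness of J; \<open>pd_G\<close> turns the derivative
  of the metric into the Christoffel terms of \<open>nabJ\<close>.\<close>

lemma nabJ_G_skew:
  assumes x: "x \<in> U" shows "transpose (nabJ i x) ** G x = - (G x ** nabJ i x)"
proof -
  have dJ: "J differentiable (at x)" "G differentiable (at x)"
    using differentiable[OF smooth_J x] differentiable[OF smooth_G x] .
  have "pd i (\<lambda>x. transpose (J x) ** G x) x = pd i (\<lambda>x. - (G x ** J x)) x"
    using Jt_G by (intro pd_cong[OF openU x])
  moreover have "(\<lambda>x. transpose (J x)) differentiable (at x)"
    by (intro differentiable[OF _ x] smooth_intros openU smooth_J)
  moreover have "(\<lambda>x. G x ** J x) differentiable (at x)"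
    by (intro differentiable[OF _ x] smooth_intros openU smooth_J smooth_G)
  ultimately have "transpose (pd i J x) ** G x + transpose (J x) ** pd i G x = - (pd i G x ** J x + G x ** pd i J x)"
    using dJ by (simp add: pd_matrix_mult pd_transpose pd_minus)
  then have e: "transpose (pd i J x) ** G x = - (pd i G x ** J x + G x ** pd i J x + transpose (J x) ** pd i G x)"
    by (simp add: algebra_simps)
  show ?thesis
    using x by (simp add: nabJ_def transpose_simps matrix_mult_simps e pd_G Jt_G Jt_G' algebra_simps)
qed

lemma H_nabJ_t:
  assumes x: "x \<in> U" shows "H x ** transpose (nabJ i x) = - (nabJ i x ** H x)"
proof -
  have "H x ** (transpose (nabJ i x) ** G x) ** H x = - (H x ** (G x ** nabJ i x)) ** H x"
    using x by (simp add: nabJ_G_skew matrix_mult_simps)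
  then show ?thesis
    using x by (simp add: matrix_mult_simps H_G G_H')
qed

text \<open>J and D_a J are skew-adjoint and anticommute, so their product is skew-adjoint.\<close>

lemma C_skew:
  assumes x: "x \<in> U" shows "transpose (C a x) = - C a x"
proof -
  have "transpose (C a x) = H x ** transpose (nabJ a x) ** transpose (J x)"
    using x by (simp add: C_def transpose_simps H_sym matrix_mul_assoc)
  also have "\<dots> = - (nabJ a x ** (H x ** transpose (J x)))"
    using x by (simp add: H_nabJ_t matrix_mult_simps)
  also have "\<dots> = nabJ a x ** J x ** H x"
    using x by (simp add: H_Jt matrix_mult_simps)
  also have "\<dots> = - C a x"
    using x by (simp add: nabJ_anticomm C_def matrix_mult_simps)
  finally show ?thesis .
qed

text \<open>The Ricci identity for the endomorphism field J. The direction index of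
  \<open>nabJ\<close> is treated as a mere label: its Christoffel terms would be symmetric in
  \<open>i\<close> and \<open>a\<close> and cancel in the difference.\<close>

lemma Riem_J:
  assumes x: "x \<in> U"
  shows "Riem i a x ** J x - J x ** Riem i a x =
    (pd i (nabJ a) x + Gam i x ** nabJ a x - nabJ a x ** Gam i x) - (pd a (nabJ i) x + Gam a x ** nabJ i x - nabJ i x ** Gam a x)"
proof -
  have e: "pd i (nabJ j) x = pd i (pd j J) x + (pd i (Gam j) x ** J x + Gam j x ** pd i J x)
      - (pd i J x ** Gam j x + J x ** pd i (Gam j) x)" for i j
  proof -
    have "pd i (nabJ j) x = pd i (\<lambda>x. pd j J x + Gam j x ** J x - J x ** Gam j x) x"
      by (simp add: nabJ_def[abs_def])
    also have "\<dots> = pd i (pd j J) x + pd i (\<lambda>x. Gam j x ** J x) x - pd i (\<lambda>x. J x ** Gam j x) x"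
    proof -
      have "pd j J differentiable (at x)"
        by (intro differentiable[OF _ x] smooth_intros openU smooth_J)
      moreover have "(\<lambda>x. Gam j x ** J x) differentiable (at x)" 
        by (intro differentiable[OF _ x] smooth_intros openU smooth_J smooth_Gam)
      moreover have "(\<lambda>x. J x ** Gam j x) differentiable (at x)"
        by (intro differentiable[OF _ x] smooth_intros openU smooth_J smooth_Gam)
      moreover have "(\<lambda>x. pd j J x + Gam j x ** J x) differentiable (at x)"
        by (intro differentiable[OF _ x] smooth_intros openU smooth_J smooth_Gam)
      ultimately show ?thesis by (simp add: pd_diff pd_add)
    qed
    also have "pd i (\<lambda>x. Gam j x ** J x) x = pd i (Gam j) x ** J x + Gam j x ** pd i J x"
      by (intro pd_matrix_mult differentiable[OF _ x] smooth_Gam smooth_J)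
    also have "pd i (\<lambda>x. J x ** Gam j x) x = pd i J x ** Gam j x + J x ** pd i (Gam j) x"
      by (intro pd_matrix_mult differentiable[OF _ x] smooth_Gam smooth_J)
    finally show ?thesis .
  qed
  have c: "pd i (pd a J) x = pd a (pd i J) x"
  proof -
    \<comment> \<open>\<open>pd_commute\<close> speaks of vector values, so the matrix is taken row
      by row.\<close>
    have "pd i (pd a J) x $ k = pd a (pd i J) x $ k" for k
    proof -
      have v: "pd i (pd a J) x $ k = pd i (pd a (\<lambda>x. J x $ k)) x" for i a
      proof -
        have "pd i (pd a J) x $ k = pd i (\<lambda>x. pd a J x $ k) x"
          using differentiable[OF smooth_on_pd[OF smooth_J openU] x] by (simp add: pd_vec_nth)
        also have "\<dots> = pd i (pd a (\<lambda>x. J x $ k)) x"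
          using differentiable[OF smooth_J] by (intro pd_cong[OF openU x]) (simp add: pd_vec_nth)
        finally show ?thesis .
      qed
      show ?thesis unfolding v
        using openU smooth_J x by (intro pd_commute[of U]) (auto intro!: smooth_intros)
    qed
    then show ?thesis by (simp add: vec_eq_iff)
  qed
  show ?thesis
    unfolding e Riem_def nabJ_def using c by (simp add: matrix_mult_simps algebra_simps)
qed

text \<open>Covariant derivative of \<open>C a\<close> as a tensor with two upper indices, the index
  \<open>a\<close> again being only a label.\<close>

definition DC where "DC i a x = pd i (C a) x + Gam i x ** C a x + C a x ** transpose (Gam i x)"

lemma DC_skew:
  assumes x: "x \<in> U" shows "DC i a x $ k $ l = - DC i a x $ l $ k"
proof -
  have d: "C a differentiable (at x)" using differentiable[OF smooth_C x] .
  have "transpose (pd i (C a) x) = pd i (\<lambda>x. transpose (C a x)) x"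
    using d by (simp add: pd_transpose)
  also have "\<dots> = pd i (\<lambda>x. - C a x) x"
    using C_skew by (intro pd_cong[OF openU x])
  also have "\<dots> = - pd i (C a) x"
    using d by (simp add: pd_minus)
  finally have "transpose (DC i a x) = - DC i a x"
    using x by (simp add: DC_def transpose_simps C_skew matrix_mult_simps)
  then have "transpose (DC i a x) $ l $ k = (- DC i a x) $ l $ k"
    by simp
  then show ?thesis
    by (simp add: transpose_def)
qed

text \<open>The first Christoffel term of \<open>DC\<close> becomes the one in the divergence of W.
  The second contracts the symmetric lower indices of \<open>Gam\<close> with the skew matrix
  \<open>C a\<close> and vanishes.\<close>

lemma sum_DC:
  assumes x: "x \<in> U"
  shows "(\<Sum>i\<in>UNIV. \<Sum>a\<in>UNIV. DC i a x $ i $ a) = dvg W x"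
proof -
  have d: "C a differentiable (at x)" for a using differentiable[OF smooth_C x] .
  have pW: "pd i W x $ i = (\<Sum>a\<in>UNIV. pd i (C a) x $ i $ a)" for i
  proof -
    have "pd i W x $ i = pd i (\<lambda>x. W x $ i) x"
      using differentiable[OF smooth_W x] by (simp add: pd_vec_nth)
    also have "\<dots> = pd i (\<lambda>x. \<Sum>a\<in>UNIV. C a x $ i $ a) x"
      by (simp add: W_def)
    also have "\<dots> = (\<Sum>a\<in>UNIV. pd i (\<lambda>x. C a x $ i $ a) x)"
      using openU smooth_C by (intro pd_sum differentiable[OF _ x] smooth_intros)
    also have "\<dots> = (\<Sum>a\<in>UNIV. pd i (C a) x $ i $ a)"
    proof -
      have "(\<lambda>x. C a x $ i) differentiable (at x)" for a
        using openU smooth_C by (intro differentiable[OF _ x] smooth_intros)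
      then show ?thesis using d by (simp add: pd_vec_nth)
    qed
    finally show ?thesis .
  qed
  have g1: "(\<Sum>a\<in>UNIV. (Gam i x ** C a x) $ i $ a) = (Gam i x *v W x) $ i" for i
    by (simp add: matrix_matrix_mult_def matrix_vector_mult_def W_def sum_distrib_left) (rule sum.swap)
  have sk: "C a x $ i $ k = - C a x $ k $ i" for a i k
  proof -
    have "transpose (C a x) $ k $ i = (- C a x) $ k $ i" using C_skew[OF x] by simp
    then show ?thesis by (simp add: transpose_def)
  qed
  have "(\<Sum>i\<in>UNIV. \<Sum>a\<in>UNIV. (C a x ** transpose (Gam i x)) $ i $ a) = 
     (\<Sum>a\<in>UNIV. \<Sum>i\<in>UNIV. \<Sum>k\<in>UNIV. Gam i x $ a $ k * C a x $ i $ k)"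
    by (subst sum.swap) (simp add: matrix_matrix_mult_def transpose_def mult.commute)
  also have "\<dots> = 0"
  proof (rule sum.neutral, rule ballI)
    fix a show "(\<Sum>i\<in>UNIV. \<Sum>k\<in>UNIV. Gam i x $ a $ k * C a x $ i $ k) = 0"
      using sk Gam_sym[OF x] by (intro sum_symmetric_skew_zero) blast+
  qed
  finally have g2: "(\<Sum>i\<in>UNIV. \<Sum>a\<in>UNIV. (C a x ** transpose (Gam i x)) $ i $ a) = 0" .
  show ?thesis
    by (simp add: DC_def sum.distrib g2 g1 dvg_def nab_def pW)
qed

lemma V_eq:
  assumes x: "x \<in> U"
  shows "(\<chi> i. \<Sum>a\<in>UNIV. (nabJ a x ** H x) $ i $ a) = - (J x *v W x)"
proof -
  have "J x *v W x = (\<chi> i. \<Sum>a\<in>UNIV. (J x ** C a x) $ i $ a)"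
    by (simp add: vec_eq_iff matrix_matrix_mult_def matrix_vector_mult_def W_def sum_distrib_left) (intro allI sum.swap)
  also have "\<dots> = (\<chi> i. \<Sum>a\<in>UNIV. - (nabJ a x ** H x) $ i $ a)"
    using x by (simp add: C_def matrix_mult_simps J_J)
  finally show ?thesis
    by (simp add: vec_eq_iff sum_negf)
qed

text \<open>The double sum factors through the trace V of D J: one factor contracts to V directly,
  the other to minus V with lowered index by skew-adjointness. The norms of V and W agree because J
  is an isometry.\<close>

lemma quadratic_norm:
  assumes x: "x \<in> U"
  shows "(\<Sum>i\<in>UNIV. \<Sum>a\<in>UNIV. (nabJ i x ** nabJ a x ** H x) $ i $ a) = - (W x \<bullet> (G x *v W x))"
proof -
  let ?V = "\<chi> i. \<Sum>a\<in>UNIV. (nabJ a x ** H x) $ i $ a"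
  have E: "(nabJ i x ** H x) $ k $ l = - (nabJ i x ** H x) $ l $ k" for i k l
  proof -
    have "transpose (nabJ i x ** H x) = - (nabJ i x ** H x)"
      using x by (simp add: transpose_simps H_sym H_nabJ_t)
    then have "transpose (nabJ i x ** H x) $ l $ k = (- (nabJ i x ** H x)) $ l $ k" by simp
    then show ?thesis by (simp add: transpose_def)
  qed
  have Ai: "nabJ i x = (nabJ i x ** H x) ** G x" for i
    using x by (simp add: H_G')
  have "(\<Sum>i\<in>UNIV. nabJ i x $ i $ k) = - (G x *v ?V) $ k" for k
  proof -
    have "nabJ i x $ i $ k = (\<Sum>l\<in>UNIV. (nabJ i x ** H x) $ i $ l * G x $ l $ k)" for i
      by (subst Ai) (simp add: matrix_matrix_mult_def)
    also have "\<And>i. \<dots> i = (\<Sum>l\<in>UNIV. - ((G x $ k $ l) * (nabJ i x ** H x) $ l $ i))"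
    proof -
      fix i
      have "G x $ l $ k = G x $ k $ l" for l
        using arg_cong[OF G_sym[OF x], of "\<lambda>M. M $ k $ l"] by (simp add: transpose_def)
      then show "(\<Sum>l\<in>UNIV. (nabJ i x ** H x) $ i $ l * G x $ l $ k) = (\<Sum>l\<in>UNIV. - ((G x $ k $ l) * (nabJ i x ** H x) $ l $ i))"
        using E[of i i] by (intro sum.cong refl) simp
    qed
    finally have "nabJ i x $ i $ k = (\<Sum>l\<in>UNIV. - ((G x $ k $ l) * (nabJ i x ** H x) $ l $ i))" for i .
    then show ?thesis
      by (simp add: matrix_vector_mult_def sum_distrib_left sum_negf) (rule sum.swap)
  qed
  moreover have "(\<Sum>i\<in>UNIV. \<Sum>a\<in>UNIV. (nabJ i x ** nabJ a x ** H x) $ i $ a) = (\<Sum>k\<in>UNIV. (\<Sum>i\<in>UNIV. nabJ i x $ i $ k) * ?V $ k)"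
  proof -
    have "(nabJ i x ** nabJ a x ** H x) $ i $ a = (\<Sum>k\<in>UNIV. nabJ i x $ i $ k * (nabJ a x ** H x) $ k $ a)" for i a
      unfolding matrix_mul_assoc[symmetric] by (simp add: matrix_matrix_mult_def[of "nabJ i x"])
    then have "(\<Sum>a\<in>UNIV. (nabJ i x ** nabJ a x ** H x) $ i $ a) = (\<Sum>k\<in>UNIV. nabJ i x $ i $ k * ?V $ k)" for i
      by (simp add: sum_distrib_left) (rule sum.swap)
    then show ?thesis
      by (simp add: sum_distrib_right) (rule sum.swap)
  qed
  ultimately have "(\<Sum>i\<in>UNIV. \<Sum>a\<in>UNIV. (nabJ i x ** nabJ a x ** H x) $ i $ a) = - (?V \<bullet> (G x *v ?V))"
    by (simp add: inner_vec_def sum_negf mult.commute)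
  also have "?V \<bullet> (G x *v ?V) = W x \<bullet> (G x *v W x)"
  proof -
    have "?V \<bullet> (G x *v ?V) = (J x *v W x) \<bullet> (G x *v (J x *v W x))"
      unfolding V_eq[OF x] by (simp add: matrix_vector_simps)
    also have "\<dots> = W x \<bullet> ((transpose (J x) ** G x ** J x) *v W x)"
      by (simp add: matrix_vector_mul_assoc[symmetric] inner_matrix_vector[of _ "transpose (J x)"] transpose_transpose del: transpose_matrix_vector)
    finally show ?thesis using J_G_J[OF x] by simp
  qed
  finally show ?thesis .
qed

text \<open>D_{JX} J - J (D_X J) for X the coordinate field number \<open>i\<close>.\<close>

definition nabJ_defect where "nabJ_defect i x = (\<Sum>b\<in>UNIV. J x $ b $ i *\<^sub>R nabJ b x) - J x ** nabJ i x"

text \<open>D_b J is skew-adjoint, and so is J (D_i J), as a product of anticommuting skew-adjoint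
  maps.\<close>

lemma nabJ_defect_G_skew:
  assumes x: "x \<in> U" shows "transpose (G x ** nabJ_defect i x) = - (G x ** nabJ_defect i x)"
proof -
  have s: "transpose (G x ** nabJ b x) = - (G x ** nabJ b x)" for b
    using x by (simp add: transpose_simps G_sym nabJ_G_skew)
  have "transpose (G x ** (J x ** nabJ i x)) = transpose (nabJ i x) ** transpose (J x) ** G x"
    using x by (simp add: transpose_simps G_sym matrix_mul_assoc)
  also have "\<dots> = G x ** nabJ i x ** J x"
    using x by (simp add: Jt_G' nabJ_G_skew matrix_mult_simps)
  also have "\<dots> = - (G x ** (J x ** nabJ i x))"
    using x nabJ_anticomm[OF x, of i] by (simp add: matrix_mul_assoc[symmetric] matrix_mult_simps(6))
  finally have s2: "transpose (G x ** (J x ** nabJ i x)) = - (G x ** (J x ** nabJ i x))" .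
  have "G x ** nabJ_defect i x = (\<Sum>b\<in>UNIV. J x $ b $ i *\<^sub>R (G x ** nabJ b x)) - G x ** (J x ** nabJ i x)"
    by (simp add: nabJ_defect_def matrix_mult_sum_right matrix_mult_simps)
  note e = this
  have "transpose (G x ** nabJ_defect i x) = (\<Sum>b\<in>UNIV. J x $ b $ i *\<^sub>R transpose (G x ** nabJ b x)) - transpose (G x ** (J x ** nabJ i x))"
    unfolding e by (simp add: linear_diff[OF linear_transpose]
      linear_sum[OF linear_transpose]
      linear_cmul[OF linear_transpose])
  also have "\<dots> = - (G x ** nabJ_defect i x)"
    unfolding s s2 e by (simp add: sum_negf)
  finally show ?thesis .
qed

text \<open>The trilinear form \<open>g (nabJ_defect X Y, Z)\<close> is symmetric in \<open>X, Y\<close> by integrability and skew in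
  \<open>Y, Z\<close>, so it vanishes.\<close>

lemma nabJ_defect_zero:
  assumes x: "x \<in> U" and nij: "nij_zero x"
  shows "nabJ_defect i x = 0"
proof -
  have nabJ_defect': "nabJ_defect i x $ k $ j = nabJ_defect j x $ k $ i" for i j k
  proof -
    have JG: "(\<Sum>b\<in>UNIV. J x $ b $ i *\<^sub>R (Gam b x ** M)) $ k $ j = (\<Sum>b\<in>UNIV. \<Sum>m\<in>UNIV. J x $ b $ i * Gam b x $ k $ m * M $ m $ j)" for M i j
      by (simp add: matrix_matrix_mult_def sum_distrib_left mult.assoc)
    \<comment> \<open>The symmetry of \<open>Gam\<close> exchanges the two arguments, so this term
      is \<open>J Gam J\<close> for the other index. Together with the term \<open>J Gam J\<close>
      of the defect it is symmetric in \<open>i\<close> and \<open>j\<close>.\<close>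
    have JM: "(\<Sum>b\<in>UNIV. J x $ b $ i *\<^sub>R (J x ** Gam b x)) $ k $ j = (J x ** Gam j x ** J x) $ k $ i" for i j
    proof -
      have "(\<Sum>b\<in>UNIV. J x $ b $ i *\<^sub>R (J x ** Gam b x)) $ k $ j = (\<Sum>b\<in>UNIV. (J x ** Gam b x) $ k $ j * J x $ b $ i)"
        by (simp add: mult.commute)
      also have "\<dots> = (\<Sum>b\<in>UNIV. (J x ** Gam j x) $ k $ b * J x $ b $ i)"
        using Gam_sym[OF x, of _ _ j] by (simp add: matrix_matrix_mult_def)
      finally show ?thesis by (simp add: matrix_matrix_mult_def[of "J x ** Gam j x"])
    qed
    have Bexp: "nabJ_defect i x = (\<Sum>b\<in>UNIV. J x $ b $ i *\<^sub>R pd b J x) + (\<Sum>b\<in>UNIV. J x $ b $ i *\<^sub>R (Gam b x ** J x))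
       - (\<Sum>b\<in>UNIV. J x $ b $ i *\<^sub>R (J x ** Gam b x)) - J x ** pd i J x - J x ** Gam i x ** J x - Gam i x" for i
      using x by (simp add: nabJ_defect_def nabJ_def matrix_mult_simps J_J scaleR_add_right scaleR_diff_right sum.distrib sum_subtractf)
    have sy: "(\<Sum>b\<in>UNIV. J x $ b $ i *\<^sub>R (Gam b x ** J x)) $ k $ j = (\<Sum>b\<in>UNIV. J x $ b $ j *\<^sub>R (Gam b x ** J x)) $ k $ i"
      unfolding JG using Gam_sym[OF x, of _ k] 
      by (subst sum.swap) (simp add: mult.commute mult.left_commute)
    have nij': "((\<Sum>b\<in>UNIV. J x $ b $ i *\<^sub>R pd b J x) *v axis j 1
     - (\<Sum>b\<in>UNIV. J x $ b $ j *\<^sub>R pd b J x) *v axis i 1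
     - (J x ** pd i J x) *v axis j 1 + (J x ** pd j J x) *v axis i 1) $ k = 0"
      using nij by (simp add: nij_zero_def)
    then have "(\<Sum>b\<in>UNIV. J x $ b $ i *\<^sub>R pd b J x) $ k $ j - (\<Sum>b\<in>UNIV. J x $ b $ j *\<^sub>R pd b J x) $ k $ i
      - (J x ** pd i J x) $ k $ j + (J x ** pd j J x) $ k $ i = 0"
      by (simp add: matrix_vector_mult_basis column_def)
    then show ?thesis
      using sy JM[of i j] JM[of j i] Gam_sym[OF x, of i k j]
      unfolding Bexp[of i] Bexp[of j] by (simp only: vector_add_component vector_minus_component)
  qed
  define b where "b i j k = (G x ** nabJ_defect i x) $ k $ j" for i j k
  have b1: "b i j k = b j i k" for i j k
    unfolding b_def matrix_matrix_mult_def using nabJ_defect'[of i _ j] by simp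
  have b2: "b i j k = - b i k j" for i j k
  proof -
    have "transpose (G x ** nabJ_defect i x) $ j $ k = (- (G x ** nabJ_defect i x)) $ j $ k"
      using nabJ_defect_G_skew[OF x] by simp
    then show ?thesis by (simp add: b_def transpose_def)
  qed
  \<comment> \<open>Alternating the symmetry in the first two indices with the skewness in the last
    two returns to the start after six moves, three of which change the sign.\<close>
  have "b i j k = 0" for i j k
    using b1[of i j k] b2[of j i k] b1[of j k i] b2[of k j i] b1[of k i j] b2[of i k j] by linarith
  then have "G x ** nabJ_defect i x = 0"
    by (simp add: b_def vec_eq_iff)
  then have "H x ** (G x ** nabJ_defect i x) = 0"
    by (simp add: matrix_mult_simps)
  then show ?thesis
    using x by (simp add: matrix_mul_assoc H_G)
qed

text \<open>By \<open>\<nabla>\<^sub>J\<^sub>X J = J \<nabla>\<^sub>X J\<close>, rotating the summation frame by \<open>J\<close> changes the sign of the sum.\<close>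

lemma quadratic_mixed:
  assumes x: "x \<in> U" and nij: "nij_zero x"
  shows "(\<Sum>i\<in>UNIV. \<Sum>a\<in>UNIV. (nabJ a x ** nabJ i x ** H x) $ i $ a) = 0"
proof -
  let ?T = "\<Sum>i\<in>UNIV. \<Sum>a\<in>UNIV. (nabJ a x ** nabJ i x ** H x) $ i $ a"
  \<comment> \<open>A product of two matrices \<open>nabJ\<close> commutes with J, and H with J
    transposed gives -J H; so rotating both free indices by J changes nothing.\<close>
  have e: "J x ** nabJ b x ** nabJ i x ** H x ** transpose (J x) = nabJ b x ** nabJ i x ** H x" for b i
  proof -
    have ac: "M ** nabJ i x ** J x = - (M ** J x ** nabJ i x)" for M i
      using nabJ_anticomm[OF x, of i] by (simp add: matrix_mul_assoc[symmetric] matrix_mult_simps(6))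
    have "J x ** nabJ b x ** nabJ i x ** H x ** transpose (J x) = - (J x ** nabJ b x ** nabJ i x ** J x ** H x)"
      using H_Jt[OF x] by (simp add: matrix_mul_assoc[symmetric] matrix_mult_simps(6))
    then show ?thesis
      using x by (simp add: ac J_J matrix_mult_simps)
  qed
  have mt: "(M ** transpose (J x)) $ i $ b = (\<Sum>a\<in>UNIV. M $ i $ a * J x $ b $ a)" for M :: "real ^ 'n ^ 'n" and i b
    by (simp add: matrix_matrix_mult_def transpose_def)
  have JA: "(\<Sum>b\<in>UNIV. J x $ b $ a *\<^sub>R nabJ b x) = J x ** nabJ a x" for a
    using nabJ_defect_zero[OF x nij, of a] by (simp add: nabJ_defect_def)
  \<comment> \<open>The identity for D_{JX} J, multiplied by J: it trades the direction
    \<open>a\<close> for the rotated one at the cost of a minus sign.\<close>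
  have A1: "nabJ a x = - (\<Sum>b\<in>UNIV. J x $ b $ a *\<^sub>R (J x ** nabJ b x))" for a
  proof -
    have "J x ** (\<Sum>b\<in>UNIV. J x $ b $ a *\<^sub>R nabJ b x) = - nabJ a x"
      using x by (simp add: JA matrix_mul_assoc J_J matrix_mult_simps)
    then show ?thesis
      by (simp add: matrix_mult_sum_right matrix_mult_simps)
  qed
  have "(nabJ a x ** nabJ i x ** H x) $ i $ a = - (\<Sum>b\<in>UNIV. J x $ b $ a * (J x ** nabJ b x ** nabJ i x ** H x) $ i $ a)" for i a
    by (subst A1) (simp add: matrix_mult_simps matrix_mult_sum_left)
  moreover have tr: "(\<Sum>a\<in>UNIV. \<Sum>b\<in>UNIV. (J x ** nabJ b x ** nabJ i x ** H x) $ i $ a * J x $ b $ a)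
      = (\<Sum>b\<in>UNIV. (J x ** nabJ b x ** nabJ i x ** H x ** transpose (J x)) $ i $ b)" for i
    by (subst sum.swap) (simp add: mt)
  ultimately have "?T = - (\<Sum>i\<in>UNIV. \<Sum>a\<in>UNIV. \<Sum>b\<in>UNIV. (J x ** nabJ b x ** nabJ i x ** H x) $ i $ a * J x $ b $ a)"
    by (simp add: sum_negf mult.commute)
  also have "\<dots> = - (\<Sum>i\<in>UNIV. \<Sum>b\<in>UNIV. (J x ** nabJ b x ** nabJ i x ** H x ** transpose (J x)) $ i $ b)"
    unfolding tr ..
  also have "\<dots> = - ?T"
    unfolding e ..
  finally show ?thesis by simp
qed

text \<open>Riem + J Riem J is J times the commutator of Riem with J, which the Ricci identity
  expresses by derivatives of \<open>nabJ\<close>. Moving J under the derivative gives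
  \<open>DC\<close> up to products of two first derivatives of J, and the four contractions are the
  preceding lemmas.\<close>

theorem SJ_eq:
  assumes x: "x \<in> U" and nij: "nij_zero x"
  shows "SJ x = 2 * dvg W x + W x \<bullet> (G x *v W x)"
proof -
  have d: "J differentiable (at x)" "nabJ a differentiable (at x)" "H differentiable (at x)" for a
    using differentiable[OF smooth_J x] differentiable[OF smooth_nabJ x] differentiable[OF smooth_H x] .
  have dJA: "(\<lambda>x. J x ** nabJ a x) differentiable (at x)" for a
    using openU smooth_J smooth_nabJ by (intro differentiable[OF _ x] smooth_intros)
  \<comment> \<open>Leibniz rule for \<open>J ** nabJ a ** H\<close>, with H parallel.\<close>
  have DCe: "DC i a x = (J x ** (pd i (nabJ a) x + Gam i x ** nabJ a x - nabJ a x ** Gam i x) + nabJ i x ** nabJ a x) ** H x" for i a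
  proof -
    have "pd i (C a) x = pd i (\<lambda>x. J x ** nabJ a x) x ** H x + J x ** nabJ a x ** pd i H x"
      using d dJA by (simp add: C_def[abs_def] pd_matrix_mult)
    also have "pd i (\<lambda>x. J x ** nabJ a x) x = pd i J x ** nabJ a x + J x ** pd i (nabJ a) x"
      using d by (simp add: pd_matrix_mult)
    finally have pC: "pd i (C a) x = (pd i J x ** nabJ a x + J x ** pd i (nabJ a) x) ** H x + J x ** nabJ a x ** pd i H x" .
    show ?thesis
      unfolding DC_def pC using x by (simp add: C_def pd_H nabJ_def[of i] matrix_mult_simps algebra_simps)
  qed
  have "Riem i a x + J x ** Riem i a x ** J x = J x ** (Riem i a x ** J x - J x ** Riem i a x)" for i a
    using x by (simp add: matrix_mult_simps J_J)
  note RJ = this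
  have e: "(Riem i a x + J x ** Riem i a x ** J x) ** H x =
      DC i a x - DC a i x - nabJ i x ** nabJ a x ** H x + nabJ a x ** nabJ i x ** H x" for i a
    unfolding RJ Riem_J[OF x] DCe by (simp add: matrix_mult_simps algebra_simps)
  \<comment> \<open>Skewness of \<open>DC\<close> turns the exchanged contraction into minus the
    divergence, so the difference contributes it twice.\<close>
  have "(\<Sum>i\<in>UNIV. \<Sum>a\<in>UNIV. DC a i x $ i $ a) = (\<Sum>i\<in>UNIV. \<Sum>a\<in>UNIV. - DC a i x $ a $ i)"
    by (intro sum.cong refl DC_skew[OF x])
  also have "\<dots> = - (\<Sum>a\<in>UNIV. \<Sum>i\<in>UNIV. DC a i x $ a $ i)"
    by (subst sum.swap) (simp add: sum_negf)
  finally have DC': "(\<Sum>i\<in>UNIV. \<Sum>a\<in>UNIV. DC a i x $ i $ a) = - dvg W x"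
    using sum_DC[OF x] by simp
  show ?thesis
    unfolding SJ_def e
    by (simp add: sum.distrib sum_subtractf DC' sum_DC[OF x] quadratic_norm[OF x] quadratic_mixed[OF x nij])
qed

end

section \<open>Charts, tangent vectors and vector fields\<close>

abbreviation cdom :: "('a, 'n::finite) chart \<Rightarrow> (real ^ 'n) set" where
  "cdom c \<equiv> snd c ` fst c"

definition overlap :: "('a, 'n::finite) chart \<Rightarrow> ('a, 'n) chart \<Rightarrow> (real ^ 'n) set" where
  "overlap c d = snd c ` (fst c \<inter> fst d)"

definition jac :: "('a, 'n::finite) chart \<Rightarrow> ('a, 'n) chart \<Rightarrow> real ^ 'n \<Rightarrow> real ^ 'n ^ 'n" where
  "jac c d x = (\<chi> k i. pd i (transition c d) x $ k)"

lemma tscale_apply [simp]: "tscale r v c = r *\<^sub>R v c"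
  by (simp add: tscale_def)

locale manifold =
  fixes A :: "('a::{t2_space, second_countable_topology}, 'n::finite) chart set"
  assumes atlas: "smooth_atlas A"
begin

lemma chart_open: "c \<in> A \<Longrightarrow> open (fst c)" and cdom_open: "c \<in> A \<Longrightarrow> open (cdom c)"
  using atlas by (auto simp: smooth_atlas_def is_chart_def)

lemma chart_homeomorphism: "c \<in> A \<Longrightarrow> homeomorphism (fst c) (cdom c) (snd c) (chart_inv c)"
proof -
  assume "c \<in> A"
  then obtain h where h: "homeomorphism (fst c) (cdom c) (snd c) h"
    using atlas by (auto simp: smooth_atlas_def is_chart_def)
  have "inj_on (snd c) (fst c)"
    using homeomorphism_apply1[OF h] by (rule inj_on_inverseI)
  then have "chart_inv c x = h x" if "x \<in> cdom c" for x
    using h that unfolding chart_inv_def homeomorphism_def by (auto simp: inv_into_f_f)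
  then show ?thesis
    using h by (intro homeomorphism_cong[OF h]) auto
qed

lemma chart_inv_left [simp]: "c \<in> A \<Longrightarrow> p \<in> fst c \<Longrightarrow> chart_inv c (snd c p) = p"
  by (rule homeomorphism_apply1[OF chart_homeomorphism])

lemma chart_inv_right [simp]: "c \<in> A \<Longrightarrow> x \<in> cdom c \<Longrightarrow> snd c (chart_inv c x) = x"
  by (rule homeomorphism_apply2[OF chart_homeomorphism])

lemma chart_inv_in [simp]: "c \<in> A \<Longrightarrow> x \<in> cdom c \<Longrightarrow> chart_inv c x \<in> fst c"
  using homeomorphism_image2[OF chart_homeomorphism] by blast

lemma chart_continuous: "c \<in> A \<Longrightarrow> continuous_on (fst c) (snd c)"
  and chart_inv_continuous: "c \<in> A \<Longrightarrow> continuous_on (cdom c) (chart_inv c)"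
  using chart_homeomorphism[of c] by (auto simp: homeomorphism_def)

lemma charts_at_iff: "c \<in> charts_at A p \<longleftrightarrow> c \<in> A \<and> p \<in> fst c"
  by (auto simp: charts_at_def)

lemma chart_at: "chart_at A p \<in> charts_at A p"
proof -
  obtain c where "c \<in> A" "p \<in> fst c"
    using atlas UNIV_I[of p] unfolding smooth_atlas_def by blast
  then show ?thesis
    unfolding chart_at_def by (intro someI[of "\<lambda>c. c \<in> charts_at A p" c]) (simp add: charts_at_def)
qed

lemma chart_preimage_open:
  assumes "c \<in> A" "open S"
  shows "open {x \<in> cdom c. chart_inv c x \<in> S}"
  using continuous_open_preimage[OF chart_inv_continuous[OF assms(1)] cdom_open[OF assms(1)] assms(2)]
  by (simp add: vimage_def Int_def)

lemma overlap_eq: "c \<in> A \<Longrightarrow> overlap c d = {x \<in> cdom c. chart_inv c x \<in> fst d}"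
  unfolding overlap_def by force

lemma overlap_open: "c \<in> A \<Longrightarrow> d \<in> A \<Longrightarrow> open (overlap c d)"
  by (simp add: overlap_eq chart_preimage_open chart_open)

lemma overlap_subset: "overlap c d \<subseteq> cdom c"
  by (auto simp: overlap_def)

lemma transition_smooth: "c \<in> A \<Longrightarrow> d \<in> A \<Longrightarrow> smooth_on (overlap c d) (transition c d)"
  using atlas by (auto simp: smooth_atlas_def overlap_def)

lemma transition_snd [simp]: "c \<in> A \<Longrightarrow> p \<in> fst c \<Longrightarrow> transition c d (snd c p) = snd d p"
  by (simp add: transition_def)

lemma transition_in: "c \<in> A \<Longrightarrow> x \<in> overlap c d \<Longrightarrow> transition c d x \<in> overlap d c"
  by (auto simp: overlap_def)

lemma chart_inv_transition: "c \<in> A \<Longrightarrow> d \<in> A \<Longrightarrow> x \<in> overlap c d \<Longrightarrow> chart_inv d (transition c d x) = chart_inv c x"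
  by (auto simp: overlap_def)

lemma overlapI: "p \<in> fst c \<Longrightarrow> p \<in> fst d \<Longrightarrow> snd c p \<in> overlap c d"
  by (auto simp: overlap_def)

lemma transition_differentiable:
  "c \<in> A \<Longrightarrow> d \<in> A \<Longrightarrow> x \<in> overlap c d \<Longrightarrow> transition c d differentiable (at x)"
  using smooth_on_differentiable transition_smooth overlap_open by blast

lemma transition_derivative:
  assumes "c \<in> A" "d \<in> A" "x \<in> overlap c d"
  shows "frechet_derivative (transition c d) (at x) v = jac c d x *v v"
  unfolding frechet_derivative_pd[OF transition_differentiable[OF assms]]
  by (simp add: vec_eq_iff jac_def matrix_vector_mult_def mult.commute)

lemma transition_has_derivative:
  assumes "c \<in> A" "d \<in> A" "x \<in> overlap c d"
  shows "(transition c d has_derivative (\<lambda>v. jac c d x *v v)) (at x)"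
proof -
  have "frechet_derivative (transition c d) (at x) = (\<lambda>v. jac c d x *v v)"
    using transition_derivative[OF assms] by blast
  then show ?thesis
    using frechet_derivative_has_derivative[OF transition_differentiable[OF assms]] by simp
qed

lemma jac_smooth: "c \<in> A \<Longrightarrow> d \<in> A \<Longrightarrow> smooth_on (overlap c d) (jac c d)"
  unfolding jac_def[abs_def] by (intro smooth_intros overlap_open transition_smooth)

lemma jac_self:
  assumes "c \<in> A" "p \<in> fst c" shows "jac c c (snd c p) = mat 1"
proof -
  have "pd i (transition c c) (snd c p) = pd i (\<lambda>x. x) (snd c p)" for i
    using assms by (intro pd_cong[OF overlap_open[of c c]]) (auto simp: overlap_def)
  then show ?thesis
    by (simp add: vec_eq_iff jac_def pd_def mat_def axis_def)
qed

text \<open>Chain rule on the part of the chart where all three domains meet.\<close>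

lemma jac_chain:
  assumes "c \<in> A" "d \<in> A" "e \<in> A" "p \<in> fst c" "p \<in> fst d" "p \<in> fst e"
  shows "jac d e (snd d p) ** jac c d (snd c p) = jac c e (snd c p)"
proof -
  let ?S = "{x \<in> cdom c. chart_inv c x \<in> fst d \<inter> fst e}"
  have oS: "open ?S" using assms by (intro chart_preimage_open) (auto simp: chart_open)
  have pS: "snd c p \<in> ?S" using assms by auto
  have "((transition d e \<circ> transition c d) has_derivative ((\<lambda>v. jac d e (snd d p) *v v) \<circ> (\<lambda>v. jac c d (snd c p) *v v))) (at (snd c p))"
    using assms transition_has_derivative[OF assms(1,2), of "snd c p"] transition_has_derivative[OF assms(2,3), of "snd d p"]
    by (intro diff_chain_at) (simp_all add: overlapI)
  moreover have "(transition d e \<circ> transition c d) x = transition c e x" if "x \<in> ?S" for x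
    using that assms by (auto simp: transition_def)
  ultimately have "(transition c e has_derivative ((\<lambda>v. jac d e (snd d p) *v v) \<circ> (\<lambda>v. jac c d (snd c p) *v v))) (at (snd c p))"
    using has_derivative_transform_within_open[OF _ oS pS] by blast
  then have "(\<lambda>v. jac c e (snd c p) *v v) = (\<lambda>v. jac d e (snd d p) *v (jac c d (snd c p) *v v))"
    using has_derivative_unique[OF transition_has_derivative[OF assms(1,3)]] assms overlapI
    by (metis (no_types, lifting) comp_def ext)
  then have "jac c e (snd c p) *v v = (jac d e (snd d p) ** jac c d (snd c p)) *v v" for v
    by (simp add: matrix_vector_mul_assoc fun_eq_iff)
  then show ?thesis
    by (simp add: matrix_eq)
qed

lemma jac_inverse:
  assumes "c \<in> A" "d \<in> A" "p \<in> fst c" "p \<in> fst d"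
  shows "jac d c (snd d p) ** jac c d (snd c p) = mat 1"
  using jac_chain[OF assms(1,2,1,3,4,3)] jac_self[OF assms(1,3)] by simp

section \<open>Tangent vectors in coordinates\<close>

lemma tangent_space_iff:
  "v \<in> tangent_space A p \<longleftrightarrow> (\<forall>c. c \<notin> charts_at A p \<longrightarrow> v c = 0) \<and>
     (\<forall>c\<in>charts_at A p. \<forall>d\<in>charts_at A p. v d = jac c d (snd c p) *v v c)"
  unfolding tangent_space_def by (auto simp: transition_derivative charts_at_iff overlapI)

lemma tangent_transform:
  "v \<in> tangent_space A p \<Longrightarrow> c \<in> charts_at A p \<Longrightarrow> d \<in> charts_at A p \<Longrightarrow> v d = jac c d (snd c p) *v v c"
  unfolding tangent_space_iff by blast

lemma tangent_outside: "v \<in> tangent_space A p \<Longrightarrow> c \<notin> charts_at A p \<Longrightarrow> v c = 0"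
  unfolding tangent_space_iff by blast

lemma tangentI:
  "(\<And>c. c \<notin> charts_at A p \<Longrightarrow> v c = 0) \<Longrightarrow>
   (\<And>c d. c \<in> charts_at A p \<Longrightarrow> d \<in> charts_at A p \<Longrightarrow> v d = jac c d (snd c p) *v v c) \<Longrightarrow>
   v \<in> tangent_space A p"
  unfolding tangent_space_iff by blast

definition tvec_of :: "('a, 'n) chart \<Rightarrow> 'a \<Rightarrow> real ^ 'n \<Rightarrow> ('a, 'n) tvec" where
  "tvec_of c p v = (\<lambda>d. if d \<in> charts_at A p then jac c d (snd c p) *v v else 0)"

lemma tvec_of_tangent: "c \<in> charts_at A p \<Longrightarrow> tvec_of c p v \<in> tangent_space A p"
  by (auto simp: tangent_space_iff tvec_of_def charts_at_iff matrix_vector_mul_assoc jac_chain)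

lemma tvec_of_self [simp]: "c \<in> charts_at A p \<Longrightarrow> tvec_of c p v c = v"
  by (simp add: tvec_of_def charts_at_iff jac_self)

text \<open>One chart determines the whole family: the other entries follow by Jacobians or are 0.
  Together with \<open>tvec_of\<close> this identifies the tangent space with R^n.\<close>

lemma tangent_eqI:
  assumes "v \<in> tangent_space A p" "w \<in> tangent_space A p" "c \<in> charts_at A p" "v c = w c"
  shows "v = w"
proof
  fix d show "v d = w d"
    using assms tangent_transform[OF assms(1,3), of d] tangent_transform[OF assms(2,3), of d]
      tangent_outside[OF assms(1), of d] tangent_outside[OF assms(2), of d]
    by (cases "d \<in> charts_at A p") auto
qed

lemma coord_vec_eq: "c \<in> charts_at A p \<Longrightarrow> coord_vec A c p i = tvec_of c p (axis i 1)"
  by (auto simp: coord_vec_def tvec_of_def fun_eq_iff charts_at_iff transition_derivative overlapI)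

lemma tangent_zero: "0 \<in> tangent_space A p"
  by (simp add: tangent_space_iff)

lemma tangent_add:
  assumes v: "v \<in> tangent_space A p" and w: "w \<in> tangent_space A p"
  shows "v + w \<in> tangent_space A p"
proof (rule tangentI)
  show "(v + w) c = 0" if "c \<notin> charts_at A p" for c
    using that v w by (simp add: tangent_outside)
  show "(v + w) d = jac c d (snd c p) *v (v + w) c" if "c \<in> charts_at A p" "d \<in> charts_at A p" for c d
    using tangent_transform[OF v that] tangent_transform[OF w that] by (simp add: matrix_vector_simps)
qed

lemma tangent_scale:
  assumes v: "v \<in> tangent_space A p"
  shows "tscale r v \<in> tangent_space A p"
proof (rule tangentI)
  show "tscale r v c = 0" if "c \<notin> charts_at A p" for c
    using that v by (simp add: tangent_outside)
  show "tscale r v d = jac c d (snd c p) *v tscale r v c" if "c \<in> charts_at A p" "d \<in> charts_at A p" for c d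
    using tangent_transform[OF v that] by (simp add: matrix_vector_simps)
qed

lemma tangent_minus: "v \<in> tangent_space A p \<Longrightarrow> - v \<in> tangent_space A p"
  using tangent_scale[of v p "- 1"] by (simp add: tscale_def fun_Compl_def)

lemma tangent_diff: "v \<in> tangent_space A p \<Longrightarrow> w \<in> tangent_space A p \<Longrightarrow> v - w \<in> tangent_space A p"
  using tangent_add[OF _ tangent_minus] by fastforce

lemma coord_vec_tangent: "c \<in> charts_at A p \<Longrightarrow> coord_vec A c p i \<in> tangent_space A p"
  by (simp add: coord_vec_eq tvec_of_tangent)

lemma tangent_sum:
  "(\<And>i. i \<in> I \<Longrightarrow> v i \<in> tangent_space A p) \<Longrightarrow> sum v I \<in> tangent_space A p"
  by (induction I rule: infinite_finite_induct) (auto simp: tangent_zero intro: tangent_add)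

lemma sum_tvec_apply: "sum v I (c :: ('a, 'n) chart) = (\<Sum>i\<in>I. v i c :: real ^ 'n)"
  by (induction I rule: infinite_finite_induct) auto

text \<open>\<open>F\<close> is linear only on the tangent space, a subset of its domain type. The
  sum is therefore pulled out by induction, every partial sum being tangent again.\<close>

lemma tangent_linear_expand:
  fixes F :: "('a, 'n) tvec \<Rightarrow> 'b::real_vector"
  assumes add: "\<And>v w. v \<in> tangent_space A p \<Longrightarrow> w \<in> tangent_space A p \<Longrightarrow> F (v + w) = F v + F w"
    and scale: "\<And>v r. v \<in> tangent_space A p \<Longrightarrow> F (tscale r v) = r *\<^sub>R F v"
    and c: "c \<in> charts_at A p" and v: "v \<in> tangent_space A p"
  shows "F v = (\<Sum>i\<in>UNIV. v c $ i *\<^sub>R F (coord_vec A c p i))"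
proof -
  let ?e = "\<lambda>i. tscale (v c $ i) (coord_vec A c p i)"
  have e: "?e i \<in> tangent_space A p" for i
    by (intro tangent_scale coord_vec_tangent c)
  have z: "F 0 = 0"
    using add[OF tangent_zero tangent_zero] by simp
  have "F (sum ?e I) = (\<Sum>i\<in>I. F (?e i))" for I :: "'n set"
    using finite[of I]
  proof (induction I rule: finite_induct)
    case (insert i I)
    have "F (sum ?e (insert i I)) = F (?e i + sum ?e I)"
      by (simp only: sum.insert[OF insert(1,2)])
    also have "\<dots> = F (?e i) + F (sum ?e I)"
      by (intro add e tangent_sum)
    finally show ?case
      by (simp only: sum.insert[OF insert(1,2)] insert.IH)
  qed (simp only: sum.empty z)
  moreover have "v = sum ?e UNIV"
  proof (rule tangent_eqI[OF v _ c])
    have "(\<Sum>i\<in>UNIV. v c $ i *\<^sub>R axis i 1) = v c"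
      using basis_expansion[of "v c"] by (simp add: scalar_mult_eq_scaleR)
    then show "v c = sum ?e UNIV c"
      using c by (simp add: sum_tvec_apply coord_vec_eq)
  qed (rule tangent_sum[OF e])
  ultimately have "F v = (\<Sum>i\<in>UNIV. F (?e i))"
    by metis
  then show ?thesis
    by (simp add: scale coord_vec_tangent c)
qed

section \<open>Differentials and Lie brackets in charts\<close>

lemma differentiable_chart_change:
  fixes f :: "'a \<Rightarrow> 'b::real_normed_vector"
  assumes c: "c \<in> charts_at A p" and d: "d \<in> charts_at A p"
    and f: "(f \<circ> chart_inv d) differentiable (at (snd d p))"
  shows "((f \<circ> chart_inv c) has_derivative (\<lambda>v. frechet_derivative (f \<circ> chart_inv d) (at (snd d p)) (jac c d (snd c p) *v v))) (at (snd c p))"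
proof -
  have cd: "c \<in> A" "d \<in> A" "p \<in> fst c" "p \<in> fst d"
    using c d by (auto simp: charts_at_iff)
  have "(((f \<circ> chart_inv d) \<circ> transition c d) has_derivative
     (frechet_derivative (f \<circ> chart_inv d) (at (snd d p)) \<circ> (\<lambda>v. jac c d (snd c p) *v v))) (at (snd c p))"
    using f cd by (intro diff_chain_at transition_has_derivative) (simp_all add: overlapI frechet_derivative_has_derivative)
  moreover have "((f \<circ> chart_inv d) \<circ> transition c d) x = (f \<circ> chart_inv c) x" if "x \<in> overlap c d" for x
    using cd that by (simp add: chart_inv_transition)
  ultimately have "((f \<circ> chart_inv c) has_derivative
     (frechet_derivative (f \<circ> chart_inv d) (at (snd d p)) \<circ> (\<lambda>v. jac c d (snd c p) *v v))) (at (snd c p))"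
    using has_derivative_transform_within_open[OF _ overlap_open[OF cd(1,2)] overlapI[OF cd(3,4)]] by blast
  then show ?thesis by (simp add: o_def)
qed

text \<open>The chain rule removes the arbitrary chart chosen in
  \<open>differential\<close>.\<close>

lemma differential_chart:
  assumes c: "c \<in> charts_at A p" and v: "v \<in> tangent_space A p"
    and f: "(f \<circ> chart_inv c) differentiable (at (snd c p))"
  shows "differential A f p v = (\<Sum>i\<in>UNIV. v c $ i * pd i (f \<circ> chart_inv c) (snd c p))"
proof -
  let ?d = "chart_at A p"
  have "frechet_derivative (f \<circ> chart_inv ?d) (at (snd ?d p)) =
      (\<lambda>v. frechet_derivative (f \<circ> chart_inv c) (at (snd c p)) (jac ?d c (snd ?d p) *v v))"
    using frechet_derivative_at[OF differentiable_chart_change[OF chart_at c f]] by simp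
  then have "differential A f p v = frechet_derivative (f \<circ> chart_inv c) (at (snd c p)) (v c)"
    unfolding differential_def Let_def using tangent_transform[OF v chart_at c] by simp
  then show ?thesis
    by (simp add: frechet_derivative_pd[OF f])
qed

lemma smooth_fun_differentiable:
  "smooth_fun A f \<Longrightarrow> c \<in> charts_at A p \<Longrightarrow> (f \<circ> chart_inv c) differentiable (at (snd c p))"
  using smooth_on_differentiable[of "cdom c" "f \<circ> chart_inv c"] by (auto simp: smooth_fun_def charts_at_iff cdom_open)

lemma vf_rep_snd [simp]: "c \<in> charts_at A p \<Longrightarrow> vf_rep c X (snd c p) = X p c"
  by (simp add: vf_rep_def charts_at_iff)

lemma smooth_vf_tangent: "smooth_vf A X \<Longrightarrow> X p \<in> tangent_space A p"
  by (simp add: smooth_vf_def)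

lemma smooth_vf_rep: "smooth_vf A X \<Longrightarrow> c \<in> A \<Longrightarrow> smooth_on (cdom c) (vf_rep c X)"
  by (simp add: smooth_vf_def)

lemma smooth_vf_rep_differentiable:
  "smooth_vf A X \<Longrightarrow> c \<in> charts_at A p \<Longrightarrow> vf_rep c X differentiable (at (snd c p))"
  using smooth_on_differentiable[OF smooth_vf_rep[of X c] cdom_open, of "snd c p"] by (auto simp: charts_at_iff)

lemma vf_rep_transform:
  assumes "\<And>p. X p \<in> tangent_space A p" "c \<in> A" "d \<in> A" "x \<in> overlap c d"
  shows "vf_rep d X (transition c d x) = jac c d x *v vf_rep c X x"
proof -
  obtain p where p: "x = snd c p" "p \<in> fst c" "p \<in> fst d"
    using assms by (auto simp: overlap_def)
  then show ?thesis
    using assms tangent_transform[OF assms(1), of c p d] by (simp add: charts_at_iff vf_rep_def)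
qed

lemma pd_jac_sym:
  assumes "c \<in> A" "d \<in> A" "x \<in> overlap c d"
  shows "pd i (jac c d) x $ k $ j = pd j (jac c d) x $ k $ i"
proof -
  have e: "pd i (jac c d) x $ k $ j = pd i (pd j (transition c d)) x $ k" for i j
  proof -
    have d1: "jac c d differentiable (at x)"
      using smooth_on_differentiable[OF jac_smooth overlap_open] assms by blast
    have d2: "pd j (transition c d) differentiable (at x)"
      using smooth_on_differentiable[OF smooth_on_pd[OF transition_smooth overlap_open] overlap_open] assms by blast
    have "pd i (jac c d) x $ k $ j = pd i (\<lambda>x. jac c d x $ k $ j) x"
      using d1 differentiable_vec_nth[OF d1, of k] by (simp add: pd_vec_nth)
    also have "\<dots> = pd i (pd j (transition c d)) x $ k"
      using d2 by (simp add: jac_def pd_vec_nth)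
    finally show ?thesis .
  qed
  show ?thesis
    unfolding e using pd_commute[OF transition_smooth overlap_open] assms by metis
qed

lemma lie_bracket_chart:
  assumes "smooth_vf A X" "smooth_vf A Y" "c \<in> charts_at A p"
  shows "lie_bracket A X Y p c = (\<Sum>i\<in>UNIV. X p c $ i *\<^sub>R pd i (vf_rep c Y) (snd c p)) - (\<Sum>i\<in>UNIV. Y p c $ i *\<^sub>R pd i (vf_rep c X) (snd c p))"
  using assms by (simp add: lie_bracket_def frechet_derivative_pd smooth_vf_rep_differentiable)

text \<open>Under a change of chart each half of the bracket acquires a term with second derivatives
  of the transition map; these are symmetric in X and Y and cancel.\<close>

lemma lie_bracket_tangent:
  assumes X: "smooth_vf A X" and Y: "smooth_vf A Y"
  shows "lie_bracket A X Y p \<in> tangent_space A p"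
  unfolding tangent_space_iff
proof (intro conjI allI impI ballI)
  fix c d assume c: "c \<in> charts_at A p" and d: "d \<in> charts_at A p"
  then have cd: "c \<in> A" "d \<in> A" "p \<in> fst c" "p \<in> fst d"
    by (auto simp: charts_at_iff)
  let ?x = "snd c p"
  have xo: "?x \<in> overlap c d" using cd by (intro overlapI)
  have dj: "jac c d differentiable (at ?x)"
    using smooth_on_differentiable[OF jac_smooth overlap_open] cd xo by blast
  have D: "(\<Sum>i\<in>UNIV. X p d $ i *\<^sub>R pd i (vf_rep d Y) (snd d p)) =
      (\<Sum>i\<in>UNIV. X p c $ i *\<^sub>R (pd i (jac c d) ?x *v Y p c)) + jac c d ?x *v (\<Sum>i\<in>UNIV. X p c $ i *\<^sub>R pd i (vf_rep c Y) ?x)"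
    if X: "smooth_vf A X" and Y: "smooth_vf A Y" for X Y
  proof -
    have "(\<Sum>i\<in>UNIV. X p d $ i *\<^sub>R pd i (vf_rep d Y) (snd d p)) = frechet_derivative (vf_rep d Y) (at (snd d p)) (X p d)"
      using Y d by (simp add: frechet_derivative_pd smooth_vf_rep_differentiable)
    also have "\<dots> = frechet_derivative (vf_rep d Y) (at (snd d p)) (frechet_derivative (transition c d) (at ?x) (X p c))"
      using tangent_transform[OF smooth_vf_tangent[OF X] c d] cd by (simp add: transition_derivative xo)
    also have "\<dots> = frechet_derivative (\<lambda>x. vf_rep d Y (transition c d x)) (at ?x) (X p c)"
    proof -
      have "((vf_rep d Y \<circ> transition c d) has_derivative (frechet_derivative (vf_rep d Y) (at (snd d p)) \<circ> frechet_derivative (transition c d) (at ?x))) (at ?x)"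
      proof (intro diff_chain_at)
        show "(transition c d has_derivative frechet_derivative (transition c d) (at ?x)) (at ?x)"
          using cd xo by (intro frechet_derivative_has_derivative transition_differentiable)
        show "(vf_rep d Y has_derivative frechet_derivative (vf_rep d Y) (at (snd d p))) (at (transition c d ?x))"
          unfolding transition_snd[OF cd(1,3)]
          by (intro frechet_derivative_has_derivative smooth_vf_rep_differentiable Y d)
      qed
      from fun_cong[OF frechet_derivative_at[OF this], of "X p c"] show ?thesis
        by (simp only: o_def)
    qed
    also have "\<dots> = frechet_derivative (\<lambda>x. jac c d x *v vf_rep c Y x) (at ?x) (X p c)"
      using vf_rep_transform[OF smooth_vf_tangent[OF Y]] cd
      by (subst frechet_derivative_cong_open[OF overlap_open[OF cd(1,2)] xo]) auto
    also have "\<dots> = (\<Sum>i\<in>UNIV. X p c $ i *\<^sub>R pd i (\<lambda>x. jac c d x *v vf_rep c Y x) ?x)"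
    proof (rule frechet_derivative_pd)
      show "(\<lambda>x. jac c d x *v vf_rep c Y x) differentiable at ?x"
        using bounded_bilinear.FDERIV[OF bounded_bilinear_matrix_vector_mult frechet_derivative_has_derivative[OF dj]
          frechet_derivative_has_derivative[OF smooth_vf_rep_differentiable[OF Y c]]]
        by (auto simp: differentiable_def)
    qed
    also have "\<dots> = (\<Sum>i\<in>UNIV. X p c $ i *\<^sub>R (pd i (jac c d) ?x *v Y p c + jac c d ?x *v pd i (vf_rep c Y) ?x))"
      using pd_matrix_vector_mult[OF dj smooth_vf_rep_differentiable[OF Y c]] c by simp
    also have "\<dots> = (\<Sum>i\<in>UNIV. X p c $ i *\<^sub>R (pd i (jac c d) ?x *v Y p c)) + jac c d ?x *v (\<Sum>i\<in>UNIV. X p c $ i *\<^sub>R pd i (vf_rep c Y) ?x)"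
      by (simp add: scaleR_add_right sum.distrib matrix_vector_sum_right matrix_vector_simps)
    finally show ?thesis .
  qed
  have S: "(\<Sum>i\<in>UNIV. X p c $ i *\<^sub>R (pd i (jac c d) ?x *v Y p c)) = (\<Sum>i\<in>UNIV. Y p c $ i *\<^sub>R (pd i (jac c d) ?x *v X p c))"
  proof -
    have "(\<Sum>i\<in>UNIV. X p c $ i *\<^sub>R (pd i (jac c d) ?x *v Y p c)) $ k = (\<Sum>i\<in>UNIV. Y p c $ i *\<^sub>R (pd i (jac c d) ?x *v X p c)) $ k" for k
    proof -
      have "(\<Sum>i\<in>UNIV. X p c $ i *\<^sub>R (pd i (jac c d) ?x *v Y p c)) $ k = (\<Sum>i\<in>UNIV. \<Sum>j\<in>UNIV. X p c $ i * pd i (jac c d) ?x $ k $ j * Y p c $ j)"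
        by (simp add: matrix_vector_mult_def sum_distrib_left mult.assoc)
      also have "\<dots> = (\<Sum>j\<in>UNIV. \<Sum>i\<in>UNIV. Y p c $ j * pd j (jac c d) ?x $ k $ i * X p c $ i)"
        using pd_jac_sym[OF cd(1,2) xo] by (subst sum.swap) (simp add: mult.commute mult.left_commute)
      also have "\<dots> = (\<Sum>i\<in>UNIV. Y p c $ i *\<^sub>R (pd i (jac c d) ?x *v X p c)) $ k"
        by (simp add: matrix_vector_mult_def sum_distrib_left mult.assoc)
      finally show ?thesis .
    qed
    then show ?thesis by (simp add: vec_eq_iff)
  qed
  show "lie_bracket A X Y p d = jac c d (snd c p) *v lie_bracket A X Y p c"
    unfolding lie_bracket_chart[OF X Y c] lie_bracket_chart[OF X Y d] D[OF X Y] D[OF Y X] S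
    by (simp add: matrix_vector_simps)
qed (simp add: lie_bracket_def)

end

section \<open>Bump functions and extension of tangent vectors\<close>

text \<open>exp(-1/t) with powers of 1/t attached: the span of this family is closed under
  differentiation, and every member is flat at 0.\<close>

definition flat_exp :: "nat \<Rightarrow> real \<Rightarrow> real" where
  "flat_exp k t = (if t > 0 then exp (- inverse t) * inverse t ^ k else 0)"

text \<open>The substitution s = 1/t reduces the limit from the right to the decay of s^k / exp
  s.\<close>

lemma flat_exp_tendsto_0: "(flat_exp k \<longlongrightarrow> 0) (at 0)"
proof (rule filterlim_split_at)
  show "(flat_exp k \<longlongrightarrow> 0) (at_left 0)"
    by (rule tendsto_eventually) (auto simp: eventually_at_filter flat_exp_def)
  have "((\<lambda>s. s ^ k / exp s) \<longlongrightarrow> (0::real)) at_top"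
    by (rule tendsto_power_div_exp_0)
  then have "((\<lambda>t. inverse t ^ k / exp (inverse t)) \<longlongrightarrow> (0::real)) (at_right 0)"
    by (rule filterlim_compose) (rule filterlim_inverse_at_top_right)
  then show "(flat_exp k \<longlongrightarrow> 0) (at_right 0)"
    by (rule Lim_transform_eventually)
      (auto simp: eventually_at_filter flat_exp_def exp_minus field_simps)
qed

lemma flat_exp_DERIV:
  "(flat_exp k has_real_derivative flat_exp (k + 2) t - real k * flat_exp (k + 1) t) (at t)"
proof -
  consider "t > 0" | "t < 0" | "t = 0" by linarith
  then show ?thesis
  proof cases
    case 1
    have "((\<lambda>t. exp (- inverse t) * inverse t ^ k) has_real_derivative flat_exp (k + 2) t - real k * flat_exp (k + 1) t) (at t)"
    proof -
      have "((\<lambda>t. exp (- inverse t) * inverse t ^ k) has_real_derivative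
          exp (- inverse t) * (inverse t * inverse t) * inverse t ^ k +
          exp (- inverse t) * (real k * inverse t ^ (k - 1) * - (inverse t * inverse t))) (at t)"
        using 1 by (auto intro!: derivative_eq_intros)
      \<comment> \<open>For k = 0 the truncated exponent \<open>k - 1\<close> is harmless, as its
        term has the factor \<open>real k\<close>.\<close>
      moreover have "e * (s * s) * s ^ k + e * (real k * s ^ (k - 1) * - (s * s)) = e * s ^ (k + 2) - real k * (e * s ^ (k + 1))"
        for e s :: real
        by (cases k) (simp_all add: algebra_simps)
      ultimately have "((\<lambda>t. exp (- inverse t) * inverse t ^ k) has_real_derivative
          exp (- inverse t) * inverse t ^ (k + 2) - real k * (exp (- inverse t) * inverse t ^ (k + 1))) (at t)"
        by (simp only:)
      then show ?thesis
        using 1 by (simp only: flat_exp_def if_True)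
    qed
    then show ?thesis
      by (rule DERIV_cong_ev[THEN iffD1, rotated -1])
        (use 1 eventually_nhds_in_open[of "{0<..}" t] in \<open>auto elim!: eventually_mono simp: flat_exp_def\<close>)
  next
    case 2
    have "((\<lambda>t. 0) has_real_derivative flat_exp (k + 2) t - real k * flat_exp (k + 1) t) (at t)"
      using 2 by (auto simp: flat_exp_def)
    then show ?thesis
      by (rule DERIV_cong_ev[THEN iffD1, rotated -1])
        (use 2 eventually_nhds_in_open[of "{..<0}" t] in \<open>auto elim!: eventually_mono simp: flat_exp_def\<close>)
  next
    case 3
    \<comment> \<open>The difference quotient at 0 is the next member of the family, which tends to
      0.\<close>
    have "((\<lambda>h. (flat_exp k (0 + h) - flat_exp k 0) / h) \<longlongrightarrow> 0) (at 0)"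
      by (rule Lim_transform_eventually[OF flat_exp_tendsto_0[of "k + 1"]])
        (auto simp: eventually_at_filter flat_exp_def field_simps)
    then have "(flat_exp k has_real_derivative 0) (at 0)"
      by (simp add: DERIV_def)
    with 3 show ?thesis by (simp add: flat_exp_def)
  qed
qed

text \<open>The induction leaves \<open>m\<close> free because differentiation raises it.\<close>

lemma Ck_on_flat_exp:
  fixes q :: "real ^ 'n::finite \<Rightarrow> real"
  assumes "open S" "smooth_on S q"
  shows "Ck_on k S (\<lambda>x. flat_exp m (q x))"
proof (induction k arbitrary: m)
  case 0
  have "continuous_on UNIV (flat_exp m)"
    using flat_exp_DERIV by (meson DERIV_isCont continuous_at_imp_continuous_on)
  then show ?case
    using smooth_on_continuous[OF assms(2)] by (auto intro: continuous_on_compose2)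
next
  case (Suc k)
  have d: "((\<lambda>x. flat_exp m (q x)) has_derivative
     (\<lambda>v. (flat_exp (m + 2) (q x) - real m * flat_exp (m + 1) (q x)) * frechet_derivative q (at x) v)) (at x)"
    if "x \<in> S" for x
  proof -
    have "(q has_derivative frechet_derivative q (at x)) (at x)"
      using smooth_on_differentiable[OF assms(2,1) that] by (rule frechet_derivative_has_derivative)
    moreover have "(flat_exp m has_derivative (*) (flat_exp (m + 2) (q x) - real m * flat_exp (m + 1) (q x))) (at (q x))"
      using flat_exp_DERIV[of m "q x"] by (simp add: has_field_derivative_def)
    ultimately show ?thesis
      using diff_chain_at by (fastforce simp: o_def)
  qed
  have "Ck_on k S (\<lambda>x. (flat_exp (m + 2) (q x) + (- real m) * flat_exp (m + 1) (q x)) * pd i q x)" for i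
    using assms Suc.IH smooth_on_pd[OF assms(2,1)]
    by (intro Ck_on_bilinear[OF bounded_bilinear_mult] Ck_on_add Ck_on_const) (auto simp: smooth_on_def)
  moreover have "pd i (\<lambda>x. flat_exp m (q x)) x = (flat_exp (m + 2) (q x) + (- real m) * flat_exp (m + 1) (q x)) * pd i q x"
    if "x \<in> S" for i x
    using pd_has_derivative[OF d[OF that]] by (simp add: pd_def)
  ultimately have "Ck_on k S (pd i (\<lambda>x. flat_exp m (q x)))" for i
    by (subst Ck_on_cong[OF assms(1)]) auto
  then show ?case
    using d by (auto simp: Ck_on_Suc[OF assms(1)] differentiable_def)
qed

definition bump :: "real ^ 'n::finite \<Rightarrow> real \<Rightarrow> real ^ 'n \<Rightarrow> real" where
  "bump a r x = flat_exp 0 (r\<^sup>2 - (x - a) \<bullet> (x - a))"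

lemma smooth_on_bump: "open S \<Longrightarrow> smooth_on S (bump a r)"
proof -
  assume S: "open S"
  have "smooth_on S (\<lambda>x. r\<^sup>2 - (x - a) \<bullet> (x - a))"
    using S by (intro smooth_intros smooth_on_bilinear[OF bounded_bilinear_inner])
  then show ?thesis
    unfolding smooth_on_def bump_def[abs_def] using Ck_on_flat_exp[OF S] by (simp add: smooth_on_def)
qed

lemma bump_pos: "r > 0 \<Longrightarrow> 0 < bump a r x \<longleftrightarrow> dist x a < r"
  by (auto simp: bump_def flat_exp_def dist_norm norm_eq_sqrt_inner real_less_lsqrt real_sqrt_less_iff
      dest: real_less_lsqrt) (smt (verit) real_sqrt_abs real_sqrt_less_iff)

lemma bump_nonneg: "0 \<le> bump a r x"
  by (simp add: bump_def flat_exp_def)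

lemma bump_eq_0: "r > 0 \<Longrightarrow> r \<le> dist x a \<Longrightarrow> bump a r x = 0"
  using bump_pos[of r a x] bump_nonneg[of a r x] by linarith

section \<open>Bump functions and vector fields on the manifold\<close>

context manifold
begin

definition chart_bump :: "('a, 'n) chart \<Rightarrow> real ^ 'n \<Rightarrow> real \<Rightarrow> 'a \<Rightarrow> real" where
  "chart_bump c a r q = (if q \<in> fst c then bump a r (snd c q) else 0)"

lemma chart_bump_compact:
  assumes "c \<in> A" "cball a r \<subseteq> cdom c"
  shows "compact (chart_inv c ` cball a r)"
  using chart_inv_continuous[OF assms(1)] assms(2)
  by (intro compact_continuous_image) (auto intro: continuous_on_subset)

lemma chart_bump_outside:
  assumes "c \<in> A" "r > 0" "q \<notin> chart_inv c ` cball a r"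
  shows "chart_bump c a r q = 0"
proof (cases "q \<in> fst c")
  case True
  have "snd c q \<notin> cball a r"
    using assms True by (metis chart_inv_left image_eqI)
  then show ?thesis
    using True assms(2) bump_eq_0[of r "snd c q" a] by (simp add: chart_bump_def dist_commute)
qed (simp add: chart_bump_def)

text \<open>A compact set in a Hausdorff space is closed. Hence every point has a neighbourhood
  either inside the chart domain, where smoothness is given, or off \<open>K\<close>, where the
  function is 0.\<close>

lemma smooth_on_extend_zero:
  fixes f :: "'a \<Rightarrow> 'b::real_normed_vector"
  assumes c: "c \<in> A" "d \<in> A" and K: "compact K" "K \<subseteq> fst c" and z: "\<And>q. q \<notin> K \<Longrightarrow> f q = 0"
    and f: "smooth_on (overlap d c) (\<lambda>x. f (chart_inv d x))"
  shows "smooth_on (cdom d) (\<lambda>x. f (chart_inv d x))"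
proof (rule smooth_on_local[OF cdom_open[OF c(2)]])
  fix x assume x: "x \<in> cdom d"
  show "\<exists>T. open T \<and> x \<in> T \<and> T \<subseteq> cdom d \<and> smooth_on T (\<lambda>x. f (chart_inv d x))"
  proof (cases "chart_inv d x \<in> K")
    case True
    then have "x \<in> overlap d c"
      using K x c by (auto simp: overlap_eq)
    then show ?thesis
      using overlap_open[OF c(2,1)] f overlap_subset by blast
  next
    case False
    let ?T = "{x \<in> cdom d. chart_inv d x \<in> - K}"
    have T: "open ?T"
      using chart_preimage_open[OF c(2), of "- K"] K by (simp add: compact_imp_closed open_Compl)
    have "smooth_on ?T (\<lambda>x. f (chart_inv d x)) \<longleftrightarrow> smooth_on ?T (\<lambda>x. 0 :: 'b)"
      using z by (intro smooth_on_cong[OF T]) auto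
    then show ?thesis
      using T False x smooth_on_const[OF T] by (intro exI[of _ ?T]) auto
  qed
qed

lemma chart_inv_cball_subset: "c \<in> A \<Longrightarrow> cball a r \<subseteq> cdom c \<Longrightarrow> chart_inv c ` cball a r \<subseteq> fst c"
  by auto

lemma smooth_chart_bump_overlap:
  assumes "c \<in> A" "d \<in> A"
  shows "smooth_on (overlap d c) (\<lambda>x. chart_bump c a r (chart_inv d x))"
proof -
  have "smooth_on (overlap d c) (\<lambda>x. bump a r (transition d c x))"
    using smooth_on_compose[OF overlap_open[OF assms(2,1)] open_UNIV _ smooth_on_bump[OF open_UNIV] transition_smooth[OF assms(2,1)], of a r]
    by simp
  then show ?thesis
    using assms by (subst smooth_on_cong[OF overlap_open]) (auto simp: overlap_def chart_bump_def)
qed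

lemma smooth_chart_bump:
  assumes "c \<in> A" "r > 0" "cball a r \<subseteq> cdom c"
  shows "smooth_fun A (chart_bump c a r)"
  unfolding smooth_fun_def o_def
proof
  fix d assume d: "d \<in> A"
  show "smooth_on (cdom d) (\<lambda>x. chart_bump c a r (chart_inv d x))"
    using smooth_on_extend_zero[OF assms(1) d chart_bump_compact[OF assms(1,3)] chart_inv_cball_subset[OF assms(1,3)]
        chart_bump_outside[OF assms(1,2)] smooth_chart_bump_overlap[OF assms(1) d]] .
qed

text \<open>A field with constant coordinates in one chart, cut off by a bump. It shows that the
  choice in \<open>vf_ext\<close> is not empty.\<close>

lemma vector_field_extension:
  assumes v: "v \<in> tangent_space A p"
  shows "\<exists>X. smooth_vf A X \<and> X p = v"
proof -
  define c where "c = chart_at A p"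
  have cp: "c \<in> charts_at A p" by (simp add: c_def chart_at)
  then have c: "c \<in> A" "p \<in> fst c" by (auto simp: charts_at_iff)
  obtain r where r: "r > 0" "cball (snd c p) r \<subseteq> cdom c"
    using cdom_open[OF c(1)] c open_contains_cball by blast
  let ?b = "chart_bump c (snd c p) r"
  \<comment> \<open>The bump need not be 1 at its centre; dividing by its value there gives exactly
    \<open>v\<close> at \<open>p\<close>.\<close>
  let ?m = "bump (snd c p) r (snd c p)"
  have b0: "?m > 0" using r by (simp add: bump_pos)
  define X where "X q = tscale (?b q) (if q \<in> fst c then tvec_of c q ((1 / ?m) *\<^sub>R v c) else 0)" for q
  have "X p = v"
  proof (rule tangent_eqI[OF _ v cp])
    show "X p \<in> tangent_space A p"
      using c cp by (simp add: X_def tangent_scale tvec_of_tangent)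
    show "X p c = v c"
      using c cp b0 by (simp add: X_def chart_bump_def)
  qed
  moreover have "smooth_vf A X"
    unfolding smooth_vf_def
  proof (intro conjI allI ballI)
    fix q show "X q \<in> tangent_space A q"
      using c by (auto simp: X_def charts_at_iff tangent_zero intro!: tangent_scale tvec_of_tangent)
  next
    fix d assume d: "d \<in> A"
    have "smooth_on (overlap d c) (\<lambda>x. chart_bump c (snd c p) r (chart_inv d x) *\<^sub>R (jac c d (transition d c x) *v ((1 / ?m) *\<^sub>R v c)))"
    proof (intro smooth_on_scaleR smooth_on_matrix_vector_mult smooth_on_const smooth_chart_bump_overlap overlap_open c d)
      show "smooth_on (overlap d c) (\<lambda>x. jac c d (transition d c x))"
        using smooth_on_compose[OF overlap_open[OF d c(1)] overlap_open[OF c(1) d] _ jac_smooth[OF c(1) d] transition_smooth[OF d c(1)]]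
          transition_in[OF d] by blast
    qed
    moreover have "chart_bump c (snd c p) r (chart_inv d x) *\<^sub>R (jac c d (transition d c x) *v ((1 / ?m) *\<^sub>R v c)) = X (chart_inv d x) d"
      if "x \<in> overlap d c" for x
      using that c d by (auto simp: X_def overlap_def tvec_of_def charts_at_iff)
    ultimately have "smooth_on (overlap d c) (\<lambda>x. X (chart_inv d x) d)"
      by (rule smooth_on_cong[OF overlap_open[OF d c(1)], THEN iffD1, rotated])
    moreover have "X q d = 0" if "q \<notin> chart_inv c ` cball (snd c p) r" for q
      using chart_bump_outside[OF c(1) r(1) that] by (simp add: X_def)
    ultimately show "smooth_on (cdom d) (vf_rep d X)"
      unfolding vf_rep_def
      by (intro smooth_on_extend_zero[where f = "\<lambda>q. X q d", OF c(1) d chart_bump_compact[OF c(1) r(2)] chart_inv_cball_subset[OF c(1) r(2)]])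
  qed
  ultimately show ?thesis by blast
qed

lemma vf_ext:
  assumes "v \<in> tangent_space A p"
  shows "smooth_vf A (vf_ext A p v)" "vf_ext A p v p = v"
  using someI_ex[OF vector_field_extension[OF assms]] by (auto simp: vf_ext_def)

end

section \<open>The Levi-Civita connection\<close>

context local_metric
begin

definition cov where "cov v Y x = (\<Sum>i\<in>UNIV. v $ i *\<^sub>R nab i Y x)"

lemma cov_eq:
  "cov v Y x = (\<Sum>i\<in>UNIV. v $ i *\<^sub>R pd i Y x) + (\<Sum>i\<in>UNIV. v $ i *\<^sub>R (Gam i x *v Y x))"
  by (simp add: cov_def nab_def scaleR_add_right sum.distrib)

text \<open>Torsion-freeness: the connection is symmetric in the direction and the argument apart
  from the derivative term.\<close>

lemma Gam_swap:
  assumes x: "x \<in> U"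
  shows "(\<Sum>i\<in>UNIV. v $ i *\<^sub>R (Gam i x *v w)) = (\<Sum>i\<in>UNIV. w $ i *\<^sub>R (Gam i x *v v))"
proof -
  have "(\<Sum>i\<in>UNIV. v $ i *\<^sub>R (Gam i x *v w)) $ k = (\<Sum>i\<in>UNIV. w $ i *\<^sub>R (Gam i x *v v)) $ k" for k
  proof -
    have "(\<Sum>i\<in>UNIV. v $ i *\<^sub>R (Gam i x *v w)) $ k = (\<Sum>i\<in>UNIV. \<Sum>j\<in>UNIV. v $ i * Gam i x $ k $ j * w $ j)"
      by (simp add: matrix_vector_mult_def sum_distrib_left mult.assoc)
    also have "\<dots> = (\<Sum>j\<in>UNIV. \<Sum>i\<in>UNIV. w $ j * Gam j x $ k $ i * v $ i)"
      by (subst sum.swap) (simp add: Gam_sym[OF x, of _ k] mult.commute mult.left_commute)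
    also have "\<dots> = (\<Sum>i\<in>UNIV. w $ i *\<^sub>R (Gam i x *v v)) $ k"
      by (simp add: matrix_vector_mult_def sum_distrib_left mult.assoc)
    finally show ?thesis .
  qed
  then show ?thesis by (simp add: vec_eq_iff)
qed

lemma cov_torsion:
  assumes "x \<in> U"
  shows "cov (X x) Y x - cov (Y x) X x =
    (\<Sum>i\<in>UNIV. X x $ i *\<^sub>R pd i Y x) - (\<Sum>i\<in>UNIV. Y x $ i *\<^sub>R pd i X x)"
  unfolding cov_eq using Gam_swap[OF assms, of "X x" "Y x"] by simp

lemma cov_metric:
  assumes x: "x \<in> U" and Y: "Y differentiable (at x)" and Z: "Z differentiable (at x)"
  shows "(\<Sum>i\<in>UNIV. v $ i * pd i (\<lambda>x. Y x \<bullet> (G x *v Z x)) x) = cov v Y x \<bullet> (G x *v Z x) + Y x \<bullet> (G x *v cov v Z x)"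
proof -
  have "cov v Y x \<bullet> (G x *v Z x) = (\<Sum>i\<in>UNIV. v $ i * (nab i Y x \<bullet> (G x *v Z x)))"
    by (simp add: cov_def inner_sum_left)
  moreover have "Y x \<bullet> (G x *v cov v Z x) = (\<Sum>i\<in>UNIV. v $ i * (Y x \<bullet> (G x *v nab i Z x)))"
    by (simp add: cov_def inner_sum_right matrix_vector_sum_right matrix_vector_simps)
  ultimately show ?thesis
    unfolding nab_metric[OF assms] by (simp add: sum.distrib distrib_left)
qed

end

section \<open>Existence and uniqueness of the connection on a Riemannian manifold\<close>

lemma matrix_eq_if_inner_eq:
  fixes M N :: "real ^ 'n::finite ^ 'm::finite"
  assumes "\<And>u v. u \<bullet> (M *v v) = u \<bullet> (N *v v)"
  shows "M = N"
  unfolding matrix_eq using assms by (metis vector_eq_ldot)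

lemma inner_matrix_sum:
  fixes M :: "real ^ 'n::finite ^ 'm::finite"
  shows "u \<bullet> (M *v v) = (\<Sum>i\<in>UNIV. \<Sum>j\<in>UNIV. u $ i * v $ j * M $ i $ j)"
  by (simp add: inner_vec_def matrix_vector_mult_def sum_distrib_left mult.commute mult.left_commute)

locale riemannian_manifold = manifold A
  for A :: "('a::{t2_space, second_countable_topology}, 'n::finite) chart set" +
  fixes g :: "('a, 'n) metric"
  assumes metric: "riemannian_metric A g"
begin

lemma g_add_left:
  "u \<in> tangent_space A p \<Longrightarrow> v \<in> tangent_space A p \<Longrightarrow> w \<in> tangent_space A p \<Longrightarrow> g p (u + v) w = g p u w + g p v w"
  and g_scale_left: "u \<in> tangent_space A p \<Longrightarrow> v \<in> tangent_space A p \<Longrightarrow> g p (tscale r u) v = r * g p u v"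
  and g_sym: "u \<in> tangent_space A p \<Longrightarrow> v \<in> tangent_space A p \<Longrightarrow> g p u v = g p v u"
  and g_pos: "v \<in> tangent_space A p \<Longrightarrow> v \<noteq> 0 \<Longrightarrow> g p v v > 0"
  using metric unfolding riemannian_metric_def by blast+

lemma g_expand_left:
  assumes "c \<in> charts_at A p" "u \<in> tangent_space A p" "v \<in> tangent_space A p"
  shows "g p u v = (\<Sum>i\<in>UNIV. u c $ i * g p (coord_vec A c p i) v)"
  using tangent_linear_expand[of p "\<lambda>u. g p u v" c u] assms
  by (simp add: g_add_left g_scale_left)

definition gm :: "('a, 'n) chart \<Rightarrow> real ^ 'n \<Rightarrow> real ^ 'n ^ 'n" where
  "gm c x = gram A g c (chart_inv c x)"

lemma gram_gm: "c \<in> charts_at A p \<Longrightarrow> gram A g c p = gm c (snd c p)"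
  by (simp add: gm_def charts_at_iff)

lemma metric_chart:
  assumes c: "c \<in> charts_at A p" and u: "u \<in> tangent_space A p" and v: "v \<in> tangent_space A p"
  shows "g p u v = u c \<bullet> (gm c (snd c p) *v v c)"
proof -
  have "g p (coord_vec A c p i) v = (\<Sum>j\<in>UNIV. v c $ j * gm c (snd c p) $ i $ j)" for i
    using g_sym[OF coord_vec_tangent[OF c] v] g_expand_left[OF c v coord_vec_tangent[OF c]]
      g_sym[OF coord_vec_tangent[OF c] coord_vec_tangent[OF c]]
    by (simp add: gram_gm[OF c, symmetric] gram_def)
  then show ?thesis
    unfolding g_expand_left[OF c u v] by (simp add: inner_matrix_sum sum_distrib_left mult.assoc)
qed

text \<open>Opens every chart to the matrix calculus of \<open>local_metric\<close> by
  interpretation.\<close>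

lemma local_metric_chart:
  assumes c: "c \<in> A"
  shows "local_metric (cdom c) (gm c)"
proof
  show "open (cdom c)" by (rule cdom_open[OF c])
  have "smooth_on (cdom c) (\<lambda>x. \<chi> i j. gram A g c (chart_inv c x) $ i $ j)"
    using metric c unfolding riemannian_metric_def by (intro smooth_on_vec_lambda cdom_open) blast+
  then show "smooth_on (cdom c) (gm c)"
    by (simp add: gm_def[abs_def])
next
  fix x assume x: "x \<in> cdom c"
  then obtain p where p: "x = snd c p" "c \<in> charts_at A p"
    using c by (auto simp: charts_at_iff)
  show "transpose (gm c x) = gm c x"
    using g_sym[OF coord_vec_tangent[OF p(2)] coord_vec_tangent[OF p(2)]]
    by (simp add: p(1) gram_gm[OF p(2), symmetric] gram_def transpose_def vec_eq_iff)
  fix v :: "real ^ 'n" assume v: "v \<noteq> 0"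
  have "tvec_of c p v \<noteq> 0"
    using v tvec_of_self[OF p(2), of v] by (metis zero_fun_apply)
  then show "v \<bullet> (gm c x *v v) > 0"
    using g_pos[OF tvec_of_tangent[OF p(2)], of v] metric_chart[OF p(2) tvec_of_tangent[OF p(2)] tvec_of_tangent[OF p(2)], of v v] p
    by simp
qed

text \<open>The test field is an extension of \<open>u - v\<close>.\<close>

lemma g_nondegenerate:
  assumes "u \<in> tangent_space A p" "v \<in> tangent_space A p"
    and "\<And>Z. smooth_vf A Z \<Longrightarrow> g p u (Z p) = g p v (Z p)"
  shows "u = v"
proof (rule ccontr)
  assume ne: "u \<noteq> v"
  have w: "u - v \<in> tangent_space A p" using assms by (simp add: tangent_diff)
  have "g p u (u - v) = g p v (u - v)"
    using assms(3)[OF vf_ext(1)[OF w]] by (simp add: vf_ext(2)[OF w])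
  moreover have "g p u (u - v) = g p (u - v) (u - v) + g p v (u - v)"
    using g_add_left[OF w assms(2) w] by simp
  ultimately show False
    using g_pos[OF w] ne by simp
qed

abbreviation nabla :: "('a, 'n) chart \<Rightarrow> 'n \<Rightarrow> (real ^ 'n \<Rightarrow> real ^ 'n) \<Rightarrow> real ^ 'n \<Rightarrow> real ^ 'n" where
  "nabla c \<equiv> local_metric.nab (gm c)"

text \<open>Built chart by chart. That the entries in different charts form one tangent vector is
  not checked by transforming Christoffel symbols but follows from uniqueness, see
  \<open>lc_chart_connection\<close>.\<close>

definition lc :: "('a, 'n) vfield \<Rightarrow> ('a, 'n) vfield \<Rightarrow> ('a, 'n) vfield" where
  "lc X Y = (\<lambda>p c. if c \<in> charts_at A p
     then local_metric.cov (gm c) (X p c) (vf_rep c Y) (snd c p) else 0)"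

lemma metric_pd:
  assumes c: "c \<in> charts_at A p" and Y: "smooth_vf A Y" and Z: "smooth_vf A Z" and v: "v \<in> tangent_space A p"
  shows "differential A (\<lambda>p. g p (Y p) (Z p)) p v =
    (\<Sum>i\<in>UNIV. v c $ i * pd i (\<lambda>x. vf_rep c Y x \<bullet> (gm c x *v vf_rep c Z x)) (snd c p))"
proof -
  have cA: "c \<in> A" "p \<in> fst c" using c by (auto simp: charts_at_iff)
  interpret L: local_metric "cdom c" "gm c" by (rule local_metric_chart[OF cA(1)])
  let ?F = "\<lambda>x. vf_rep c Y x \<bullet> (gm c x *v vf_rep c Z x)"
  have e: "((\<lambda>p. g p (Y p) (Z p)) \<circ> chart_inv c) x = ?F x" if x: "x \<in> cdom c" for x
  proof -
    have "c \<in> charts_at A (chart_inv c x)" using cA x by (simp add: charts_at_iff)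
    from metric_chart[OF this smooth_vf_tangent[OF Y] smooth_vf_tangent[OF Z]] show ?thesis
      using cA x by (simp add: vf_rep_def)
  qed
  have px: "snd c p \<in> cdom c" using cA by blast
  have "smooth_on (cdom c) ?F"
    by (intro smooth_on_bilinear[OF bounded_bilinear_inner] smooth_intros L.openU L.smooth_G
      smooth_vf_rep Y Z cA)
  then have d: "?F differentiable (at (snd c p))"
    by (rule L.differentiable[OF _ px])
  then obtain D where D: "(?F has_derivative D) (at (snd c p))" by (auto simp: differentiable_def)
  have "(((\<lambda>p. g p (Y p) (Z p)) \<circ> chart_inv c) has_derivative D) (at (snd c p))"
    using e by (intro has_derivative_transform_within_open[OF D L.openU px]) simp
  then have "((\<lambda>p. g p (Y p) (Z p)) \<circ> chart_inv c) differentiable (at (snd c p))"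
    by (auto simp: differentiable_def)
  from differential_chart[OF c v this] show ?thesis
    using pd_cong[OF L.openU px e] by (simp only:)
qed

text \<open>The Koszul formula at a single point: three instances of metric compatibility and three
  of vanishing torsion, combined linearly. \<open>D\<close> yields only the value at
  \<open>p\<close>, so that the connection of one chart qualifies.\<close>

lemma koszul:
  fixes D :: "('a, 'n) vfield \<Rightarrow> ('a, 'n) vfield \<Rightarrow> ('a, 'n) tvec"
  assumes tan: "\<And>X Y. smooth_vf A X \<Longrightarrow> smooth_vf A Y \<Longrightarrow> D X Y \<in> tangent_space A p"
    and tor: "\<And>X Y. smooth_vf A X \<Longrightarrow> smooth_vf A Y \<Longrightarrow> D X Y - D Y X = lie_bracket A X Y p"
    and met: "\<And>X Y Z. smooth_vf A X \<Longrightarrow> smooth_vf A Y \<Longrightarrow> smooth_vf A Z \<Longrightarrow>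
      vf_apply A X (\<lambda>p. g p (Y p) (Z p)) p = g p (D X Y) (Z p) + g p (Y p) (D X Z)"
    and X: "smooth_vf A X" and Y: "smooth_vf A Y" and Z: "smooth_vf A Z"
  shows "2 * g p (D X Y) (Z p) =
      vf_apply A X (\<lambda>p. g p (Y p) (Z p)) p + vf_apply A Y (\<lambda>p. g p (X p) (Z p)) p
    - vf_apply A Z (\<lambda>p. g p (X p) (Y p)) p + g p (lie_bracket A X Y p) (Z p)
    - g p (lie_bracket A X Z p) (Y p) - g p (lie_bracket A Y Z p) (X p)"
proof -
  have b: "g p (D X Y) (Z p) = g p (lie_bracket A X Y p) (Z p) + g p (D Y X) (Z p)"
    if X: "smooth_vf A X" and Y: "smooth_vf A Y" and Z: "smooth_vf A Z" for X Y Z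
    using g_add_left[OF lie_bracket_tangent[OF X Y] tan[OF Y X] smooth_vf_tangent[OF Z]] tor[OF X Y]
    by (metis diff_add_cancel)
  have s: "g p (Y p) (D X Z) = g p (D X Z) (Y p)"
    if X: "smooth_vf A X" and Y: "smooth_vf A Y" and Z: "smooth_vf A Z" for X Y Z
    by (intro g_sym tan smooth_vf_tangent that)
  show ?thesis
    using met[OF X Y Z] met[OF Y X Z] met[OF Z X Y] b[OF X Y Z] b[OF X Z Y] b[OF Y Z X]
      s[OF X Y Z] s[OF Y X Z] s[OF Z X Y]
    by linarith
qed

lemma cov_torsion_chart:
  assumes X: "smooth_vf A X" and Y: "smooth_vf A Y" and c: "c \<in> charts_at A p"
  shows "local_metric.cov (gm c) (X p c) (vf_rep c Y) (snd c p) - local_metric.cov (gm c) (Y p c) (vf_rep c X) (snd c p)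
     = lie_bracket A X Y p c"
proof -
  have cA: "c \<in> A" "snd c p \<in> cdom c" using c by (auto simp: charts_at_iff)
  interpret L: local_metric "cdom c" "gm c" by (rule local_metric_chart[OF cA(1)])
  show ?thesis
    using L.cov_torsion[OF cA(2), of "vf_rep c X" "vf_rep c Y"] lie_bracket_chart[OF X Y c] c by simp
qed

lemma cov_metric_chart:
  assumes X: "smooth_vf A X" and Y: "smooth_vf A Y" and Z: "smooth_vf A Z" and c: "c \<in> charts_at A p"
  shows "vf_apply A X (\<lambda>p. g p (Y p) (Z p)) p =
    local_metric.cov (gm c) (X p c) (vf_rep c Y) (snd c p) \<bullet> (gm c (snd c p) *v Z p c)
    + Y p c \<bullet> (gm c (snd c p) *v local_metric.cov (gm c) (X p c) (vf_rep c Z) (snd c p))"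
proof -
  have cA: "c \<in> A" "snd c p \<in> cdom c" using c by (auto simp: charts_at_iff)
  interpret L: local_metric "cdom c" "gm c" by (rule local_metric_chart[OF cA(1)])
  show ?thesis
    unfolding vf_apply_def metric_pd[OF c Y Z smooth_vf_tangent[OF X]]
    using L.cov_metric[OF cA(2) smooth_vf_rep_differentiable[OF Y c] smooth_vf_rep_differentiable[OF Z c]] c by simp
qed

definition chart_connection where
  "chart_connection c p X Y = tvec_of c p (local_metric.cov (gm c) (X p c) (vf_rep c Y) (snd c p))"

lemma chart_connection_tangent: "c \<in> charts_at A p \<Longrightarrow> chart_connection c p X Y \<in> tangent_space A p"
  by (simp add: chart_connection_def tvec_of_tangent)

lemma chart_connection_torsion:
  assumes c: "c \<in> charts_at A p" and XY: "smooth_vf A X" "smooth_vf A Y"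
  shows "chart_connection c p X Y - chart_connection c p Y X = lie_bracket A X Y p"
  using cov_torsion_chart[OF XY c]
  by (intro tangent_eqI[OF tangent_diff lie_bracket_tangent[OF XY] c] chart_connection_tangent c)
    (simp add: chart_connection_def c)

lemma chart_connection_metric:
  assumes c: "c \<in> charts_at A p" and XYZ: "smooth_vf A X" "smooth_vf A Y" "smooth_vf A Z"
  shows "vf_apply A X (\<lambda>p. g p (Y p) (Z p)) p =
    g p (chart_connection c p X Y) (Z p) + g p (Y p) (chart_connection c p X Z)"
  using cov_metric_chart[OF XYZ c] XYZ chart_connection_tangent[OF c]
  by (simp add: metric_chart[OF c] smooth_vf_tangent) (simp add: chart_connection_def c)

text \<open>Both sides satisfy the Koszul formula, whose right-hand side does not mention the
  connection, and \<open>g\<close> is nondegenerate.\<close>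

lemma connection_unique:
  fixes D :: "('a, 'n) vfield \<Rightarrow> ('a, 'n) vfield \<Rightarrow> ('a, 'n) tvec"
  assumes tan: "\<And>X Y. smooth_vf A X \<Longrightarrow> smooth_vf A Y \<Longrightarrow> D X Y \<in> tangent_space A p"
    and tor: "\<And>X Y. smooth_vf A X \<Longrightarrow> smooth_vf A Y \<Longrightarrow> D X Y - D Y X = lie_bracket A X Y p"
    and met: "\<And>X Y Z. smooth_vf A X \<Longrightarrow> smooth_vf A Y \<Longrightarrow> smooth_vf A Z \<Longrightarrow>
      vf_apply A X (\<lambda>p. g p (Y p) (Z p)) p = g p (D X Y) (Z p) + g p (Y p) (D X Z)"
    and X: "smooth_vf A X" and Y: "smooth_vf A Y" and c: "c \<in> charts_at A p"
  shows "D X Y = chart_connection c p X Y"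
proof (rule g_nondegenerate[OF tan[OF X Y] chart_connection_tangent[OF c]])
  fix Z assume Z: "smooth_vf A Z"
  show "g p (D X Y) (Z p) = g p (chart_connection c p X Y) (Z p)"
    using koszul[where D = D, OF tan tor met X Y Z]
      koszul[where D = "chart_connection c p", OF chart_connection_tangent[OF c]
        chart_connection_torsion[OF c] chart_connection_metric[OF c] X Y Z]
    by linarith
qed

text \<open>The connections computed in two charts around \<open>p\<close> both have the Levi-Civita
  properties at \<open>p\<close>, hence agree there.\<close>

lemma lc_chart_connection:
  assumes X: "smooth_vf A X" and Y: "smooth_vf A Y" and c: "c \<in> charts_at A p"
  shows "lc X Y p = chart_connection c p X Y"
proof
  fix d
  show "lc X Y p d = chart_connection c p X Y d"
  proof (cases "d \<in> charts_at A p")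
    case True
    have "chart_connection c p X Y = chart_connection d p X Y"
      by (rule connection_unique[where D = "chart_connection c p", OF chart_connection_tangent[OF c]
        chart_connection_torsion[OF c] chart_connection_metric[OF c] X Y True])
    then show ?thesis
      using True by (simp add: lc_def) (simp add: chart_connection_def)
  qed (simp add: lc_def chart_connection_def tvec_of_def)
qed

lemma lc_tangent: "smooth_vf A X \<Longrightarrow> smooth_vf A Y \<Longrightarrow> lc X Y p \<in> tangent_space A p"
  using lc_chart_connection[OF _ _ chart_at] chart_connection_tangent[OF chart_at] by simp

lemma lc_chart: "c \<in> charts_at A p \<Longrightarrow> lc X Y p c = local_metric.cov (gm c) (X p c) (vf_rep c Y) (snd c p)"
  by (simp add: lc_def)

lemma vf_rep_lc:
  "c \<in> A \<Longrightarrow> x \<in> cdom c \<Longrightarrow> vf_rep c (lc X Y) x = (\<Sum>i\<in>UNIV. vf_rep c X x $ i *\<^sub>R nabla c i (vf_rep c Y) x)"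
  using local_metric.cov_def[OF local_metric_chart[of c]] by (simp add: vf_rep_def[of c "lc X Y"] lc_def charts_at_iff) (simp add: vf_rep_def)

lemma lc_smooth:
  assumes X: "smooth_vf A X" and Y: "smooth_vf A Y"
  shows "smooth_vf A (lc X Y)"
  unfolding smooth_vf_def
proof (intro conjI allI ballI)
  show "lc X Y p \<in> tangent_space A p" for p by (rule lc_tangent[OF assms])
  fix c assume c: "c \<in> A"
  interpret L: local_metric "cdom c" "gm c" by (rule local_metric_chart[OF c])
  have "smooth_on (cdom c) (\<lambda>x. \<Sum>i\<in>UNIV. vf_rep c X x $ i *\<^sub>R nabla c i (vf_rep c Y) x)"
    by (intro smooth_intros L.openU L.smooth_nab smooth_vf_rep X Y c)
  then show "smooth_on (cdom c) (vf_rep c (lc X Y))"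
    by (rule smooth_on_cong[OF L.openU, THEN iffD1, rotated]) (simp add: vf_rep_lc[OF c])
qed

lemma lc_levi_civita: "is_levi_civita A g lc"
  unfolding is_levi_civita_def is_connection_def
proof (intro conjI allI impI)
  fix X Y Z :: "('a, 'n) vfield" and f :: "'a \<Rightarrow> real"
  assume X: "smooth_vf A X" and Y: "smooth_vf A Y"
  show "lc X Y - lc Y X = lie_bracket A X Y"
  proof (intro ext)
    fix p c show "(lc X Y - lc Y X) p c = lie_bracket A X Y p c"
      using cov_torsion_chart[OF X Y, of c p] by (simp add: lc_def lie_bracket_def)
  qed
  assume Z: "smooth_vf A Z"
  show "vf_apply A X (\<lambda>p. g p (Y p) (Z p)) = (\<lambda>p. g p (lc X Y p) (Z p) + g p (Y p) (lc X Z p))"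
  proof
    fix p
    show "vf_apply A X (\<lambda>p. g p (Y p) (Z p)) p = g p (lc X Y p) (Z p) + g p (Y p) (lc X Z p)"
      using cov_metric_chart[OF X Y Z chart_at, of p]
        metric_chart[OF chart_at lc_tangent[OF X Y] smooth_vf_tangent[OF Z], of p]
        metric_chart[OF chart_at smooth_vf_tangent[OF Y] lc_tangent[OF X Z], of p]
      by (simp add: lc_chart[OF chart_at])
  qed
  assume f: "smooth_fun A f"
  show "smooth_vf A (lc X Y)" by (rule lc_smooth[OF X Y])
  have cov_def: "local_metric.cov (gm c) v Y x = (\<Sum>i\<in>UNIV. v $ i *\<^sub>R nabla c i Y x)" if "c \<in> charts_at A p" for c p v Y x
    using local_metric.cov_def[OF local_metric_chart[of c]] that by (simp add: charts_at_iff)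
  show "lc (X + Y) Z = lc X Z + lc Y Z"
    by (intro ext) (simp add: lc_def cov_def scaleR_add_left sum.distrib)
  show "lc (vf_scale f X) Y = vf_scale f (lc X Y)"
    by (intro ext) (simp add: lc_def cov_def vf_scale_def scaleR_sum_right)
  show "lc X (Y + Z) = lc X Y + lc X Z"
  proof (intro ext)
    fix p c
    show "lc X (Y + Z) p c = (lc X Y + lc X Z) p c"
    proof (cases "c \<in> charts_at A p")
      case c: True
      then have cA: "c \<in> A" by (simp add: charts_at_iff)
      have "vf_rep c (Y + Z) = (\<lambda>x. vf_rep c Y x + vf_rep c Z x)"
        by (simp add: vf_rep_def fun_eq_iff)
      then have "nabla c i (vf_rep c (Y + Z)) (snd c p) = nabla c i (vf_rep c Y) (snd c p) + nabla c i (vf_rep c Z) (snd c p)" for i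
        using pd_add[OF smooth_vf_rep_differentiable[OF Y c] smooth_vf_rep_differentiable[OF Z c], of i]
          local_metric.nab_def[OF local_metric_chart[OF cA]]
        by (simp add: matrix_vector_simps)
      then show ?thesis
        using c by (simp add: lc_def cov_def[OF c] scaleR_add_right sum.distrib)
    qed (simp add: lc_def)
  qed
  show "lc X (vf_scale f Y) = vf_scale (vf_apply A X f) Y + vf_scale f (lc X Y)"
  proof (intro ext)
    fix p c
    show "lc X (vf_scale f Y) p c = (vf_scale (vf_apply A X f) Y + vf_scale f (lc X Y)) p c"
    proof (cases "c \<in> charts_at A p")
      case c: True
      then have cA: "c \<in> A" "p \<in> fst c" by (simp_all add: charts_at_iff)
      have "vf_rep c (vf_scale f Y) = (\<lambda>x. (f \<circ> chart_inv c) x *\<^sub>R vf_rep c Y x)"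
        by (simp add: vf_rep_def vf_scale_def fun_eq_iff)
      then have "nabla c i (vf_rep c (vf_scale f Y)) (snd c p) =
          pd i (f \<circ> chart_inv c) (snd c p) *\<^sub>R Y p c + f p *\<^sub>R nabla c i (vf_rep c Y) (snd c p)" for i
        using pd_scaleR[OF smooth_fun_differentiable[OF f c] smooth_vf_rep_differentiable[OF Y c], of i]
          local_metric.nab_def[OF local_metric_chart[OF cA(1)]] c cA
        by (simp add: matrix_vector_simps scaleR_add_right)
      then show ?thesis
        using c differential_chart[OF c smooth_vf_tangent[OF X] smooth_fun_differentiable[OF f c]]
        by (simp add: lc_def cov_def[OF c] vf_scale_def vf_apply_def scaleR_add_right sum.distrib
          scaleR_sum_left scaleR_sum_right mult.commute)
    next
      case False
      then show ?thesis
        using tangent_outside[OF smooth_vf_tangent[OF Y] False] by (simp add: lc_def vf_scale_def)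
    qed
  qed
qed

lemma levi_civita_eq:
  assumes X: "smooth_vf A X" and Y: "smooth_vf A Y"
  shows "levi_civita A g X Y = lc X Y"
proof
  fix p
  have lcA: "is_levi_civita A g (levi_civita A g)"
    unfolding levi_civita_def by (rule someI[of "is_levi_civita A g", OF lc_levi_civita])
  \<comment> \<open>The clauses of \<open>is_connection\<close> stand behind a smooth function
    \<open>f\<close>; the constant 0 instantiates it.\<close>
  have sf: "smooth_fun A (\<lambda>p. 0)"
    by (auto simp: smooth_fun_def o_def intro!: smooth_intros cdom_open)
  have "levi_civita A g X Y p = chart_connection (chart_at A p) p X Y"
  proof (rule connection_unique[where D = "\<lambda>X Y. levi_civita A g X Y p", OF _ _ _ X Y chart_at])
    fix X Y Z assume X: "smooth_vf A X" and Y: "smooth_vf A Y"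
    have "smooth_vf A (levi_civita A g X Y)"
      using lcA X Y sf unfolding is_levi_civita_def is_connection_def by blast
    then show "levi_civita A g X Y p \<in> tangent_space A p" by (rule smooth_vf_tangent)
    have "levi_civita A g X Y - levi_civita A g Y X = lie_bracket A X Y"
      using lcA X Y unfolding is_levi_civita_def by blast
    then show "levi_civita A g X Y p - levi_civita A g Y X p = lie_bracket A X Y p"
      by (metis minus_apply)
    assume Z: "smooth_vf A Z"
    have "vf_apply A X (\<lambda>p. g p (Y p) (Z p)) =
          (\<lambda>p. g p (levi_civita A g X Y p) (Z p) + g p (Y p) (levi_civita A g X Z p))"
      using lcA X Y Z unfolding is_levi_civita_def by blast
    then show "vf_apply A X (\<lambda>p. g p (Y p) (Z p)) p = g p (levi_civita A g X Y p) (Z p) + g p (Y p) (levi_civita A g X Z p)"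
      by simp
  qed
  then show "levi_civita A g X Y p = lc X Y p"
    using lc_chart_connection[OF X Y chart_at] by simp
qed

end

section \<open>Curvature in charts\<close>

context local_metric
begin

lemma cov_diff_left: "cov (v - w) Y x = cov v Y x - cov w Y x"
  by (simp add: cov_def scaleR_diff_left sum_subtractf)

text \<open>Leibniz rule for the coefficients of \<open>Y\<close>: one part differentiates them, the
  other is a pure second derivative of \<open>Z\<close>.\<close>

lemma cov_cov:
  assumes x: "x \<in> U" and Y: "smooth_on U Y" and Z: "smooth_on U Z"
  shows "cov v (\<lambda>x. cov (Y x) Z x) x = cov (\<Sum>i\<in>UNIV. v $ i *\<^sub>R pd i Y x) Z x
    + (\<Sum>i\<in>UNIV. \<Sum>j\<in>UNIV. (v $ i * Y x $ j) *\<^sub>R nab i (nab j Z) x)"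
proof -
  have N: "nab i (\<lambda>x. cov (Y x) Z x) x = cov (pd i Y x) Z x + (\<Sum>j\<in>UNIV. Y x $ j *\<^sub>R nab i (nab j Z) x)" for i
  proof -
    have dY: "(\<lambda>x. Y x $ j) differentiable (at x)" for j
      by (intro differentiable_vec_nth differentiable[OF Y x])
    have dN: "nab j Z differentiable (at x)" for j
      by (intro differentiable[OF _ x] smooth_nab Z)
    have dYN: "(\<lambda>x. Y x $ j *\<^sub>R nab j Z x) differentiable (at x)" for j
      by (intro differentiable[OF _ x] smooth_intros openU smooth_nab Z Y)
    have "pd i (\<lambda>x. cov (Y x) Z x) x = (\<Sum>j\<in>UNIV. pd i (\<lambda>x. Y x $ j *\<^sub>R nab j Z x) x)"
      unfolding cov_def by (intro pd_sum dYN)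
    also have "\<dots> = (\<Sum>j\<in>UNIV. pd i Y x $ j *\<^sub>R nab j Z x + Y x $ j *\<^sub>R pd i (nab j Z) x)"
      by (simp add: pd_scaleR[OF dY dN] pd_vec_nth[OF differentiable[OF Y x]])
    finally show ?thesis
      by (simp add: nab_def[of i] cov_def scaleR_add_right sum.distrib
        matrix_vector_sum_right matrix_vector_simps)
  qed
  have "cov v (\<lambda>x. cov (Y x) Z x) x = (\<Sum>i\<in>UNIV. v $ i *\<^sub>R cov (pd i Y x) Z x)
    + (\<Sum>i\<in>UNIV. \<Sum>j\<in>UNIV. (v $ i * Y x $ j) *\<^sub>R nab i (nab j Z) x)"
    by (simp add: cov_def[of v] N scaleR_add_right sum.distrib scaleR_sum_right)
  also have "(\<Sum>i\<in>UNIV. v $ i *\<^sub>R cov (pd i Y x) Z x) = cov (\<Sum>i\<in>UNIV. v $ i *\<^sub>R pd i Y x) Z x"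
    unfolding cov_def by (simp add: scaleR_sum_right scaleR_sum_left) (rule sum.swap)
  finally show ?thesis .
qed

text \<open>The bracket term cancels the parts in which coefficients of \<open>X\<close> and
  \<open>Y\<close> are differentiated, leaving the commutator \<open>Riem\<close>. The minus sign is
  the curvature convention of the definitions.\<close>

lemma cov_curvature:
  assumes x: "x \<in> U" and X: "smooth_on U X" and Y: "smooth_on U Y" and Z: "smooth_on U Z"
  shows "cov ((\<Sum>i\<in>UNIV. X x $ i *\<^sub>R pd i Y x) - (\<Sum>i\<in>UNIV. Y x $ i *\<^sub>R pd i X x)) Z x
    - (cov (X x) (\<lambda>x. cov (Y x) Z x) x - cov (Y x) (\<lambda>x. cov (X x) Z x) x)
    = - (\<Sum>i\<in>UNIV. \<Sum>j\<in>UNIV. (X x $ i * Y x $ j) *\<^sub>R (Riem i j x *v Z x))"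
proof -
  have "(\<Sum>i\<in>UNIV. \<Sum>j\<in>UNIV. (Y x $ i * X x $ j) *\<^sub>R nab i (nab j Z) x) =
      (\<Sum>i\<in>UNIV. \<Sum>j\<in>UNIV. (X x $ i * Y x $ j) *\<^sub>R nab j (nab i Z) x)"
    by (subst sum.swap) (simp add: mult.commute)
  moreover have "(\<Sum>i\<in>UNIV. \<Sum>j\<in>UNIV. (X x $ i * Y x $ j) *\<^sub>R (Riem i j x *v Z x)) =
      (\<Sum>i\<in>UNIV. \<Sum>j\<in>UNIV. (X x $ i * Y x $ j) *\<^sub>R nab i (nab j Z) x)
    - (\<Sum>i\<in>UNIV. \<Sum>j\<in>UNIV. (X x $ i * Y x $ j) *\<^sub>R nab j (nab i Z) x)"
    by (simp add: nab_commutator[OF x Z, symmetric] scaleR_diff_right sum_subtractf)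
  ultimately show ?thesis
    unfolding cov_cov[OF x Y Z] cov_cov[OF x X Z] cov_diff_left by simp
qed

lemma Riem_antisym: "Riem i j x = - Riem j i x"
  by (simp add: Riem_def)

end

section \<open>Traces and curvature in coordinates\<close>

context manifold
begin

lemma smooth_vf_diff: "smooth_vf A X \<Longrightarrow> smooth_vf A Y \<Longrightarrow> smooth_vf A (X - Y)"
  unfolding smooth_vf_def
proof (intro conjI allI ballI)
  assume X: "(\<forall>p. X p \<in> tangent_space A p) \<and> (\<forall>c\<in>A. smooth_on (cdom c) (vf_rep c X))"
    and Y: "(\<forall>p. Y p \<in> tangent_space A p) \<and> (\<forall>c\<in>A. smooth_on (cdom c) (vf_rep c Y))"
  show "(X - Y) p \<in> tangent_space A p" for p
    using X Y tangent_diff by simp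
  fix c assume c: "c \<in> A"
  have "smooth_on (cdom c) (\<lambda>x. vf_rep c X x - vf_rep c Y x)"
    using X Y c by (intro smooth_intros cdom_open) auto
  then show "smooth_on (cdom c) (vf_rep c (X - Y))"
    by (simp add: vf_rep_def)
qed

text \<open>A change of chart conjugates the matrix, and the trace is invariant under
  conjugation.\<close>

lemma trace_endo_chart:
  assumes c: "c \<in> charts_at A p"
    and tan: "\<And>v. v \<in> tangent_space A p \<Longrightarrow> F v \<in> tangent_space A p"
    and F: "\<And>v. v \<in> tangent_space A p \<Longrightarrow> F v c = M *v v c"
  shows "trace_endo A p F = trace M"
proof -
  define d where "d = chart_at A p"
  have d: "d \<in> charts_at A p" by (simp add: d_def chart_at)
  have cd: "c \<in> A" "d \<in> A" "p \<in> fst c" "p \<in> fst d"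
    using c d by (auto simp: charts_at_iff)
  let ?P = "jac c d (snd c p)" and ?Q = "jac d c (snd d p)"
  have "F (coord_vec A d p i) d = (?P ** M ** ?Q) *v axis i 1" for i
  proof -
    have e: "coord_vec A d p i \<in> tangent_space A p" by (rule coord_vec_tangent[OF d])
    have "coord_vec A d p i c = ?Q *v axis i 1"
      using c d by (simp add: coord_vec_eq tvec_of_def)
    then show ?thesis
      using tangent_transform[OF tan[OF e] c d] F[OF e] by (simp add: matrix_vector_mul_assoc matrix_mul_assoc)
  qed
  then have "trace_endo A p F = trace (?P ** M ** ?Q)"
    by (simp add: trace_endo_def Let_def d_def[symmetric] trace_def matrix_vector_mult_basis column_def)
  also have "\<dots> = trace (M ** (?Q ** ?P))"
    by (metis matrix_mul_assoc trace_mul_sym)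
  also have "?Q ** ?P = mat 1"
    using jac_inverse cd by blast
  finally show ?thesis by simp
qed

text \<open>The common shape of both Ricci tensors: tracing over the second argument of a
  curvature-like expression leaves a bilinear form in \<open>x\<close> and \<open>y\<close>, whose
  matrix is read off here.\<close>

lemma trace_endo_bilinear:
  assumes c: "c \<in> charts_at A p"
    and tan: "\<And>v. v \<in> tangent_space A p \<Longrightarrow> F v \<in> tangent_space A p"
    and F: "\<And>v. v \<in> tangent_space A p \<Longrightarrow> F v c = (\<Sum>a\<in>UNIV. \<Sum>b\<in>UNIV. (x $ a * v c $ b) *\<^sub>R (Q a b *v y))"
  shows "trace_endo A p F = x \<bullet> ((\<chi> a e. \<Sum>b\<in>UNIV. Q a b $ b $ e) *v y)"
proof -
  let ?M = "\<chi> k b. \<Sum>a\<in>UNIV. x $ a * (Q a b *v y) $ k"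
  have "trace_endo A p F = trace ?M"
  proof (rule trace_endo_chart[OF c tan])
    fix v assume v: "v \<in> tangent_space A p"
    have "F v c $ k = (?M *v v c) $ k" for k
    proof -
      have "F v c $ k = (\<Sum>a\<in>UNIV. \<Sum>b\<in>UNIV. x $ a * (Q a b *v y) $ k * v c $ b)"
        by (simp add: F[OF v] mult.commute mult.left_commute)
      also have "\<dots> = (?M *v v c) $ k"
        by (subst sum.swap) (simp add: matrix_vector_mult_def[of ?M] sum_distrib_right)
      finally show ?thesis .
    qed
    then show "F v c = ?M *v v c" by (simp add: vec_eq_iff)
  qed
  also have "\<dots> = (\<Sum>a\<in>UNIV. \<Sum>b\<in>UNIV. x $ a * (Q a b *v y) $ b)"
    by (simp add: trace_def) (rule sum.swap)
  also have "\<dots> = (\<Sum>a\<in>UNIV. \<Sum>b\<in>UNIV. \<Sum>e\<in>UNIV. x $ a * (y $ e * Q a b $ b $ e))"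
    by (simp add: matrix_vector_mult_def sum_distrib_left mult.commute mult.left_commute)
  also have "\<dots> = (\<Sum>a\<in>UNIV. \<Sum>e\<in>UNIV. \<Sum>b\<in>UNIV. x $ a * (y $ e * Q a b $ b $ e))"
    by (intro sum.cong refl sum.swap)
  also have "\<dots> = x \<bullet> ((\<chi> a e. \<Sum>b\<in>UNIV. Q a b $ b $ e) *v y)"
    by (simp add: inner_matrix_sum sum_distrib_left mult.assoc)
  finally show ?thesis .
qed

end

lemma sum_matrix_entries: "(\<Sum>i\<in>UNIV. \<Sum>j\<in>UNIV. X $ i $ j * Y $ i $ j) = trace (transpose X ** Y)"
  for X Y :: "real ^ 'n::finite ^ 'n"
  unfolding trace_def matrix_matrix_mult_def transpose_def by (subst sum.swap) simp

context riemannian_manifold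
begin

lemma gm_transform:
  assumes c: "c \<in> charts_at A p" and d: "d \<in> charts_at A p"
  shows "gm c (snd c p) = transpose (jac c d (snd c p)) ** gm d (snd d p) ** jac c d (snd c p)"
proof (rule matrix_eq_if_inner_eq)
  fix u v :: "real ^ 'n"
  let ?P = "jac c d (snd c p)"
  note t = tvec_of_tangent[OF c]
  have "u \<bullet> (gm c (snd c p) *v v) = (?P *v u) \<bullet> (gm d (snd d p) *v (?P *v v))"
  proof -
    have "tvec_of c p w d = ?P *v w" for w
      using d by (simp add: tvec_of_def)
    then show ?thesis
      using metric_chart[OF c t t, of u v] metric_chart[OF d t t, of u v] by (simp only: tvec_of_self[OF c])
  qed
  also have "\<dots> = u \<bullet> ((transpose ?P ** gm d (snd d p) ** ?P) *v v)"
    by (simp add: matrix_vector_mul_assoc[symmetric] inner_matrix_vector[of u "transpose ?P"] transpose_transpose del: transpose_matrix_vector)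
  finally show "u \<bullet> (gm c (snd c p) *v v) = u \<bullet> ((transpose ?P ** gm d (snd d p) ** ?P) *v v)" .
qed

abbreviation Hm :: "('a, 'n) chart \<Rightarrow> real ^ 'n \<Rightarrow> real ^ 'n ^ 'n" where
  "Hm c \<equiv> local_metric.H (gm c)"

lemma Hm_transform:
  assumes c: "c \<in> charts_at A p" and d: "d \<in> charts_at A p"
  shows "Hm d (snd d p) = jac c d (snd c p) ** Hm c (snd c p) ** transpose (jac c d (snd c p))"
proof -
  have cd: "c \<in> A" "d \<in> A" "p \<in> fst c" "p \<in> fst d" "snd c p \<in> cdom c" "snd d p \<in> cdom d"
    using c d by (auto simp: charts_at_iff)
  interpret C: local_metric "cdom c" "gm c" by (rule local_metric_chart[OF cd(1)])
  interpret D: local_metric "cdom d" "gm d" by (rule local_metric_chart[OF cd(2)])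
  let ?P = "jac c d (snd c p)" and ?Q = "jac d c (snd d p)"
  have QP: "?Q ** ?P = mat 1" and PQ: "?P ** ?Q = mat 1"
    using jac_inverse cd by blast+
  have "gm d (snd d p) ** (?P ** C.H (snd c p) ** transpose ?P)
      = transpose ?Q ** (gm c (snd c p) ** (?Q ** ?P) ** C.H (snd c p)) ** transpose ?P"
    unfolding gm_transform[OF d c] by (simp add: matrix_mul_assoc)
  also have "\<dots> = transpose (?P ** ?Q)"
    using C.G_H[OF cd(5)] by (simp add: QP matrix_transpose_mul)
  finally have "gm d (snd d p) ** (?P ** C.H (snd c p) ** transpose ?P) = mat 1"
    by (simp add: PQ)
  then have "D.H (snd d p) ** (gm d (snd d p) ** (?P ** C.H (snd c p) ** transpose ?P)) = D.H (snd d p)"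
    by simp
  then show ?thesis
    using D.H_G[OF cd(6)] by (simp add: matrix_mul_assoc)
qed

text \<open>The Jacobians in the laws for H and for the matrix of \<open>B\<close> cancel under the
  trace. It is used for the scalar curvatures, for the gradient, and for W being a vector.\<close>

lemma trace_metric_chart:
  assumes c: "c \<in> charts_at A p"
    and B: "\<And>x y. x \<in> tangent_space A p \<Longrightarrow> y \<in> tangent_space A p \<Longrightarrow> B x y = x c \<bullet> (M *v y c)"
  shows "trace_metric A g p B = (\<Sum>i\<in>UNIV. \<Sum>j\<in>UNIV. Hm c (snd c p) $ i $ j * M $ i $ j)"
proof -
  define d where "d = chart_at A p"
  have d: "d \<in> charts_at A p" by (simp add: d_def chart_at)
  have cd: "c \<in> A" "d \<in> A" "p \<in> fst c" "p \<in> fst d" "snd c p \<in> cdom c" "snd d p \<in> cdom d"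
    using c d by (auto simp: charts_at_iff)
  interpret C: local_metric "cdom c" "gm c" by (rule local_metric_chart[OF cd(1)])
  interpret D: local_metric "cdom d" "gm d" by (rule local_metric_chart[OF cd(2)])
  let ?P = "jac c d (snd c p)" and ?Q = "jac d c (snd d p)"
  have QP: "?Q ** ?P = mat 1"
    using jac_inverse cd by blast
  have "B (coord_vec A d p i) (coord_vec A d p j) = (transpose ?Q ** M ** ?Q) $ i $ j" for i j
  proof -
    have e: "coord_vec A d p i c = ?Q *v axis i 1" for i
      using c d by (simp add: coord_vec_eq tvec_of_def)
    have "B (coord_vec A d p i) (coord_vec A d p j) = (?Q *v axis i 1) \<bullet> (M *v (?Q *v axis j 1))"
      by (simp add: B coord_vec_tangent[OF d] e)
    also have "\<dots> = axis i 1 \<bullet> ((transpose ?Q ** M ** ?Q) *v axis j 1)"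
      by (simp add: matrix_vector_mul_assoc[symmetric] inner_matrix_vector[of _ "transpose ?Q"] transpose_transpose del: transpose_matrix_vector)
    finally show ?thesis
      by (simp add: matrix_vector_mult_basis column_def inner_axis')
  qed
  then have "trace_metric A g p B = (\<Sum>i\<in>UNIV. \<Sum>j\<in>UNIV. D.H (snd d p) $ i $ j * (transpose ?Q ** M ** ?Q) $ i $ j)"
    by (simp add: trace_metric_def Let_def d_def[symmetric] gram_gm[OF d] D.H_def)
  also have "\<dots> = trace (D.H (snd d p) ** (transpose ?Q ** M ** ?Q))"
    by (simp add: sum_matrix_entries D.H_sym[OF cd(6)])
  also have "\<dots> = trace (?P ** (C.H (snd c p) ** transpose (?Q ** ?P) ** M ** ?Q))"
    unfolding Hm_transform[OF c d] by (simp add: matrix_mul_assoc matrix_transpose_mul)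
  also have "\<dots> = trace (C.H (snd c p) ** transpose (?Q ** ?P) ** M ** (?Q ** ?P))"
    by (subst trace_mul_sym) (simp add: matrix_mul_assoc)
  also have "\<dots> = trace (C.H (snd c p) ** M)"
    by (simp add: QP)
  also have "\<dots> = (\<Sum>i\<in>UNIV. \<Sum>j\<in>UNIV. C.H (snd c p) $ i $ j * M $ i $ j)"
    by (simp add: sum_matrix_entries C.H_sym[OF cd(5)])
  finally show ?thesis .
qed

lemma lie_bracket_lc: "smooth_vf A X \<Longrightarrow> smooth_vf A Y \<Longrightarrow> lie_bracket A X Y = lc X Y - lc Y X"
  using lc_levi_civita unfolding is_levi_civita_def by metis

lemma lie_bracket_smooth: "smooth_vf A X \<Longrightarrow> smooth_vf A Y \<Longrightarrow> smooth_vf A (lie_bracket A X Y)"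
  by (simp add: lie_bracket_lc smooth_vf_diff lc_smooth)

lemma curvature_lc:
  assumes "smooth_vf A X" "smooth_vf A Y" "smooth_vf A Z"
  shows "curvature A g X Y Z = lc (lie_bracket A X Y) Z - (lc X (lc Y Z) - lc Y (lc X Z))"
  unfolding curvature_def Let_def using assms by (simp add: levi_civita_eq lie_bracket_smooth lc_smooth)

lemma curvature_tangent:
  assumes "smooth_vf A X" "smooth_vf A Y" "smooth_vf A Z"
  shows "curvature A g X Y Z p \<in> tangent_space A p"
  unfolding curvature_lc[OF assms] using assms
  by (simp add: tangent_diff lc_tangent lie_bracket_smooth lc_smooth)

abbreviation Rm :: "('a, 'n) chart \<Rightarrow> 'n \<Rightarrow> 'n \<Rightarrow> real ^ 'n \<Rightarrow> real ^ 'n ^ 'n" where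
  "Rm c \<equiv> local_metric.Riem (gm c)"

text \<open>Only the values of the fields at \<open>p\<close> occur on the right. So the curvature
  is tensorial, and the extensions chosen in \<open>curvature_at\<close> have no influence.\<close>

lemma curvature_chart:
  assumes X: "smooth_vf A X" and Y: "smooth_vf A Y" and Z: "smooth_vf A Z" and c: "c \<in> charts_at A p"
  shows "curvature A g X Y Z p c =
    - (\<Sum>i\<in>UNIV. \<Sum>j\<in>UNIV. (X p c $ i * Y p c $ j) *\<^sub>R (Rm c i j (snd c p) *v Z p c))"
proof -
  have cA: "c \<in> A" "snd c p \<in> cdom c" using c by (auto simp: charts_at_iff)
  interpret C: local_metric "cdom c" "gm c" by (rule local_metric_chart[OF cA(1)])
  have r: "vf_rep c (lc Y Z) x = C.cov (vf_rep c Y x) (vf_rep c Z) x" if "x \<in> cdom c" for x Y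
    using vf_rep_lc[OF cA(1) that] by (simp add: C.cov_def)
  have "C.cov v (vf_rep c (lc Y Z)) (snd c p) = C.cov v (\<lambda>x. C.cov (vf_rep c Y x) (vf_rep c Z) x) (snd c p)" for v Y
    unfolding C.cov_def[of v] C.nab_def
    using pd_cong[OF C.openU cA(2) r] r[OF cA(2)] by (simp only:)
  then show ?thesis
    using C.cov_curvature[OF cA(2) smooth_vf_rep[OF X cA(1)] smooth_vf_rep[OF Y cA(1)] smooth_vf_rep[OF Z cA(1)]]
      lie_bracket_chart[OF X Y c] c
    by (simp add: curvature_lc[OF X Y Z] lc_chart)
qed

lemma curvature_at_tangent:
  "x \<in> tangent_space A p \<Longrightarrow> y \<in> tangent_space A p \<Longrightarrow> z \<in> tangent_space A p \<Longrightarrow>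
    curvature_at A g p x y z \<in> tangent_space A p"
  by (simp add: curvature_at_def curvature_tangent vf_ext)

lemma curvature_at_chart:
  "x \<in> tangent_space A p \<Longrightarrow> y \<in> tangent_space A p \<Longrightarrow> z \<in> tangent_space A p \<Longrightarrow> c \<in> charts_at A p \<Longrightarrow>
    curvature_at A g p x y z c = - (\<Sum>i\<in>UNIV. \<Sum>j\<in>UNIV. (x c $ i * y c $ j) *\<^sub>R (Rm c i j (snd c p) *v z c))"
  by (simp add: curvature_at_def curvature_chart vf_ext)

lemma scalar_curvature_chart:
  assumes c: "c \<in> charts_at A p"
  shows "scalar_curvature A g p = (\<Sum>a\<in>UNIV. \<Sum>e\<in>UNIV. Hm c (snd c p) $ a $ e * (\<Sum>b\<in>UNIV. Rm c b a (snd c p) $ b $ e))"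
proof -
  interpret C: local_metric "cdom c" "gm c" using c by (intro local_metric_chart) (simp add: charts_at_iff)
  have "ricci A g p x y = x c \<bullet> ((\<chi> a e. \<Sum>b\<in>UNIV. (- Rm c a b (snd c p)) $ b $ e) *v y c)"
    if "x \<in> tangent_space A p" "y \<in> tangent_space A p" for x y
    unfolding ricci_def using that c
    by (intro trace_endo_bilinear[OF c]) (simp_all add: curvature_at_tangent curvature_at_chart matrix_vector_simps sum_negf)
  \<comment> \<open>Exchanging the two indices of \<open>Riem\<close> absorbs the minus sign of the
    curvature convention.\<close>
  from trace_metric_chart[where B = "ricci A g p", OF c this] show ?thesis
    by (simp add: scalar_curvature_def C.Riem_antisym[of _ _ "snd c p", symmetric] del: vector_uminus_component)
qed

lemma grad_norm_sq_chart:
  assumes c: "c \<in> charts_at A p" and u: "smooth_fun A u"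
  shows "grad_norm_sq A g u p = (\<Sum>i\<in>UNIV. \<Sum>j\<in>UNIV. Hm c (snd c p) $ i $ j *
    (pd i (u \<circ> chart_inv c) (snd c p) * pd j (u \<circ> chart_inv c) (snd c p)))"
proof -
  let ?d = "\<lambda>i. pd i (u \<circ> chart_inv c) (snd c p)"
  have "differential A u p v * differential A u p w = v c \<bullet> ((\<chi> i j. ?d i * ?d j) *v w c)"
    if "v \<in> tangent_space A p" "w \<in> tangent_space A p" for v w
    using differential_chart[OF c that(1) smooth_fun_differentiable[OF u c]]
      differential_chart[OF c that(2) smooth_fun_differentiable[OF u c]]
    by (simp add: inner_matrix_sum sum_product ac_simps)
  from trace_metric_chart[where B = "\<lambda>v w. differential A u p v * differential A u p w", OF c this] show ?thesis
    by (simp add: grad_norm_sq_def)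
qed

end

section \<open>Almost Hermitian manifolds\<close>

locale hermitian_manifold = riemannian_manifold A g
  for A :: "('a::{t2_space, second_countable_topology}, 'n::finite) chart set" and g :: "('a, 'n) metric" +
  fixes J :: "('a, 'n) endo"
  assumes hermitian: "almost_hermitian A g J"
begin

lemma J_tangent: "v \<in> tangent_space A p \<Longrightarrow> J p v \<in> tangent_space A p"
  and J_add: "v \<in> tangent_space A p \<Longrightarrow> w \<in> tangent_space A p \<Longrightarrow> J p (v + w) = J p v + J p w"
  and J_scale: "v \<in> tangent_space A p \<Longrightarrow> J p (tscale r v) = tscale r (J p v)"
  and J_square: "v \<in> tangent_space A p \<Longrightarrow> J p (J p v) = - v"
  and J_isometry: "v \<in> tangent_space A p \<Longrightarrow> w \<in> tangent_space A p \<Longrightarrow> g p (J p v) (J p w) = g p v w"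
  using hermitian unfolding almost_hermitian_def almost_complex_structure_def by blast+

definition Jm :: "('a, 'n) chart \<Rightarrow> real ^ 'n \<Rightarrow> real ^ 'n ^ 'n" where
  "Jm c x = (\<chi> k i. J (chart_inv c x) (coord_vec A c (chart_inv c x) i) c $ k)"

lemma J_chart:
  assumes c: "c \<in> charts_at A p" and v: "v \<in> tangent_space A p"
  shows "J p v c = Jm c (snd c p) *v v c"
proof -
  have "J p v c = (\<Sum>i\<in>UNIV. v c $ i *\<^sub>R J p (coord_vec A c p i) c)"
    using c v by (intro tangent_linear_expand[of p "\<lambda>v. J p v c"]) (simp_all add: J_add J_scale)
  then show ?thesis
    using c by (simp add: vec_eq_iff Jm_def matrix_vector_mult_def charts_at_iff mult.commute)
qed

lemma local_hermitian_chart: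
  assumes c: "c \<in> A"
  shows "local_hermitian (cdom c) (gm c) (Jm c)"
proof -
  interpret C: local_metric "cdom c" "gm c" by (rule local_metric_chart[OF c])
  show ?thesis
  proof
    have "smooth_on (cdom c) (\<lambda>x. J (chart_inv c x) (coord_vec A c (chart_inv c x) i) c)" for i
      using hermitian c unfolding almost_hermitian_def almost_complex_structure_def by blast
    then show "smooth_on (cdom c) (Jm c)"
      unfolding Jm_def[abs_def] by (intro smooth_on_vec_lambda smooth_on_vec_nth C.openU)
  next
    fix x assume x: "x \<in> cdom c"
    then obtain p where p: "x = snd c p" "c \<in> charts_at A p"
      using c by (auto simp: charts_at_iff)
    note t = tvec_of_tangent[OF p(2)]
    have Jv: "J p (tvec_of c p v) c = Jm c x *v v" for v
      using J_chart[OF p(2) t] p by simp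
    have "(Jm c x ** Jm c x) *v v = (- mat 1) *v v" for v
      using J_square[OF t, of v] J_chart[OF p(2) J_tangent[OF t], of v] Jv[of v] p
      by (simp add: matrix_vector_mul_assoc[symmetric] matrix_vector_simps)
    then show "Jm c x ** Jm c x = - mat 1"
      by (simp add: matrix_eq)
    show "transpose (Jm c x) ** gm c x ** Jm c x = gm c x"
    proof (rule matrix_eq_if_inner_eq)
      fix u v :: "real ^ 'n"
      have "u \<bullet> ((transpose (Jm c x) ** gm c x ** Jm c x) *v v) = (Jm c x *v u) \<bullet> (gm c x *v (Jm c x *v v))"
        by (simp add: matrix_vector_mul_assoc[symmetric] inner_matrix_vector[of u "transpose (Jm c x)"] transpose_transpose del: transpose_matrix_vector)
      also have "\<dots> = u \<bullet> (gm c x *v v)"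
        using J_isometry[OF t t, of u v] metric_chart[OF p(2) J_tangent[OF t] J_tangent[OF t], of u v]
          metric_chart[OF p(2) t t, of u v] Jv p by simp
      finally show "u \<bullet> ((transpose (Jm c x) ** gm c x ** Jm c x) *v v) = u \<bullet> (gm c x *v v)" .
    qed
  qed
qed

lemma vf_rep_endo:
  assumes X: "smooth_vf A X" and c: "c \<in> A" and x: "x \<in> cdom c"
  shows "vf_rep c (vf_endo J X) x = Jm c x *v vf_rep c X x"
  using J_chart[of c "chart_inv c x", OF _ smooth_vf_tangent[OF X]] c x
  by (simp add: vf_rep_def vf_endo_def charts_at_iff)

lemma vf_endo_smooth:
  assumes X: "smooth_vf A X"
  shows "smooth_vf A (vf_endo J X)"
  unfolding smooth_vf_def
proof (intro conjI allI ballI)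
  show "vf_endo J X p \<in> tangent_space A p" for p
    by (simp add: vf_endo_def J_tangent smooth_vf_tangent[OF X])
  fix c assume c: "c \<in> A"
  interpret C: local_hermitian "cdom c" "gm c" "Jm c" by (rule local_hermitian_chart[OF c])
  have "smooth_on (cdom c) (\<lambda>x. Jm c x *v vf_rep c X x)"
    by (intro smooth_intros C.openU C.smooth_J smooth_vf_rep X c)
  then show "smooth_on (cdom c) (vf_rep c (vf_endo J X))"
    by (rule smooth_on_cong[OF C.openU, THEN iffD1, rotated]) (simp add: vf_rep_endo[OF X c])
qed

lemma pd_vf_endo:
  assumes X: "smooth_vf A X" and c: "c \<in> charts_at A p"
  shows "pd i (vf_rep c (vf_endo J X)) (snd c p) = pd i (Jm c) (snd c p) *v X p c + Jm c (snd c p) *v pd i (vf_rep c X) (snd c p)"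
proof -
  have cA: "c \<in> A" "snd c p \<in> cdom c" using c by (auto simp: charts_at_iff)
  interpret C: local_hermitian "cdom c" "gm c" "Jm c" by (rule local_hermitian_chart[OF cA(1)])
  have "pd i (vf_rep c (vf_endo J X)) (snd c p) = pd i (\<lambda>x. Jm c x *v vf_rep c X x) (snd c p)"
    by (intro pd_cong[OF C.openU cA(2)] vf_rep_endo X cA)
  also have "\<dots> = pd i (Jm c) (snd c p) *v vf_rep c X (snd c p) + Jm c (snd c p) *v pd i (vf_rep c X) (snd c p)"
    by (intro pd_matrix_vector_mult C.differentiable[OF C.smooth_J cA(2)] smooth_vf_rep_differentiable X c)
  finally show ?thesis using c by simp
qed

text \<open>Derivatives of the fields drop out of the Nijenhuis tensor, so arbitrary extensions of
  the coordinate vectors may be inserted although their brackets need not vanish.\<close>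

lemma integrable_nij_zero:
  assumes int: "integrable_acs A J" and c: "c \<in> charts_at A p"
  shows "local_hermitian.nij_zero (Jm c) (snd c p)"
proof -
  have cA: "c \<in> A" "snd c p \<in> cdom c" using c by (auto simp: charts_at_iff)
  interpret C: local_hermitian "cdom c" "gm c" "Jm c" by (rule local_hermitian_chart[OF cA(1)])
  let ?J = "Jm c (snd c p)"
  let ?DJ = "\<lambda>v. \<Sum>b\<in>UNIV. v $ b *\<^sub>R pd b (Jm c) (snd c p)"
  \<comment> \<open>After expanding the four brackets by the product rule, the terms that
    differentiate \<open>X\<close> or \<open>Y\<close> cancel because J J = -1; derivatives of J
    remain.\<close>
  have main: "?DJ (?J *v X p c) *v Y p c - ?DJ (?J *v Y p c) *v X p c
      - ?J *v (?DJ (X p c) *v Y p c) + ?J *v (?DJ (Y p c) *v X p c) = 0"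
    if X: "smooth_vf A X" and Y: "smooth_vf A Y" for X Y
  proof -
    let ?D = "\<lambda>v Y. \<Sum>b\<in>UNIV. v $ b *\<^sub>R pd b (vf_rep c Y) (snd c p)"
    note JX = vf_endo_smooth[OF X] and JY = vf_endo_smooth[OF Y]
    have DJ: "?D v (vf_endo J Y) = ?DJ v *v Y p c + ?J *v ?D v Y" if Y: "smooth_vf A Y" for v Y
      by (simp add: pd_vf_endo[OF Y c] scaleR_add_right sum.distrib matrix_vector_simps
        matrix_vector_sum_left
        matrix_vector_sum_right)
    have Jc: "vf_endo J X p c = ?J *v X p c" if "smooth_vf A X" for X
      using J_chart[OF c smooth_vf_tangent[OF that]] by (simp add: vf_endo_def)
    have JJ: "?J *v (?J *v v) = - v" for v
      by (simp add: matrix_vector_mul_assoc C.J_J[OF cA(2)] matrix_vector_simps)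
    have "nijenhuis A J X Y p c = 0"
      using int X Y by (simp add: integrable_acs_def)
    then have "lie_bracket A (vf_endo J X) (vf_endo J Y) p c - lie_bracket A X Y p c
       - ?J *v lie_bracket A (vf_endo J X) Y p c - ?J *v lie_bracket A X (vf_endo J Y) p c = 0"
      using J_chart[OF c lie_bracket_tangent[OF JX Y]] J_chart[OF c lie_bracket_tangent[OF X JY]]
      by (simp add: nijenhuis_def vf_endo_def[of J "lie_bracket A _ _"])
    then show ?thesis
      unfolding lie_bracket_chart[OF JX JY c] lie_bracket_chart[OF X Y c] lie_bracket_chart[OF JX Y c]
        lie_bracket_chart[OF X JY c] DJ[OF X] DJ[OF Y] Jc[OF X] Jc[OF Y]
      by (simp add: matrix_vector_simps JJ algebra_simps)
  qed
  show ?thesis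
    unfolding C.nij_zero_def
  proof (intro allI)
    fix i j
    note e = vf_ext[OF tvec_of_tangent[OF c]]
    have DJa: "?DJ (axis i 1) = pd i (Jm c) (snd c p)" for i
      by (simp add: axis_def if_distrib[of "\<lambda>r. r *\<^sub>R _"] cong: if_cong)
    have Ja: "(?J *v axis i 1) $ b = ?J $ b $ i" for i b
      by (simp add: matrix_vector_mult_basis column_def)
    from main[OF e(1)[of "axis i 1"] e(1)[of "axis j 1"]]
    show "(\<Sum>b\<in>UNIV. ?J $ b $ i *\<^sub>R pd b (Jm c) (snd c p)) *v axis j 1
       - (\<Sum>b\<in>UNIV. ?J $ b $ j *\<^sub>R pd b (Jm c) (snd c p)) *v axis i 1
       - (?J ** pd i (Jm c) (snd c p)) *v axis j 1 + (?J ** pd j (Jm c) (snd c p)) *v axis i 1 = 0"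
      unfolding e(2) tvec_of_self[OF c] DJa Ja matrix_vector_mul_assoc .
  qed
qed

section \<open>The holomorphic d-scalar curvature in coordinates\<close>

lemma star_scalar_curvature_chart:
  assumes c: "c \<in> charts_at A p"
  shows "star_scalar_curvature A g J p = (\<Sum>a\<in>UNIV. \<Sum>e\<in>UNIV. Hm c (snd c p) $ a $ e *
    (\<Sum>b\<in>UNIV. (- (Jm c (snd c p) ** Rm c b a (snd c p) ** Jm c (snd c p))) $ b $ e))"
proof -
  interpret C: local_metric "cdom c" "gm c" using c by (intro local_metric_chart) (simp add: charts_at_iff)
  let ?J = "Jm c (snd c p)"
  have "star_ricci A g J p x y = x c \<bullet> ((\<chi> a e. \<Sum>b\<in>UNIV. (?J ** Rm c a b (snd c p) ** ?J) $ b $ e) *v y c)"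
    if x: "x \<in> tangent_space A p" and y: "y \<in> tangent_space A p" for x y
    unfolding star_ricci_def
  proof (rule trace_endo_bilinear[OF c])
    fix v assume v: "v \<in> tangent_space A p"
    show "- J p (curvature_at A g p x v (J p y)) \<in> tangent_space A p"
      by (intro tangent_minus J_tangent curvature_at_tangent x y v)
    show "(- J p (curvature_at A g p x v (J p y))) c =
        (\<Sum>a\<in>UNIV. \<Sum>b\<in>UNIV. (x c $ a * v c $ b) *\<^sub>R ((?J ** Rm c a b (snd c p) ** ?J) *v y c))"
      using J_chart[OF c curvature_at_tangent[OF x v J_tangent[OF y]]]
        curvature_at_chart[OF x v J_tangent[OF y] c] J_chart[OF c y]
      by (simp add: matrix_vector_simps matrix_vector_sum_right
        matrix_vector_mul_assoc matrix_mul_assoc)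
  qed
  from trace_metric_chart[where B = "star_ricci A g J p", OF c this]
  have "star_scalar_curvature A g J p = (\<Sum>a\<in>UNIV. \<Sum>e\<in>UNIV. Hm c (snd c p) $ a $ e *
    (\<Sum>b\<in>UNIV. (?J ** Rm c a b (snd c p) ** ?J) $ b $ e))"
    by (simp add: star_scalar_curvature_def)
  note star = this
  have "?J ** Rm c a b (snd c p) ** ?J = - (?J ** Rm c b a (snd c p) ** ?J)" for a b
    by (subst C.Riem_antisym) (simp add: matrix_mult_simps)
  note m = this
  have "(\<Sum>b\<in>UNIV. (?J ** Rm c a b (snd c p) ** ?J) $ b $ e) =
      (\<Sum>b\<in>UNIV. (- (?J ** Rm c b a (snd c p) ** ?J)) $ b $ e)" for a e
  proof (intro sum.cong refl)
    fix b show "(?J ** Rm c a b (snd c p) ** ?J) $ b $ e = (- (?J ** Rm c b a (snd c p) ** ?J)) $ b $ e"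
      unfolding m[of a b] ..
  qed
  then show ?thesis unfolding star by (simp only:)
qed

lemma holomorphic_d_scalar_chart:
  assumes c: "c \<in> charts_at A p"
  shows "holomorphic_d_scalar A g J p = local_hermitian.SJ (gm c) (Jm c) (snd c p)"
proof -
  have cA: "c \<in> A" "snd c p \<in> cdom c" using c by (auto simp: charts_at_iff)
  interpret C: local_hermitian "cdom c" "gm c" "Jm c" by (rule local_hermitian_chart[OF cA(1)])
  let ?H = "C.H (snd c p)"
  let ?S = "\<lambda>b a. Rm c b a (snd c p) + Jm c (snd c p) ** Rm c b a (snd c p) ** Jm c (snd c p)"
  note sym = C.H_nth_sym[OF cA(2)]
  have "holomorphic_d_scalar A g J p = (\<Sum>a\<in>UNIV. \<Sum>e\<in>UNIV. ?H $ a $ e * (\<Sum>b\<in>UNIV. ?S b a $ b $ e))"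
    unfolding holomorphic_d_scalar_def scalar_curvature_chart[OF c] star_scalar_curvature_chart[OF c]
    by (simp add: sum_subtractf[symmetric] right_diff_distrib[symmetric] sum_negf sum.distrib algebra_simps)
  also have "\<dots> = (\<Sum>a\<in>UNIV. \<Sum>b\<in>UNIV. \<Sum>e\<in>UNIV. ?S b a $ b $ e * ?H $ e $ a)"
  proof -
    have "(\<Sum>e\<in>UNIV. ?H $ a $ e * (\<Sum>b\<in>UNIV. ?S b a $ b $ e)) = (\<Sum>b\<in>UNIV. \<Sum>e\<in>UNIV. ?S b a $ b $ e * ?H $ e $ a)" for a
      unfolding sum_distrib_left by (subst sum.swap) (simp only: sym[of a] mult.commute)
    then show ?thesis by (simp only:)
  qed
  also have "\<dots> = (\<Sum>b\<in>UNIV. \<Sum>a\<in>UNIV. (?S b a ** ?H) $ b $ a)"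
    by (subst sum.swap) (simp add: matrix_matrix_mult_def[of _ ?H])
  finally show ?thesis by (simp add: C.SJ_def)
qed

text \<open>The covariant derivative of J as a tensor on the manifold, computed by extensions;
  \<open>nabla_J_chart\<close> shows that they do not matter. Its metric trace is what makes W
  independent of the chart.\<close>

definition nabla_J :: "'a \<Rightarrow> ('a, 'n) tvec \<Rightarrow> ('a, 'n) tvec \<Rightarrow> ('a, 'n) tvec" where
  "nabla_J p x y = lc (vf_ext A p x) (vf_endo J (vf_ext A p y)) p - J p (lc (vf_ext A p x) (vf_ext A p y) p)"

lemma nabla_J_tangent:
  "x \<in> tangent_space A p \<Longrightarrow> y \<in> tangent_space A p \<Longrightarrow> nabla_J p x y \<in> tangent_space A p"
  unfolding nabla_J_def by (intro tangent_diff J_tangent lc_tangent vf_endo_smooth vf_ext)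

lemma nabla_J_chart:
  assumes x: "x \<in> tangent_space A p" and y: "y \<in> tangent_space A p" and c: "c \<in> charts_at A p"
  shows "nabla_J p x y c = (\<Sum>a\<in>UNIV. x c $ a *\<^sub>R (local_hermitian.nabJ (gm c) (Jm c) a (snd c p) *v y c))"
proof -
  have cA: "c \<in> A" "snd c p \<in> cdom c" using c by (auto simp: charts_at_iff)
  interpret C: local_hermitian "cdom c" "gm c" "Jm c" by (rule local_hermitian_chart[OF cA(1)])
  have Jy: "vf_endo J (vf_ext A p y) p c = Jm c (snd c p) *v y c"
    using J_chart[OF c y] by (simp add: vf_endo_def vf_ext[OF y])
  have "nabla_J p x y c = C.cov (x c) (vf_rep c (vf_endo J (vf_ext A p y))) (snd c p)
      - Jm c (snd c p) *v C.cov (x c) (vf_rep c (vf_ext A p y)) (snd c p)"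
    unfolding nabla_J_def using x y c
    by (simp add: lc_chart J_chart[OF c lc_tangent] vf_ext)
  also have "\<dots> = (\<Sum>a\<in>UNIV. x c $ a *\<^sub>R (C.nabJ a (snd c p) *v y c))"
    unfolding C.cov_def C.nab_def pd_vf_endo[OF vf_ext(1)[OF y] c] C.nabJ_def
    using c Jy vf_ext(2)[OF y]
    by (simp add: matrix_vector_sum_right matrix_vector_simps
      sum_subtractf[symmetric] scaleR_diff_right[symmetric] matrix_vector_mul_assoc[symmetric] add_diff_eq)
  finally show ?thesis .
qed

lemma Jm_transform:
  assumes c: "c \<in> charts_at A p" and d: "d \<in> charts_at A p"
  shows "jac c d (snd c p) ** Jm c (snd c p) = Jm d (snd d p) ** jac c d (snd c p)"
proof -
  have "jac c d (snd c p) *v (Jm c (snd c p) *v v) = Jm d (snd d p) *v (jac c d (snd c p) *v v)" for v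
    using tangent_transform[OF J_tangent[OF tvec_of_tangent[OF c]] c d, of v]
      tangent_transform[OF tvec_of_tangent[OF c] c d, of v]
      J_chart[OF c tvec_of_tangent[OF c], of v] J_chart[OF d tvec_of_tangent[OF c], of v] c
    by simp
  then show ?thesis
    by (simp add: matrix_eq matrix_vector_mul_assoc[symmetric])
qed

abbreviation Wm :: "('a, 'n) chart \<Rightarrow> real ^ 'n \<Rightarrow> real ^ 'n" where
  "Wm c \<equiv> local_hermitian.W (gm c) (Jm c)"

lemma Wm_eq:
  assumes c: "c \<in> A" and x: "x \<in> cdom c"
  shows "Wm c x = Jm c x *v (\<chi> k. \<Sum>a\<in>UNIV. (local_hermitian.nabJ (gm c) (Jm c) a x ** Hm c x) $ k $ a)"
proof -
  interpret C: local_hermitian "cdom c" "gm c" "Jm c" by (rule local_hermitian_chart[OF c])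
  show ?thesis
    unfolding C.V_eq[OF x] by (simp add: matrix_vector_simps matrix_vector_mul_assoc C.J_J[OF x])
qed

text \<open>The metric trace of \<open>nabla_J\<close> is a tangent vector because each of its
  components is the trace of a scalar bilinear form; J then commutes with the Jacobians.\<close>

lemma Wm_transform:
  assumes c: "c \<in> charts_at A p" and d: "d \<in> charts_at A p"
  shows "Wm d (snd d p) = jac c d (snd c p) *v Wm c (snd c p)"
proof -
  have cd: "c \<in> A" "snd c p \<in> cdom c" "d \<in> A" "snd d p \<in> cdom d"
    using c d by (auto simp: charts_at_iff)
  interpret C: local_hermitian "cdom c" "gm c" "Jm c" by (rule local_hermitian_chart[OF cd(1)])
  interpret D: local_hermitian "cdom d" "gm d" "Jm d" by (rule local_hermitian_chart[OF cd(3)])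
  let ?P = "jac c d (snd c p)"
  note symC = C.H_nth_sym[OF cd(2)] and symD = D.H_nth_sym[OF cd(4)]
  have comp: "(\<Sum>a\<in>UNIV. x $ a *\<^sub>R (M a *v y)) $ k = x \<bullet> ((\<chi> a b. M a $ k $ b) *v y)"
    for x y :: "real ^ 'n" and M :: "'n \<Rightarrow> real ^ 'n ^ 'n" and k
    by (simp add: inner_vec_def matrix_vector_mult_def)
  have "(\<chi> k. \<Sum>a\<in>UNIV. (D.nabJ a (snd d p) ** D.H (snd d p)) $ k $ a) = ?P *v (\<chi> k. \<Sum>a\<in>UNIV. (C.nabJ a (snd c p) ** C.H (snd c p)) $ k $ a)"
    (is "?VD = ?P *v ?VC")
  proof -
    have "?VD $ k = (?P *v ?VC) $ k" for k
    proof -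
      \<comment> \<open>The same scalar form, component \<open>k\<close> in the chart
        \<open>d\<close>, is read first in the coordinates of \<open>d\<close> and then in those of
        \<open>c\<close>, so \<open>trace_metric_chart\<close> can compare the two
        contractions.\<close>
      have B1: "nabla_J p x y d $ k = x d \<bullet> ((\<chi> a b. D.nabJ a (snd d p) $ k $ b) *v y d)"
        if "x \<in> tangent_space A p" "y \<in> tangent_space A p" for x y
        using nabla_J_chart[OF that d] comp by simp
      have B2: "nabla_J p x y d $ k = x c \<bullet> ((\<chi> a b. (?P ** C.nabJ a (snd c p)) $ k $ b) *v y c)"
        if "x \<in> tangent_space A p" "y \<in> tangent_space A p" for x y
      proof -
        have "nabla_J p x y d = (\<Sum>a\<in>UNIV. x c $ a *\<^sub>R ((?P ** C.nabJ a (snd c p)) *v y c))"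
          unfolding tangent_transform[OF nabla_J_tangent[OF that] c d] nabla_J_chart[OF that c]
          by (simp add: matrix_vector_sum_right matrix_vector_simps matrix_vector_mul_assoc)
        then show ?thesis using comp by simp
      qed
      have "(\<Sum>a\<in>UNIV. \<Sum>b\<in>UNIV. D.H (snd d p) $ a $ b * D.nabJ a (snd d p) $ k $ b) =
          (\<Sum>a\<in>UNIV. \<Sum>b\<in>UNIV. C.H (snd c p) $ a $ b * (?P ** C.nabJ a (snd c p)) $ k $ b)"
        using trace_metric_chart[where B = "\<lambda>x y. nabla_J p x y d $ k", OF d B1]
          trace_metric_chart[where B = "\<lambda>x y. nabla_J p x y d $ k", OF c B2] by simp
      moreover have "?VD $ k = (\<Sum>a\<in>UNIV. \<Sum>b\<in>UNIV. D.H (snd d p) $ a $ b * D.nabJ a (snd d p) $ k $ b)"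
        using symD by (simp add: matrix_matrix_mult_def mult.commute)
      moreover have "(?P *v ?VC) $ k = (\<Sum>a\<in>UNIV. \<Sum>b\<in>UNIV. C.H (snd c p) $ a $ b * (?P ** C.nabJ a (snd c p)) $ k $ b)"
      proof -
        have "(?P *v ?VC) $ k = (\<Sum>a\<in>UNIV. (?P ** (C.nabJ a (snd c p) ** C.H (snd c p))) $ k $ a)"
          by (simp add: matrix_vector_mult_def matrix_matrix_mult_def[of ?P] sum_distrib_left) (rule sum.swap)
        also have "\<dots> = (\<Sum>a\<in>UNIV. ((?P ** C.nabJ a (snd c p)) ** C.H (snd c p)) $ k $ a)"
          by (simp only: matrix_mul_assoc)
        also have "\<dots> = (\<Sum>a\<in>UNIV. \<Sum>b\<in>UNIV. (?P ** C.nabJ a (snd c p)) $ k $ b * C.H (snd c p) $ b $ a)"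
          by (simp add: matrix_matrix_mult_def[of _ "C.H (snd c p)"])
        finally show ?thesis
          using symC by (simp add: mult.commute)
      qed
      ultimately show ?thesis by simp
    qed
    then show ?thesis by (intro vec_eq_iff[THEN iffD2] allI)
  qed
  then show ?thesis
    unfolding Wm_eq[OF cd(1,2)] Wm_eq[OF cd(3,4)]
    by (simp only: matrix_vector_mul_assoc Jm_transform[OF c d])
qed

text \<open>With \<open>S\<^sub>J = 2 div W + |W|\<^sup>2\<close> the integrand is \<open>|2 grad u - u W|\<^sup>2 + div (2 u\<^sup>2 W)\<close>.\<close>

lemma integrand_ge_divergence:
  assumes int: "integrable_acs A J" and u: "smooth_fun A u" and c: "c \<in> charts_at A p"
  shows "local_metric.dvg (gm c) (\<lambda>x. (2 * (u (chart_inv c x))\<^sup>2) *\<^sub>R Wm c x) (snd c p)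
    \<le> 4 * grad_norm_sq A g u p + holomorphic_d_scalar A g J p * (u p)\<^sup>2"
proof -
  have cA: "c \<in> A" "snd c p \<in> cdom c" "p \<in> fst c" using c by (auto simp: charts_at_iff)
  interpret C: local_hermitian "cdom c" "gm c" "Jm c" by (rule local_hermitian_chart[OF cA(1)])
  let ?x = "snd c p" and ?H = "C.H (snd c p)" and ?G = "gm c (snd c p)" and ?W = "C.W (snd c p)"
  define v where "v x = u (chart_inv c x)" for x
  define D where "D = (\<chi> i. pd i v ?x)"
  have sv: "smooth_on (cdom c) v"
    using u cA unfolding smooth_fun_def v_def by (simp add: o_def)
  have dv: "v differentiable (at ?x)" by (rule C.differentiable[OF sv cA(2)])
  have dW: "C.W differentiable (at ?x)" by (rule C.differentiable[OF C.smooth_W cA(2)])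
  have "smooth_on (cdom c) (\<lambda>x. 2 * (v x * v x))"
    by (intro smooth_intros C.openU sv)
  then have dv2: "(\<lambda>x. 2 * (v x * v x)) differentiable (at ?x)" by (rule C.differentiable[OF _ cA(2)])
  have "smooth_on (cdom c) (\<lambda>x. v x * v x)"
    by (intro smooth_intros C.openU sv)
  then have dv3: "(\<lambda>x. v x * v x) differentiable (at ?x)" by (rule C.differentiable[OF _ cA(2)])
  have p2: "pd i (\<lambda>x. 2 * (v x * v x)) ?x = 4 * v ?x * D $ i" for i
    using dv dv3 by (simp add: pd_mult D_def)
  have "C.dvg (\<lambda>x. (2 * (v x * v x)) *\<^sub>R C.W x) ?x = 4 * v ?x * (D \<bullet> ?W) + 2 * (v ?x * v ?x) * C.dvg C.W ?x"
  proof -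
    have "pd i (\<lambda>x. (2 * (v x * v x)) *\<^sub>R C.W x) ?x = (4 * v ?x * D $ i) *\<^sub>R ?W + (2 * (v ?x * v ?x)) *\<^sub>R pd i C.W ?x" for i
      by (simp only: pd_scaleR[OF dv2 dW] p2)
    then show ?thesis
      by (simp add: C.dvg_def C.nab_def matrix_vector_simps inner_vec_def
        sum.distrib sum_distrib_left algebra_simps)
  qed
  moreover have "holomorphic_d_scalar A g J p = 2 * C.dvg C.W ?x + ?W \<bullet> (?G *v ?W)"
    unfolding holomorphic_d_scalar_chart[OF c] by (rule C.SJ_eq[OF cA(2) integrable_nij_zero[OF int c]])
  moreover have "grad_norm_sq A g u p = D \<bullet> (?H *v D)"
    unfolding grad_norm_sq_chart[OF c u] by (simp add: D_def v_def[abs_def] o_def inner_matrix_sum mult.commute mult.left_commute)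
  moreover have "0 \<le> 4 * (D \<bullet> (?H *v D)) - 4 * v ?x * (D \<bullet> ?W) + v ?x * v ?x * (?W \<bullet> (?G *v ?W))"
  proof -
    let ?y = "2 *\<^sub>R (?H *v D) - v ?x *\<^sub>R ?W"
    have "0 \<le> ?y \<bullet> (?G *v ?y)"
      using C.G_pos[OF cA(2), of ?y] by (cases "?y = 0") auto
    also have "?G *v ?y = 2 *\<^sub>R D - v ?x *\<^sub>R (?G *v ?W)"
      using C.G_H[OF cA(2)] by (simp add: matrix_vector_simps matrix_vector_mul_assoc)
    also have "?y \<bullet> (2 *\<^sub>R D - v ?x *\<^sub>R (?G *v ?W)) = 4 * (D \<bullet> (?H *v D)) - 2 * v ?x * (D \<bullet> ?W)
        - 2 * v ?x * ((?H *v D) \<bullet> (?G *v ?W)) + v ?x * v ?x * (?W \<bullet> (?G *v ?W))"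
      by (simp add: inner_diff_left inner_diff_right inner_commute algebra_simps)
    also have "(?H *v D) \<bullet> (?G *v ?W) = D \<bullet> ?W"
    proof -
      have "(?H *v D) \<bullet> (?G *v ?W) = (transpose ?G *v (?H *v D)) \<bullet> ?W"
        by (rule inner_matrix_vector)
      also have "transpose ?G = ?G" by (rule C.G_sym[OF cA(2)])
      finally show ?thesis
        using C.G_H[OF cA(2)] by (simp add: matrix_vector_mul_assoc)
    qed
    finally show ?thesis by simp
  qed
  moreover have "v ?x = u p" using cA by (simp add: v_def)
  ultimately show ?thesis
    by (simp add: v_def[symmetric] power2_eq_square algebra_simps)
qed

end

section \<open>Change of variables\<close>

text \<open>The change of variables theorem of the library needs a well-ordered index type; a copy of the
  finite type \<open>'n\<close> carrying an enumeration as its order provides one.\<close>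

typedef 'n wo = "UNIV :: 'n set" ..

lemma inj_Rep_wo: "inj Rep_wo" and surj_Rep_wo: "surj Rep_wo" and bij_Rep_wo: "bij Rep_wo"
  by (auto simp: inj_def surj_def bij_def Rep_wo_inject intro: Abs_wo_inverse[symmetric])

instantiation wo :: (finite) "{finite, wellorder}"
begin

definition less_eq_wo :: "'a wo \<Rightarrow> 'a wo \<Rightarrow> bool" where
  "less_eq_wo x y \<longleftrightarrow> to_nat (Rep_wo x) \<le> to_nat (Rep_wo y)"

definition less_wo :: "'a wo \<Rightarrow> 'a wo \<Rightarrow> bool" where
  "less_wo x y \<longleftrightarrow> to_nat (Rep_wo x) < to_nat (Rep_wo y)"

instance
proof
  show "finite (UNIV :: 'a wo set)"
    by (rule finite_imageD[OF finite inj_Rep_wo])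
  fix x y z :: "'a wo"
  show "x < y \<longleftrightarrow> x \<le> y \<and> \<not> y \<le> x"
    by (auto simp: less_eq_wo_def less_wo_def)
  show "x \<le> x" "x \<le> y \<Longrightarrow> y \<le> z \<Longrightarrow> x \<le> z" "x \<le> y \<or> y \<le> x"
    by (auto simp: less_eq_wo_def)
  show "x \<le> y \<Longrightarrow> y \<le> x \<Longrightarrow> x = y"
    by (simp add: less_eq_wo_def Rep_wo_inject)
next
  fix P :: "'a wo \<Rightarrow> bool" and a
  assume step: "\<And>x. (\<And>y. y < x \<Longrightarrow> P y) \<Longrightarrow> P x"
  show "P a"
    by (induction a rule: measure_induct_rule[where f = "\<lambda>x. to_nat (Rep_wo x)"])
      (auto intro: step simp: less_wo_def)
qed

end

section \<open>Transport of vectors, measure and determinants to the ordered index type\<close>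

definition wo_vec :: "'b ^ 'n::finite \<Rightarrow> 'b ^ 'n wo" where
  "wo_vec x = (\<chi> i. x $ Rep_wo i)"

definition unwo_vec :: "'b ^ 'n::finite wo \<Rightarrow> 'b ^ 'n" where
  "unwo_vec y = (\<chi> k. y $ Abs_wo k)"

lemma unwo_wo [simp]: "unwo_vec (wo_vec x) = x" and wo_unwo [simp]: "wo_vec (unwo_vec y) = y"
  by (simp_all add: wo_vec_def unwo_vec_def vec_eq_iff Abs_wo_inverse Rep_wo_inverse)

lemma bounded_linear_wo_vec: "bounded_linear (wo_vec :: real ^ 'n::finite \<Rightarrow> _)"
  by (rule linear_conv_bounded_linear[THEN iffD1]) (simp add: linear_iff wo_vec_def vec_eq_iff)

lemma bounded_linear_unwo_vec: "bounded_linear (unwo_vec :: real ^ 'n::finite wo \<Rightarrow> _)"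
  by (rule linear_conv_bounded_linear[THEN iffD1]) (simp add: linear_iff unwo_vec_def vec_eq_iff)

lemma measurable_wo_vec [measurable]: "wo_vec \<in> borel_measurable (borel :: (real ^ 'n::finite) measure)"
  by (intro borel_measurable_continuous_onI linear_continuous_on bounded_linear_wo_vec)

lemma measurable_unwo_vec [measurable]: "unwo_vec \<in> borel_measurable (borel :: (real ^ 'n::finite wo) measure)"
  by (intro borel_measurable_continuous_onI linear_continuous_on bounded_linear_unwo_vec)

lemma prod_Basis_vec: "(\<Prod>b\<in>Basis. (x :: real ^ 'n::finite) \<bullet> b) = (\<Prod>i\<in>UNIV. x $ i)"
proof -
  have B: "(Basis :: (real ^ 'n) set) = (\<lambda>i. axis i 1) ` UNIV"
    by (auto simp: Basis_vec_def)
  have "inj (\<lambda>i. axis i 1 :: real ^ 'n)"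
    by (auto simp: inj_def axis_eq_axis)
  then show ?thesis
    unfolding B by (subst prod.reindex) (auto simp: inner_axis)
qed

text \<open>Lebesgue measure is determined by boxes, and relabelling coordinates maps boxes to boxes
  with the same side lengths.\<close>

lemma lborel_wo_vec: "distr lborel borel wo_vec = (lborel :: (real ^ 'n::finite wo) measure)"
proof (rule lborel_eqI[symmetric])
  fix l u :: "real ^ 'n wo"
  assume le: "\<And>b. b \<in> Basis \<Longrightarrow> l \<bullet> b \<le> u \<bullet> b"
  have le': "l $ i \<le> u $ i" for i
    using le[of "axis i 1"] by (auto simp: Basis_vec_def inner_axis)
  have "wo_vec -` box l u = box (unwo_vec l) (unwo_vec u)"
  proof -
    have "x \<in> box (unwo_vec l) (unwo_vec u) \<longleftrightarrow> wo_vec x \<in> box l u" for x :: "real ^ 'n"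
    proof -
      have "(\<forall>k. P (Abs_wo k) k) \<longleftrightarrow> (\<forall>i. P i (Rep_wo i))" for P :: "'n wo \<Rightarrow> 'n \<Rightarrow> bool"
        by (metis Abs_wo_inverse Rep_wo_inverse UNIV_I)
      then show ?thesis
        by (simp add: mem_box_cart wo_vec_def unwo_vec_def)
    qed
    then show ?thesis by auto
  qed
  then have "emeasure (distr lborel borel wo_vec) (box l u) = emeasure lborel (box (unwo_vec l) (unwo_vec u))"
    by (subst emeasure_distr) auto
  also have "\<dots> = (\<Prod>b\<in>Basis. (unwo_vec u - unwo_vec l) \<bullet> b)"
    by (rule emeasure_lborel_box) (auto simp: Basis_vec_def inner_axis unwo_vec_def le')
  also have "(\<Prod>b\<in>Basis. (unwo_vec u - unwo_vec l) \<bullet> b) = (\<Prod>k\<in>UNIV. (u - l) $ Abs_wo k)"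
    unfolding prod_Basis_vec by (simp add: unwo_vec_def)
  also have "\<dots> = (\<Prod>i\<in>UNIV. (u - l) $ i)"
    by (rule prod.reindex_bij_witness[of _ Rep_wo Abs_wo]) (auto simp: Rep_wo_inverse Abs_wo_inverse)
  also have "\<dots> = (\<Prod>b\<in>Basis. (u - l) \<bullet> b)"
    by (rule prod_Basis_vec[symmetric])
  finally show "emeasure (distr lborel borel wo_vec) (box l u) = (\<Prod>b\<in>Basis. (u - l) \<bullet> b)" .
qed simp

lemma emeasure_wo_vec_image:
  assumes "B \<in> sets borel"
  shows "wo_vec ` B \<in> sets borel" "emeasure lborel (wo_vec ` B) = emeasure lborel (B :: (real ^ 'n::finite) set)"
proof -
  have e: "wo_vec ` B = unwo_vec -` B"
    by (auto simp: image_iff) (metis wo_unwo)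
  have "unwo_vec -` B \<inter> space borel \<in> sets borel"
    using measurable_unwo_vec assms by (rule measurable_sets)
  then show s: "wo_vec ` B \<in> sets borel"
    by (simp add: e)
  have "emeasure lborel (wo_vec ` B) = emeasure (distr lborel borel wo_vec) (wo_vec ` B)"
    by (simp add: lborel_wo_vec)
  also have "\<dots> = emeasure lborel (wo_vec -` wo_vec ` B)"
    using s by (subst emeasure_distr) auto
  also have "wo_vec -` wo_vec ` B = B"
    by (auto simp: image_iff) (metis unwo_wo)
  finally show "emeasure lborel (wo_vec ` B) = emeasure lborel B" .
qed

text \<open>Conjugation by the bijection of index types matches the permutations and preserves their
  signs.\<close>

lemma det_wo:
  fixes M :: "real ^ 'n::finite ^ 'n"
  shows "det (\<chi> i j. M $ Rep_wo i $ Rep_wo j) = det M"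
proof -
  let ?f = "map_permutation UNIV (Abs_wo :: 'n \<Rightarrow> 'n wo)"
  have inj: "inj (Abs_wo :: 'n \<Rightarrow> 'n wo)"
    by (auto simp: inj_def Abs_wo_inject)
  have bij: "bij (Abs_wo :: 'n \<Rightarrow> 'n wo)"
    using inj by (auto simp: bij_def) (metis Rep_wo_inverse rangeI)
  have inv: "inv Abs_wo i = Rep_wo i" for i :: "'n wo"
    by (metis Rep_wo_inverse inj inv_f_f)
  have f: "?f p i = Abs_wo (p (Rep_wo i))" for p i
    using bij by (simp add: map_permutation_def restrict_id_def inv bij_is_surj)
  have "det M = (\<Sum>p | p permutes UNIV. of_int (sign p) * (\<Prod>i\<in>UNIV. M $ i $ p i))"
    by (simp add: det_def)
  also have "\<dots> = (\<Sum>q | q permutes (UNIV :: 'n wo set). of_int (sign q) * (\<Prod>i\<in>UNIV. M $ Rep_wo i $ Rep_wo (q i)))"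
  proof (rule sum.reindex_bij_witness[of _ "\<lambda>q k. Rep_wo (q (Abs_wo k))" ?f])
    fix p :: "'n \<Rightarrow> 'n" assume "p \<in> {p. p permutes UNIV}"
    then have p: "p permutes UNIV" by simp
    show "(\<lambda>k. Rep_wo (?f p (Abs_wo k))) = p"
      by (simp add: f Abs_wo_inverse)
    show "?f p \<in> {q. q permutes UNIV}"
      using map_permutation_permutes[OF bij p] by simp
    have "(\<Prod>i\<in>UNIV. M $ Rep_wo i $ Rep_wo (?f p i)) = (\<Prod>i\<in>UNIV. M $ i $ p i)"
      by (rule prod.reindex_bij_witness[of _ Abs_wo Rep_wo]) (auto simp: f Abs_wo_inverse Rep_wo_inverse)
    then show "of_int (sign (?f p)) * (\<Prod>i\<in>UNIV. M $ Rep_wo i $ Rep_wo (?f p i)) = of_int (sign p) * (\<Prod>i\<in>UNIV. M $ i $ p i)"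
      using sign_map_permutation[OF inj p] by simp
  next
    fix q :: "'n wo \<Rightarrow> 'n wo" assume "q \<in> {q. q permutes UNIV}"
    then have q: "bij q" by (simp add: permutes_bij)
    show "?f (\<lambda>k. Rep_wo (q (Abs_wo k))) = q"
      by (simp add: f fun_eq_iff Rep_wo_inverse)
    have "bij (\<lambda>k. Rep_wo (q (Abs_wo k)))"
      using bij_comp[OF bij_comp[OF bij q] bij_Rep_wo] by (simp add: o_def)
    then show "(\<lambda>k. Rep_wo (q (Abs_wo k))) \<in> {p. p permutes UNIV}"
      by (auto intro!: bij_imp_permutes)
  qed
  finally show ?thesis
    by (simp add: det_def)
qed

text \<open>Extends the finite case to infinite values: if the integral were finite, the determinant
  would be integrable on \<open>S\<close> and the image would have finite measure.\<close>

lemma emeasure_image_wellorder: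
  fixes f :: "real ^ 'm::{finite,wellorder} \<Rightarrow> real ^ 'm::_"
  assumes S: "S \<in> sets borel" and fS: "f ` S \<in> sets borel"
    and der: "\<And>x. x \<in> S \<Longrightarrow> (f has_derivative f' x) (at x)" and inj: "inj_on f S"
    and meas: "(\<lambda>x. indicator S x * \<bar>det (matrix (f' x))\<bar>) \<in> borel_measurable borel"
  shows "emeasure lborel (f ` S) = (\<integral>\<^sup>+x. ennreal (indicator S x * \<bar>det (matrix (f' x))\<bar>) \<partial>lborel)"
proof -
  let ?D = "\<lambda>x. \<bar>det (matrix (f' x))\<bar>"
  have SL: "S \<in> sets lebesgue" using S by auto
  have der': "(f has_derivative f' x) (at x within S)" if "x \<in> S" for x
    using der[OF that] by (rule has_derivative_at_withinI)
  note M = has_measure_differentiable_image[OF SL der' inj]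
  have lm: "f ` S \<in> lmeasurable \<longleftrightarrow> emeasure lborel (f ` S) < \<infinity>"
    using fS by (auto simp: fmeasurable_def)
  show ?thesis
  proof (cases "f ` S \<in> lmeasurable")
    case True
    then have "(?D has_integral measure lebesgue (f ` S)) S"
      using M by blast
    then have "(\<integral>\<^sup>+x. ennreal (indicator S x * ?D x) \<partial>lborel) = ennreal (measure lebesgue (f ` S))"
      by (intro nn_integral_has_integral_lebesgue) auto
    also have "\<dots> = emeasure lebesgue (f ` S)"
      using True by (intro emeasure_eq_measure2[symmetric])
    finally show ?thesis
      using fS by simp
  next
    case False
    have "(\<integral>\<^sup>+x. ennreal (indicator S x * ?D x) \<partial>lborel) = \<infinity>"
    proof (rule ccontr)
      assume "\<not> ?thesis"
      then have "(\<integral>\<^sup>+x. ennreal (indicator S x * ?D x) \<partial>lborel) < \<infinity>"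
        by (simp add: less_top)
      then have "(\<lambda>x. indicator S x * ?D x) integrable_on UNIV"
        using meas by (intro nn_integral_integrable_on) auto
      moreover have "(\<lambda>x. indicator S x * ?D x) = (\<lambda>x. if x \<in> S then ?D x else 0)"
        by auto
      ultimately have "?D integrable_on S"
        by (simp add: integrable_restrict_UNIV)
      then show False
        using M False by (auto simp: integrable_on_def)
    qed
    then show ?thesis
      using False lm by (simp add: not_less top_unique)
  qed
qed

lemma emeasure_differentiable_image:
  fixes f :: "real ^ 'n::finite \<Rightarrow> real ^ 'n"
  assumes S: "S \<in> sets borel" and fS: "f ` S \<in> sets borel"
    and der: "\<And>x. x \<in> S \<Longrightarrow> (f has_derivative (\<lambda>v. M x *v v)) (at x)" and inj: "inj_on f S"
    and meas: "(\<lambda>x. indicator S x * \<bar>det (M x)\<bar>) \<in> borel_measurable borel"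
  shows "emeasure lborel (f ` S) = (\<integral>\<^sup>+x. ennreal (indicator S x * \<bar>det (M x)\<bar>) \<partial>lborel)"
proof -
  define F where "F y = wo_vec (f (unwo_vec y))" for y
  define F' where "F' y v = wo_vec (M (unwo_vec y) *v unwo_vec v)" for y v
  let ?S = "wo_vec ` S"
  have im: "F ` ?S = wo_vec ` (f ` S)"
    by (force simp: F_def)
  have det: "det (matrix (F' y)) = det (M (unwo_vec y))" for y
  proof -
    have ax: "unwo_vec (axis j 1) = (axis (Rep_wo j) 1 :: real ^ 'n)" for j :: "'n wo"
      by (auto simp: unwo_vec_def vec_eq_iff axis_def Abs_wo_inverse Rep_wo_inverse)
    have "matrix (F' y) = (\<chi> i j. M (unwo_vec y) $ Rep_wo i $ Rep_wo j)"
      by (simp add: matrix_def F'_def ax wo_vec_def matrix_vector_mult_basis column_def)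
    then show ?thesis by (simp add: det_wo)
  qed
  have mem: "y \<in> ?S \<longleftrightarrow> unwo_vec y \<in> S" for y
    by (metis image_iff unwo_wo wo_unwo)
  have ind: "indicator ?S y * \<bar>det (matrix (F' y))\<bar> = (\<lambda>x. indicator S x * \<bar>det (M x)\<bar>) (unwo_vec y)" for y
    by (simp add: det indicator_def mem)
  have "emeasure lborel (F ` ?S) = (\<integral>\<^sup>+y. ennreal (indicator ?S y * \<bar>det (matrix (F' y))\<bar>) \<partial>lborel)"
  proof (rule emeasure_image_wellorder)
    show "?S \<in> sets borel" using S by (rule emeasure_wo_vec_image)
    show "F ` ?S \<in> sets borel" unfolding im using fS by (rule emeasure_wo_vec_image)
    show "inj_on F ?S"
      using inj by (auto simp: inj_on_def F_def) (metis unwo_wo)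
    show "(F has_derivative F' y) (at y)" if "y \<in> ?S" for y
    proof -
      have "(f has_derivative (\<lambda>v. M (unwo_vec y) *v v)) (at (unwo_vec y))"
        using der that mem by blast
      moreover have "(unwo_vec has_derivative unwo_vec) (at y)"
        by (rule bounded_linear_imp_has_derivative[OF bounded_linear_unwo_vec])
      ultimately have "((f \<circ> unwo_vec) has_derivative ((\<lambda>v. M (unwo_vec y) *v v) \<circ> unwo_vec)) (at y)"
        by (intro diff_chain_at)
      from bounded_linear.has_derivative[OF bounded_linear_wo_vec this] show ?thesis
        by (simp add: F_def[abs_def] F'_def[abs_def])
    qed
    show "(\<lambda>y. indicator ?S y * \<bar>det (matrix (F' y))\<bar>) \<in> borel_measurable borel"
      unfolding ind by (rule measurable_compose[OF measurable_unwo_vec meas])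
  qed
  also have "\<dots> = (\<integral>\<^sup>+y. ennreal (indicator S (unwo_vec y) * \<bar>det (M (unwo_vec y))\<bar>) \<partial>distr lborel borel wo_vec)"
    unfolding ind by (simp add: lborel_wo_vec)
  also have "\<dots> = (\<integral>\<^sup>+x. ennreal (indicator S x * \<bar>det (M x)\<bar>) \<partial>lborel)"
    using measurable_compose[OF measurable_unwo_vec meas] by (subst nn_integral_distr) simp_all
  finally show ?thesis
    unfolding im using emeasure_wo_vec_image[OF fS] by simp
qed

section \<open>Change of variables for nonnegative integrals\<close>

lemma borel_measurable_if_continuous:
  fixes f :: "'a::topological_space \<Rightarrow> real"
  assumes "open U" "continuous_on U f"
  shows "(\<lambda>x. indicator U x * f x) \<in> borel_measurable borel"
  using borel_measurable_continuous_on_indicator[of U f] assms by simp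

text \<open>Equality of two measures: Lebesgue measure on \<open>V\<close> is the image of the
  measure with density the absolute determinant on \<open>U\<close>. Integrating \<open>h\<close>
  against both gives the formula.\<close>

lemma nn_integral_change_of_variables:
  fixes f :: "real ^ 'n::finite \<Rightarrow> real ^ 'n"
  assumes U: "open U" and V: "open V" and f: "f ` U = V" and inj: "inj_on f U"
    and der: "\<And>x. x \<in> U \<Longrightarrow> (f has_derivative (\<lambda>v. M x *v v)) (at x)"
    and M: "continuous_on U M" and h: "h \<in> borel_measurable borel"
  shows "(\<integral>\<^sup>+y. indicator V y * h y \<partial>lborel) = (\<integral>\<^sup>+x. indicator U x * (ennreal \<bar>det (M x)\<bar> * h (f x)) \<partial>lborel)"
proof -
  let ?d = "\<lambda>x. indicator U x * \<bar>det (M x)\<bar>"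
  \<comment> \<open>The cut-off makes the map Borel on the whole space; its value 0 off
    \<open>U\<close> carries no mass, since \<open>?d\<close> vanishes there.\<close>
  let ?f = "\<lambda>x. indicator U x *\<^sub>R f x"
  have cf: "continuous_on U f"
    using der by (meson U continuous_at_imp_continuous_on has_derivative_continuous)
  have cd: "continuous_on U (\<lambda>x. \<bar>det (M x)\<bar>)"
    unfolding det_def using M by (intro continuous_intros)
  have mf [measurable]: "?f \<in> borel_measurable borel"
    using U cf by (intro borel_measurable_continuous_on_indicator) auto
  have md [measurable]: "?d \<in> borel_measurable borel"
    by (rule borel_measurable_if_continuous[OF U cd])
  have Ub [measurable]: "U \<in> sets borel" and Vb [measurable]: "V \<in> sets borel" using U V by auto
  have "density lborel (indicator V) = distr (density lborel (\<lambda>x. ennreal (?d x))) borel ?f"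
  proof (rule measure_eqI)
    fix B assume "B \<in> sets (density lborel (indicator V :: real ^ 'n \<Rightarrow> ennreal))"
    then have B [measurable]: "B \<in> sets borel" by simp
    let ?S = "U \<inter> ?f -` B"
    have S [measurable]: "?S \<in> sets borel"
      using measurable_sets[OF mf B] by (auto intro: sets.Int)
    have fS: "f ` ?S = V \<inter> B" using f by auto
    have "emeasure (density lborel (indicator V)) B = emeasure lborel (V \<inter> B)"
      by (subst emeasure_density) (auto simp: indicator_inter_arith[symmetric] intro!: nn_integral_indicator[THEN trans])
    also have "\<dots> = emeasure lborel (f ` ?S)" by (simp only: fS)
    also have "\<dots> = (\<integral>\<^sup>+x. ennreal (indicator ?S x * \<bar>det (M x)\<bar>) \<partial>lborel)"
    proof (rule emeasure_differentiable_image[OF S])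
      show "f ` ?S \<in> sets borel" unfolding fS by measurable
      show "(f has_derivative (\<lambda>v. M x *v v)) (at x)" if "x \<in> ?S" for x using der that by blast
      show "inj_on f ?S" using inj by (rule inj_on_subset) auto
      have "(\<lambda>x. indicator ?S x * ?d x) \<in> borel_measurable borel" by measurable
      moreover have "(\<lambda>x. indicator ?S x * ?d x) = (\<lambda>x. indicator ?S x * \<bar>det (M x)\<bar>)"
        by (auto simp: indicator_def)
      ultimately show "(\<lambda>x. indicator ?S x * \<bar>det (M x)\<bar>) \<in> borel_measurable borel" by simp
    qed
    also have "\<dots> = (\<integral>\<^sup>+x. ennreal (?d x) * indicator (?f -` B) x \<partial>lborel)"
      by (intro nn_integral_cong) (auto simp: indicator_def)
    also have "\<dots> = emeasure (distr (density lborel (\<lambda>x. ennreal (?d x))) borel ?f) B"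
      using measurable_sets[OF mf B] by (subst emeasure_distr) (auto simp: emeasure_density)
    finally show "emeasure (density lborel (indicator V)) B = emeasure (distr (density lborel (\<lambda>x. ennreal (?d x))) borel ?f) B" .
  qed simp
  then have "(\<integral>\<^sup>+y. h y \<partial>density lborel (indicator V)) = (\<integral>\<^sup>+y. h y \<partial>distr (density lborel (\<lambda>x. ennreal (?d x))) borel ?f)"
    by simp
  moreover have "(\<integral>\<^sup>+y. h y \<partial>density lborel (indicator V)) = (\<integral>\<^sup>+y. indicator V y * h y \<partial>lborel)"
    using h by (subst nn_integral_density) auto
  moreover have "(\<integral>\<^sup>+y. h y \<partial>distr (density lborel (\<lambda>x. ennreal (?d x))) borel ?f) = (\<integral>\<^sup>+x. ennreal (?d x) * h (?f x) \<partial>lborel)"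
  proof -
    have hf: "(\<lambda>x. h (?f x)) \<in> borel_measurable borel"
      using measurable_compose[OF mf h] by simp
    have "(\<integral>\<^sup>+y. h y \<partial>distr (density lborel (\<lambda>x. ennreal (?d x))) borel ?f) = (\<integral>\<^sup>+x. h (?f x) \<partial>density lborel (\<lambda>x. ennreal (?d x)))"
      using h mf by (intro nn_integral_distr) auto
    also have "\<dots> = (\<integral>\<^sup>+x. ennreal (?d x) * h (?f x) \<partial>lborel)"
      using hf md by (intro nn_integral_density) auto
    finally show ?thesis .
  qed
  moreover have "(\<integral>\<^sup>+x. ennreal (?d x) * h (?f x) \<partial>lborel) = (\<integral>\<^sup>+x. indicator U x * (ennreal \<bar>det (M x)\<bar> * h (f x)) \<partial>lborel)"
    by (intro nn_integral_cong) (auto simp: indicator_def)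
  ultimately show ?thesis by simp
qed

section \<open>The Riemannian measure\<close>

context riemannian_manifold
begin

lemma chart_inj: "c \<in> A \<Longrightarrow> inj_on (snd c) (fst c)"
  by (rule inj_on_inverseI[where g = "chart_inv c"]) simp

definition vol :: "('a, 'n) chart \<Rightarrow> real ^ 'n \<Rightarrow> real" where
  "vol c x = sqrt (det (gm c x))"

lemma vol_pos: "c \<in> A \<Longrightarrow> x \<in> cdom c \<Longrightarrow> vol c x > 0"
  unfolding vol_def using local_metric.det_G_pos[OF local_metric_chart] by auto

lemma vol_continuous: "c \<in> A \<Longrightarrow> continuous_on (cdom c) (vol c)"
proof -
  assume c: "c \<in> A"
  interpret C: local_metric "cdom c" "gm c" by (rule local_metric_chart[OF c])
  show ?thesis
    unfolding vol_def by (intro continuous_on_real_sqrt smooth_on_continuous smooth_on_det C.openU C.smooth_G)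
qed

lemma vol_measurable: "c \<in> A \<Longrightarrow> (\<lambda>x. indicator (cdom c) x * vol c x) \<in> borel_measurable borel"
  by (intro borel_measurable_if_continuous cdom_open vol_continuous)

definition chart_measure :: "('a, 'n) chart \<Rightarrow> 'a measure" where
  "chart_measure c = distr (density (restrict_space lborel (cdom c)) (\<lambda>x. ennreal (vol c x))) borel (chart_inv c)"

lemma chart_inv_measurable: "c \<in> A \<Longrightarrow> chart_inv c \<in> borel_measurable (restrict_space lborel (cdom c))"
  using borel_measurable_continuous_on_restrict[OF chart_inv_continuous, of c]
  by (simp add: measurable_cong_sets[OF sets_restrict_space_cong[OF sets_lborel]])

lemma vol_measurable_restrict: "c \<in> A \<Longrightarrow> vol c \<in> borel_measurable (restrict_space lborel (cdom c))"
  using borel_measurable_continuous_on_restrict[OF vol_continuous, of c]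
  by (simp add: measurable_cong_sets[OF sets_restrict_space_cong[OF sets_lborel]])

lemma chart_image_measurable:
  assumes c: "c \<in> A" and B: "B \<in> sets borel"
  shows "snd c ` (B \<inter> fst c) \<in> sets borel"
proof -
  have e: "snd c ` (B \<inter> fst c) = chart_inv c -` B \<inter> space (restrict_space lborel (cdom c))"
    using c by (force simp: space_restrict_space)
  have "chart_inv c -` B \<inter> space (restrict_space lborel (cdom c)) \<in> sets (restrict_space lborel (cdom c))"
    by (rule measurable_sets[OF chart_inv_measurable[OF c] B])
  then show ?thesis
    unfolding e using cdom_open[OF c] by (subst (asm) sets_restrict_space_iff) auto
qed

lemma sets_chart_measure [simp]: "sets (chart_measure c) = sets borel"
  by (simp add: chart_measure_def)

lemma nn_integral_chart_measure:
  assumes c: "c \<in> A" and f: "f \<in> borel_measurable borel"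
  shows "(\<integral>\<^sup>+p. f p \<partial>chart_measure c) = (\<integral>\<^sup>+x. ennreal (vol c x) * f (chart_inv c x) * indicator (cdom c) x \<partial>lborel)"
proof -
  have fc: "(\<lambda>x. f (chart_inv c x)) \<in> borel_measurable (restrict_space lborel (cdom c))"
    by (rule measurable_compose[OF chart_inv_measurable[OF c] f])
  have "(\<integral>\<^sup>+p. f p \<partial>chart_measure c) = (\<integral>\<^sup>+x. f (chart_inv c x) \<partial>density (restrict_space lborel (cdom c)) (\<lambda>x. ennreal (vol c x)))"
    unfolding chart_measure_def using f chart_inv_measurable[OF c] by (intro nn_integral_distr) auto
  also have "\<dots> = (\<integral>\<^sup>+x. ennreal (vol c x) * f (chart_inv c x) \<partial>restrict_space lborel (cdom c))"
    using fc vol_measurable_restrict[OF c] by (intro nn_integral_density) auto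
  also have "\<dots> = (\<integral>\<^sup>+x. ennreal (vol c x) * f (chart_inv c x) * indicator (cdom c) x \<partial>lborel)"
    using cdom_open[OF c] by (intro nn_integral_restrict_space) auto
  finally show ?thesis .
qed

lemma emeasure_chart_measure:
  assumes c: "c \<in> A" and B: "B \<in> sets borel"
  shows "emeasure (chart_measure c) B = (\<integral>\<^sup>+x\<in>snd c ` (B \<inter> fst c). ennreal (vol c x) \<partial>lborel)"
proof -
  have "emeasure (chart_measure c) B = (\<integral>\<^sup>+p. indicator B p \<partial>chart_measure c)"
    using B by simp
  also have "\<dots> = (\<integral>\<^sup>+x. ennreal (vol c x) * indicator B (chart_inv c x) * indicator (cdom c) x \<partial>lborel)"
    using B by (intro nn_integral_chart_measure[OF c]) auto
  also have "\<dots> = (\<integral>\<^sup>+x\<in>snd c ` (B \<inter> fst c). ennreal (vol c x) \<partial>lborel)"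
  proof (intro nn_integral_cong)
    fix x
    have "x \<in> snd c ` (B \<inter> fst c) \<longleftrightarrow> x \<in> cdom c \<and> chart_inv c x \<in> B"
      using c by force
    then show "ennreal (vol c x) * indicator B (chart_inv c x) * indicator (cdom c) x
        = ennreal (vol c x) * indicator (snd c ` (B \<inter> fst c)) x"
      by (auto simp: indicator_def)
  qed
  finally show ?thesis .
qed

text \<open>Determinants in \<open>gm_transform\<close>; the root of the squared Jacobian gives an
  absolute value, which is why no orientation enters.\<close>

lemma vol_transform:
  assumes "c \<in> A" "d \<in> A" "x \<in> overlap c d"
  shows "vol c x = \<bar>det (jac c d x)\<bar> * vol d (transition c d x)"
proof -
  obtain p where p: "x = snd c p" "c \<in> charts_at A p" "d \<in> charts_at A p"
    using assms by (auto simp: overlap_def charts_at_iff)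
  have "det (gm c x) = (det (jac c d x))\<^sup>2 * det (gm d (transition c d x))"
    using arg_cong[OF gm_transform[OF p(2,3)], of det] p assms
    by (simp add: det_mul det_transpose power2_eq_square charts_at_iff)
  then show ?thesis
    by (simp add: vol_def real_sqrt_mult real_sqrt_abs)
qed

text \<open>The Jacobian in the transformation of the densities is the one in the change of
  variables.\<close>

lemma chart_measure_overlap:
  assumes c: "c \<in> A" and d: "d \<in> A" and B: "B \<in> sets borel" "B \<subseteq> fst c" "B \<subseteq> fst d"
  shows "emeasure (chart_measure c) B = emeasure (chart_measure d) B"
proof -
  let ?t = "transition c d" and ?U = "overlap c d" and ?V = "overlap d c"
  let ?h = "\<lambda>y. ennreal (indicator (cdom d) y * vol d y) * indicator (snd d ` B) y"
  have Bd: "snd d ` B \<in> sets borel"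
    using chart_image_measurable[OF d B(1)] B(3) by (simp add: Int_absorb2)
  have "(\<integral>\<^sup>+y. indicator ?V y * ?h y \<partial>lborel) = (\<integral>\<^sup>+x. indicator ?U x * (ennreal \<bar>det (jac c d x)\<bar> * ?h (?t x)) \<partial>lborel)"
  proof (rule nn_integral_change_of_variables[OF overlap_open[OF c d] overlap_open[OF d c]])
    show "?t ` ?U = ?V"
    proof -
      have "y \<in> ?t ` ?U" if y: "y \<in> ?V" for y
      proof -
        obtain p where p: "y = snd d p" "p \<in> fst c" "p \<in> fst d" using y by (auto simp: overlap_def)
        then have "y = ?t (snd c p)" using c by simp
        then show ?thesis using overlapI[OF p(2,3)] by blast
      qed
      then show ?thesis using transition_in[OF c] by blast
    qed
    show "inj_on ?t ?U"
      using c d by (auto simp: inj_on_def overlap_def) (metis chart_inv_left)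
    show "(?t has_derivative (\<lambda>v. jac c d x *v v)) (at x)" if "x \<in> ?U" for x
      by (rule transition_has_derivative[OF c d that])
    show "continuous_on ?U (jac c d)"
      by (rule smooth_on_continuous[OF jac_smooth[OF c d]])
    show "?h \<in> borel_measurable borel"
      using vol_measurable[OF d] Bd by measurable
  qed
  moreover have "indicator ?V y * ?h y = ennreal (vol d y) * indicator (snd d ` (B \<inter> fst d)) y" for y
    using B by (auto simp: indicator_def overlap_def)
  moreover have "indicator ?U x * (ennreal \<bar>det (jac c d x)\<bar> * ?h (?t x)) = ennreal (vol c x) * indicator (snd c ` (B \<inter> fst c)) x" for x
  proof (cases "x \<in> ?U")
    case True
    then obtain p where p: "x = snd c p" "p \<in> fst c" "p \<in> fst d" by (auto simp: overlap_def)
    have "snd d p \<in> snd d ` B \<longleftrightarrow> p \<in> B"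
      using inj_on_image_mem_iff[OF chart_inj[OF d] p(3) B(3)] by blast
    moreover have "snd c p \<in> snd c ` B \<longleftrightarrow> p \<in> B"
      using inj_on_image_mem_iff[OF chart_inj[OF c] p(2) B(2)] by blast
    ultimately show ?thesis
      using True vol_transform[OF c d True] p c d B vol_pos[OF d, of "snd d p"]
      by (auto simp: indicator_def Int_absorb2 ennreal_mult)
  next
    case False
    then show ?thesis using B by (auto simp: indicator_def overlap_def)
  qed
  ultimately show ?thesis
    by (simp add: emeasure_chart_measure[OF c B(1)] emeasure_chart_measure[OF d B(1)])
qed

section \<open>Existence and uniqueness of the Riemannian measure\<close>

definition volume_measure :: "'a measure \<Rightarrow> bool" where
  "volume_measure \<mu> \<longleftrightarrow> sets \<mu> = sets borel \<and>
     (\<forall>c\<in>A. \<forall>B\<in>sets borel. B \<subseteq> fst c \<longrightarrow> emeasure \<mu> B = emeasure (chart_measure c) B)"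

lemma riemannian_measure_alt: "riemannian_measure A g = (THE \<mu>. volume_measure \<mu>)"
proof -
  have "emeasure (chart_measure c) B = (\<integral>\<^sup>+x\<in>snd c ` B. ennreal (sqrt (det (gram A g c (chart_inv c x)))) \<partial>lborel)"
    if "c \<in> A" "B \<in> sets borel" "B \<subseteq> fst c" for c B
    using emeasure_chart_measure[OF that(1,2)] that(3) by (simp add: vol_def gm_def Int_absorb2)
  then have "volume_measure = (\<lambda>\<mu>. sets \<mu> = sets borel \<and>
     (\<forall>c\<in>A. \<forall>B\<in>sets borel. B \<subseteq> fst c \<longrightarrow> emeasure \<mu> B =
        (\<integral>\<^sup>+x\<in>snd c ` B. ennreal (sqrt (det (gram A g c (chart_inv c x)))) \<partial>lborel)))"
    unfolding volume_measure_def by (intro ext) (metis (no_types, lifting))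
  then show ?thesis
    unfolding riemannian_measure_def by simp
qed

lemma finite_chart_cover:
  assumes "compact (UNIV :: 'a set)"
  shows "\<exists>(e :: nat \<Rightarrow> ('a, 'n) chart) N. (\<forall>k<N. e k \<in> A) \<and> (\<Union>k<N. fst (e k)) = UNIV"
proof -
  have "UNIV \<subseteq> (\<Union>c\<in>A. fst c)"
    using atlas by (auto simp: smooth_atlas_def)
  then obtain C where C: "C \<subseteq> A" "finite C" "UNIV \<subseteq> (\<Union>c\<in>C. fst c)"
    using compactE_image[OF assms, of A fst] chart_open by metis
  obtain e :: "nat \<Rightarrow> ('a, 'n) chart" and N where e: "C = e ` {k. k < N}"
    using finite_imp_nat_seg_image_inj_on[OF C(2)] by metis
  have "e k \<in> A" if "k < N" for k
    using C(1) e that by blast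
  moreover have "(\<Union>k<N. fst (e k)) = UNIV"
    using C(3) e by auto
  ultimately show ?thesis by blast
qed

text \<open>A finite chart cover is cut into disjoint Borel pieces. A volume measure is prescribed
  on each piece, hence unique, and the sum of the chart measures over the pieces is one because
  chart measures agree on overlaps.\<close>

lemma volume_measure_ex1:
  assumes "compact (UNIV :: 'a set)"
  shows "\<exists>!\<mu>. volume_measure \<mu>"
proof -
  obtain e :: "nat \<Rightarrow> ('a, 'n) chart" and N where e: "\<And>k. k < N \<Longrightarrow> e k \<in> A" and cov: "(\<Union>k<N. fst (e k)) = UNIV"
    using finite_chart_cover[OF assms] by blast
  \<comment> \<open>Each chart domain minus the earlier ones, so a point lies in the piece of the
    first chart that contains it.\<close>
  define P where "P k = fst (e k) - (\<Union>j<k. fst (e j))" for k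
  have P: "P k \<in> sets borel" if "k < N" for k
    unfolding P_def using e that chart_open by (intro sets.Diff borel_open open_UN) auto
  have dis: "disjoint_family_on P {..<N}"
  proof -
    have "P m \<inter> P n = {}" if "m < n" for m n
      using that by (auto simp: P_def)
    then show ?thesis
      unfolding disjoint_family_on_def by (metis Int_commute linorder_neqE_nat)
  qed
  have union: "(\<Union>k<N. P k) = UNIV"
  proof -
    have "q \<in> (\<Union>k<N. P k)" for q
    proof -
      have ex: "\<exists>k. q \<in> fst (e k) \<and> k < N" using cov by blast
      define k where "k = (LEAST k. q \<in> fst (e k) \<and> k < N)"
      have k: "q \<in> fst (e k)" "k < N" unfolding k_def using LeastI_ex[OF ex] by auto
      have "q \<notin> fst (e j)" if "j < k" for j
        using not_less_Least[of j "\<lambda>k. q \<in> fst (e k) \<and> k < N"] that k unfolding k_def by auto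
      then show ?thesis using k by (auto simp: P_def)
    qed
    then show ?thesis by blast
  qed
  have split: "emeasure \<mu> B = (\<Sum>k<N. emeasure \<mu> (B \<inter> P k))" if "sets \<mu> = sets borel" "B \<in> sets borel" for \<mu> B
  proof -
    have "(\<Sum>k<N. emeasure \<mu> (B \<inter> P k)) = emeasure \<mu> (\<Union>k<N. B \<inter> P k)"
    proof (rule sum_emeasure)
      show "disjoint_family_on (\<lambda>k. B \<inter> P k) {..<N}"
        using dis unfolding disjoint_family_on_def by blast
    qed (use that P in auto)
    moreover have "(\<Union>k<N. B \<inter> P k) = B" using union by auto
    ultimately show ?thesis by simp
  qed
  define f where "f B = (\<Sum>k<N. emeasure (chart_measure (e k)) (B \<inter> P k))" for B
  define \<mu> where "\<mu> = measure_of UNIV (sets borel) f"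
  have sets_mu: "sets \<mu> = sets borel"
    unfolding \<mu>_def using sets.sigma_sets_eq[of borel] by (simp add: sets_measure_of_conv)
  have em: "emeasure \<mu> B = f B" if "B \<in> sets borel" for B
  proof (rule emeasure_measure_of[OF \<mu>_def])
    show "sets borel \<subseteq> Pow (UNIV :: 'a set)" by simp
    show "B \<in> sets \<mu>" using that sets_mu by simp
    show "positive (sets \<mu>) f" by (simp add: positive_def f_def)
    show "countably_additive (sets \<mu>) f"
      unfolding countably_additive_def
    proof (intro allI impI)
      fix X :: "nat \<Rightarrow> 'a set" assume X: "range X \<subseteq> sets \<mu>" "disjoint_family X" "\<Union> (range X) \<in> sets \<mu>"
      have "(\<Sum>i. emeasure (chart_measure (e k)) (X i \<inter> P k)) = emeasure (chart_measure (e k)) (\<Union> (range X) \<inter> P k)" if "k < N" for k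
      proof -
        have "(\<Sum>i. emeasure (chart_measure (e k)) (X i \<inter> P k)) = emeasure (chart_measure (e k)) (\<Union>i. X i \<inter> P k)"
          using X P[OF that] sets_mu by (intro suminf_emeasure) (auto simp: disjoint_family_on_def)
        then show ?thesis by simp
      qed
      then show "(\<Sum>i. f (X i)) = f (\<Union> (range X))"
        unfolding f_def by (subst suminf_sum) auto
    qed
  qed
  have "volume_measure \<mu>"
    unfolding volume_measure_def
  proof (intro conjI ballI impI sets_mu)
    fix c B assume c: "c \<in> A" and B: "B \<in> sets borel" "B \<subseteq> fst c"
    have "emeasure (chart_measure (e k)) (B \<inter> P k) = emeasure (chart_measure c) (B \<inter> P k)" if "k < N" for k
      using B P[OF that] by (intro chart_measure_overlap e[OF that] c) (auto simp: P_def)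
    then have "f B = (\<Sum>k<N. emeasure (chart_measure c) (B \<inter> P k))"
      by (simp add: f_def)
    then show "emeasure \<mu> B = emeasure (chart_measure c) B"
      using em[OF B(1)] split[OF sets_chart_measure B(1)] by simp
  qed
  moreover have "\<nu> = \<mu>" if nu: "volume_measure \<nu>" for \<nu>
  proof (rule measure_eqI)
    show sn: "sets \<nu> = sets \<mu>" using nu sets_mu by (simp add: volume_measure_def)
    fix B assume "B \<in> sets \<nu>"
    then have B: "B \<in> sets borel" using sn sets_mu by simp
    have "emeasure \<nu> (B \<inter> P k) = emeasure (chart_measure (e k)) (B \<inter> P k)" if "k < N" for k
    proof -
      have "B \<inter> P k \<in> sets borel" "B \<inter> P k \<subseteq> fst (e k)"
        using B P[OF that] by (auto simp: P_def)
      then show ?thesis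
        using nu e[OF that] unfolding volume_measure_def by blast
    qed
    then show "emeasure \<nu> B = emeasure \<mu> B"
      using split[of \<nu> B] sn sets_mu B em[OF B] by (simp add: f_def)
  qed
  ultimately show ?thesis by blast
qed

lemma riemannian_measure_volume:
  "compact (UNIV :: 'a set) \<Longrightarrow> volume_measure (riemannian_measure A g)"
  unfolding riemannian_measure_alt by (rule theI'[OF volume_measure_ex1])

lemma integral_riemannian_measure_chart:
  fixes h :: "'a \<Rightarrow> real"
  assumes comp: "compact (UNIV :: 'a set)" and c: "c \<in> A" and h: "h \<in> borel_measurable borel"
    and supp: "\<And>p. p \<notin> fst c \<Longrightarrow> h p = 0"
  shows "integrable (riemannian_measure A g) h \<longleftrightarrow> integrable lborel (\<lambda>x. indicator (cdom c) x * (vol c x * h (chart_inv c x)))"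
    and "integral\<^sup>L (riemannian_measure A g) h = integral\<^sup>L lborel (\<lambda>x. indicator (cdom c) x * (vol c x * h (chart_inv c x)))"
proof -
  let ?\<mu> = "riemannian_measure A g"
  have mu: "sets ?\<mu> = sets borel" "\<And>B. B \<in> sets borel \<Longrightarrow> B \<subseteq> fst c \<Longrightarrow> emeasure ?\<mu> B = emeasure (chart_measure c) B"
    using riemannian_measure_volume[OF comp] c by (auto simp: volume_measure_def)
  have fc: "fst c \<in> sets borel" using chart_open[OF c] by auto
  \<comment> \<open>On one chart domain the Riemannian measure is the chart measure, so integrals of
    functions vanishing off the domain become Lebesgue integrals.\<close>
  have "density ?\<mu> (indicator (fst c)) = chart_measure c"
  proof (rule measure_eqI)
    fix B assume "B \<in> sets (density ?\<mu> (indicator (fst c) :: 'a \<Rightarrow> ennreal))"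
    then have B: "B \<in> sets borel" by (simp add: mu)
    have "emeasure (density ?\<mu> (indicator (fst c))) B = emeasure ?\<mu> (fst c \<inter> B)"
      using B fc by (subst emeasure_density)
        (auto simp: mu(1) indicator_inter_arith[symmetric] measurable_cong_sets[OF mu(1)] intro!: nn_integral_indicator[THEN trans])
    also have "\<dots> = emeasure (chart_measure c) (fst c \<inter> B)"
      using B fc by (intro mu) auto
    also have "\<dots> = emeasure (chart_measure c) B"
    proof -
      have "fst c \<inter> B \<inter> fst c = B \<inter> fst c" by blast
      then show ?thesis
        using B fc by (simp add: emeasure_chart_measure[OF c])
    qed
    finally show "emeasure (density ?\<mu> (indicator (fst c))) B = emeasure (chart_measure c) B" .
  qed (simp add: mu)
  then have cm: "chart_measure c = density ?\<mu> (\<lambda>p. ennreal (indicator (fst c) p))"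
    by (simp add: ennreal_indicator)
  have hm: "h \<in> borel_measurable ?\<mu>" "(indicator (fst c) :: 'a \<Rightarrow> real) \<in> borel_measurable ?\<mu>"
    using h fc by (auto simp: measurable_cong_sets[OF mu(1)] mu(1))
  have h1: "(\<lambda>p. indicator (fst c) p *\<^sub>R h p) = h"
    using supp by (auto simp: indicator_def fun_eq_iff)
  let ?R = "restrict_space lborel (cdom c)"
  have m: "chart_inv c \<in> measurable (density ?R (\<lambda>x. ennreal (vol c x))) borel"
    using chart_inv_measurable[OF c] by simp
  have hc: "(\<lambda>x. h (chart_inv c x)) \<in> borel_measurable ?R"
    by (rule measurable_compose[OF chart_inv_measurable[OF c] h])
  have nn: "AE x in ?R. 0 \<le> vol c x"
    using vol_pos[OF c] by (intro AE_I2) (auto simp: space_restrict_space intro: less_imp_le)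
  have om: "cdom c \<inter> space lborel \<in> sets lborel"
    using cdom_open[OF c] by simp
  show "integrable ?\<mu> h \<longleftrightarrow> integrable lborel (\<lambda>x. indicator (cdom c) x * (vol c x * h (chart_inv c x)))"
  proof -
    have "integrable ?\<mu> h \<longleftrightarrow> integrable (chart_measure c) h"
      unfolding cm using integrable_density[OF hm AE_I2] h1 by simp
    also have "\<dots> \<longleftrightarrow> integrable (density ?R (\<lambda>x. ennreal (vol c x))) (\<lambda>x. h (chart_inv c x))"
      unfolding chart_measure_def by (rule integrable_distr_eq[OF m h])
    also have "\<dots> \<longleftrightarrow> integrable ?R (\<lambda>x. vol c x *\<^sub>R h (chart_inv c x))"
      by (rule integrable_density[OF hc vol_measurable_restrict[OF c] nn])
    also have "\<dots> \<longleftrightarrow> integrable lborel (\<lambda>x. indicator (cdom c) x * (vol c x * h (chart_inv c x)))"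
      using integrable_restrict_space[OF om, of "\<lambda>x. vol c x *\<^sub>R h (chart_inv c x)"] by simp
    finally show ?thesis .
  qed
  show "integral\<^sup>L ?\<mu> h = integral\<^sup>L lborel (\<lambda>x. indicator (cdom c) x * (vol c x * h (chart_inv c x)))"
  proof -
    have "integral\<^sup>L ?\<mu> h = integral\<^sup>L (chart_measure c) h"
      unfolding cm using integral_density[OF hm AE_I2] h1 by simp
    also have "\<dots> = integral\<^sup>L (density ?R (\<lambda>x. ennreal (vol c x))) (\<lambda>x. h (chart_inv c x))"
      unfolding chart_measure_def by (rule integral_distr[OF m h])
    also have "\<dots> = integral\<^sup>L ?R (\<lambda>x. vol c x *\<^sub>R h (chart_inv c x))"
      by (rule integral_density[OF hc vol_measurable_restrict[OF c] nn])
    also have "\<dots> = integral\<^sup>L lborel (\<lambda>x. indicator (cdom c) x * (vol c x * h (chart_inv c x)))"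
      using integral_restrict_space[OF om, of "\<lambda>x. vol c x *\<^sub>R h (chart_inv c x)"] by simp
    finally show ?thesis .
  qed
qed

end

section \<open>The divergence theorem\<close>

lemma pd_zero_open:
  assumes "open S" "x \<in> S" "\<And>y. y \<in> S \<Longrightarrow> f y = 0"
  shows "pd i f x = 0" "f differentiable (at x)"
proof -
  show "pd i f x = 0"
    using pd_cong[OF assms(1,2), of f "\<lambda>y. 0" i] assms(3) by simp
  have "(f has_derivative (\<lambda>v. 0)) (at x)"
    using assms by (intro has_derivative_transform_within_open[of "\<lambda>y. 0" "\<lambda>v. 0" x UNIV S f]) auto
  then show "f differentiable (at x)"
    by (auto simp: differentiable_def)
qed

text \<open>The difference quotients of a compactly supported function have integral zero by translation
  invariance; dominated convergence passes this to the partial derivatives.\<close>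

lemma integral_pd_zero:
  fixes F :: "real ^ 'n::finite \<Rightarrow> real"
  assumes d: "\<And>x. F differentiable (at x)" and c: "continuous_on UNIV (pd i F)"
    and supp: "\<And>x. x \<notin> cball 0 R \<Longrightarrow> F x = 0"
  shows "integrable lborel (pd i F)" "integral\<^sup>L lborel (pd i F) = 0"
proof -
  let ?e = "axis i 1 :: real ^ 'n"
  have pd0: "pd i F x = 0" if "x \<notin> cball 0 R" for x
    using that supp by (intro pd_zero_open(1)[of "- cball 0 R"]) (auto simp: open_Compl)
  have ext: "(\<lambda>x. indicator (cball 0 R) x *\<^sub>R f x) = f" if "\<And>x. x \<notin> cball 0 R \<Longrightarrow> f x = 0" for f :: "real ^ 'n \<Rightarrow> real"
    using that by (auto simp: fun_eq_iff indicator_def)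
  have int: "integrable lborel f" if "continuous_on UNIV f" "\<And>x. x \<notin> cball 0 R \<Longrightarrow> f x = 0" for f :: "real ^ 'n \<Rightarrow> real"
    using borel_integrable_compact[of "cball 0 R" f] that ext[OF that(2)] by (auto intro: continuous_on_subset)
  show I: "integrable lborel (pd i F)"
    by (rule int[OF c pd0])
  have cF: "continuous_on UNIV F"
    using d by (simp add: continuous_at_imp_continuous_on differentiable_imp_continuous_within)
  have IF: "integrable lborel F"
    by (rule int[OF cF supp])
  obtain C where C: "C \<ge> 0" "\<And>x. \<bar>pd i F x\<bar> \<le> C"
  proof -
    have "bounded (pd i F ` cball 0 R)"
      using c by (intro compact_imp_bounded compact_continuous_image) (auto intro: continuous_on_subset)
    then obtain C where "\<And>x. x \<in> cball 0 R \<Longrightarrow> \<bar>pd i F x\<bar> \<le> C"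
      unfolding bounded_iff real_norm_def by blast
    then have "\<bar>pd i F x\<bar> \<le> max C 0" for x
      using pd0[of x] by (cases "x \<in> cball 0 R") (auto simp: le_max_iff_disj)
    then show ?thesis using that[of "max C 0"] by simp
  qed
  define h where "h n = inverse (real (Suc n))" for n
  have h: "0 < h n" "h n \<le> 1" for n
    by (auto simp: h_def field_simps)
  define q where "q n x = (F (x + h n *\<^sub>R ?e) - F x) / h n" for n x
  have line: "((\<lambda>s. F (x + s *\<^sub>R ?e)) has_real_derivative pd i F (x + s *\<^sub>R ?e)) (at s)" for x s
    by (rule has_real_derivative_line[OF d])
  have lim: "(\<lambda>n. q n x) \<longlonglongrightarrow> pd i F x" for x
  proof -
    have "((\<lambda>s. (F (x + s *\<^sub>R ?e) - F x) / s) \<longlongrightarrow> pd i F x) (at 0)"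
      using line[of x 0] by (simp add: DERIV_def)
    moreover have "filterlim h (at 0) sequentially"
      unfolding filterlim_at using LIMSEQ_inverse_real_of_nat h(1) by (auto simp: h_def[abs_def])
    ultimately show ?thesis
      unfolding q_def by (rule filterlim_compose)
  qed
  \<comment> \<open>By the mean value theorem a difference quotient is a value of the derivative.
    Step sizes are at most 1, so all quotients vanish outside the ball of radius R + 1.\<close>
  have bound: "norm (q n x) \<le> C * indicator (cball 0 (R + 1)) x" for n x
  proof (cases "x \<in> cball 0 (R + 1)")
    case True
    obtain s where s: "F (x + h n *\<^sub>R ?e) - F (x + 0 *\<^sub>R ?e) = (h n - 0) * pd i F (x + s *\<^sub>R ?e)"
      using MVT2[OF h(1)[of n], of "\<lambda>s. F (x + s *\<^sub>R ?e)" "\<lambda>s. pd i F (x + s *\<^sub>R ?e)"] line by blast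
    then have "q n x = pd i F (x + s *\<^sub>R ?e)"
      using h(1)[of n] by (simp add: q_def)
    then show ?thesis using C(2) True by simp
  next
    case False
    have "norm x \<le> norm (x + h n *\<^sub>R ?e) + norm (h n *\<^sub>R ?e)"
      using norm_triangle_ineq4[of "x + h n *\<^sub>R ?e" "h n *\<^sub>R ?e"] by simp
    then have "x + h n *\<^sub>R ?e \<notin> cball 0 R" "x \<notin> cball 0 R"
      using False h[of n] by auto
    then have "q n x = 0" using supp by (simp add: q_def)
    then show ?thesis using C by (simp add: indicator_def)
  qed
  have shift: "integrable lborel (\<lambda>x. F (x + v))" "integral\<^sup>L lborel (\<lambda>x. F (x + v)) = integral\<^sup>L lborel F" for v
  proof -
    have Fm: "F \<in> borel_measurable borel" using cF by (rule borel_measurable_continuous_onI)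
    have m: "(+) v \<in> measurable lborel borel" by simp
    show "integrable lborel (\<lambda>x. F (x + v))"
      using integrable_distr_eq[OF m Fm] IF by (simp add: lborel_distr_plus add.commute)
    show "integral\<^sup>L lborel (\<lambda>x. F (x + v)) = integral\<^sup>L lborel F"
      using integral_distr[OF m Fm] by (simp add: lborel_distr_plus add.commute)
  qed
  have q0: "integral\<^sup>L lborel (q n) = 0" for n
    unfolding q_def using shift IF by simp
  have "(\<lambda>n. integral\<^sup>L lborel (q n)) \<longlonglongrightarrow> integral\<^sup>L lborel (pd i F)"
  proof (rule integral_dominated_convergence)
    show "pd i F \<in> borel_measurable lborel" using I by simp
    show "q n \<in> borel_measurable lborel" for n
      unfolding q_def using shift IF by (intro borel_measurable_divide borel_measurable_diff) auto
    show "integrable lborel (\<lambda>x :: real ^ 'n. C * indicator (cball 0 (R + 1)) x)"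
      using emeasure_bounded_finite[of "cball 0 (R + 1) :: (real ^ 'n) set"]
      by (intro integrable_mult_right integrable_real_indicator) auto
    show "AE x in lborel. (\<lambda>n. q n x) \<longlonglongrightarrow> pd i F x" using lim by simp
    show "AE x in lborel. norm (q n x) \<le> C * indicator (cball 0 (R + 1)) x" for n using bound by simp
  qed
  then show "integral\<^sup>L lborel (pd i F) = 0"
    using q0 LIMSEQ_unique[OF tendsto_const[of 0]] by simp
qed

context local_metric
begin

lemma dvg_scaleR:
  assumes "f differentiable (at x)" "Z differentiable (at x)"
  shows "dvg (\<lambda>x. f x *\<^sub>R Z x) x = f x * dvg Z x + (\<Sum>i\<in>UNIV. Z x $ i * pd i f x)"
  by (simp add: dvg_def nab_def pd_scaleR[OF assms] matrix_vector_simps sum.distrib sum_distrib_left algebra_simps)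

end

context riemannian_manifold
begin

text \<open>By \<open>dvg_sqrt_det\<close> the divergence times the density is a sum of partial
  derivatives of compactly supported functions on R^n.\<close>

lemma integral_divergence_chart:
  assumes comp: "compact (UNIV :: 'a set)" and c: "c \<in> A" and K: "cball a r \<subseteq> cdom c"
    and X: "smooth_on (cdom c) X" and supp: "\<And>x. x \<in> cdom c \<Longrightarrow> x \<notin> cball a r \<Longrightarrow> X x = 0"
  defines "D \<equiv> \<lambda>p. if p \<in> fst c then local_metric.dvg (gm c) X (snd c p) else 0"
  shows "integrable (riemannian_measure A g) D" "integral\<^sup>L (riemannian_measure A g) D = 0"
proof -
  interpret C: local_metric "cdom c" "gm c" by (rule local_metric_chart[OF c])
  let ?U = "cdom c"
  define F where "F i x = indicator ?U x * (vol c x * X x $ i)" for i x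
  have oK: "open (- cball a r)" by (simp add: open_Compl)
  \<comment> \<open>Two open sets cover R^n: on the first \<open>F i\<close> is differentiable with
    continuous partial derivatives, on the second it is 0, so the extension by zero is regular
    everywhere.\<close>
  have un: "UNIV = ?U \<union> - cball a r" using K by blast
  have F0: "F i x = 0" if "x \<in> - cball a r" for i x
    using that supp by (auto simp: F_def indicator_def)
  have dX: "(\<lambda>x. X x $ i) differentiable (at x)" if "x \<in> ?U" for i x
    by (intro differentiable_vec_nth C.differentiable[OF X that])
  have FU: "pd j (F i) x = pd j (\<lambda>x. sqrt (det (gm c x)) * X x $ i) x" if "x \<in> ?U" for i j x
    by (rule pd_cong[OF C.openU that]) (simp add: F_def vol_def)
  have dF: "F i differentiable (at x)" for i x
  proof (cases "x \<in> ?U")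
    case True
    have "(\<lambda>x. sqrt (det (gm c x)) * X x $ i) differentiable (at x)"
      using C.pd_sqrt_det(2)[OF True] dX[OF True] by (rule differentiable_mult)
    then obtain f' where f': "((\<lambda>x. sqrt (det (gm c x)) * X x $ i) has_derivative f') (at x)"
      by (auto simp: differentiable_def)
    have "(F i has_derivative f') (at x)"
      by (rule has_derivative_transform_within_open[OF f' C.openU True]) (simp add: F_def vol_def)
    then show ?thesis by (auto simp: differentiable_def)
  next
    case False
    then show ?thesis using un F0 by (intro pd_zero_open(2)[OF oK]) auto
  qed
  have cF: "continuous_on UNIV (pd j (F i))" for i j
    unfolding un
  proof (rule continuous_on_open_Un[OF C.openU oK])
    have "continuous_on ?U (\<lambda>x. vol c x * (\<Sum>k\<in>UNIV. C.Gam k x $ k $ j) * X x $ i + vol c x * pd j X x $ i)"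
      by (intro continuous_on_add continuous_on_mult continuous_on_sum vol_continuous[OF c] smooth_on_continuous
        smooth_intros C.smooth_Gam C.openU X)
    moreover have "pd j (F i) x = vol c x * (\<Sum>k\<in>UNIV. C.Gam k x $ k $ j) * X x $ i + vol c x * pd j X x $ i"
      if "x \<in> ?U" for x
      using that C.pd_sqrt_det[OF that] dX[OF that, of i] C.differentiable[OF X that]
      by (simp add: FU pd_mult pd_vec_nth vol_def)
    ultimately show "continuous_on ?U (pd j (F i))"
      by (simp cong: continuous_on_cong)
    have "pd j (F i) x = 0" if "x \<in> - cball a r" for x
      using pd_zero_open(1)[OF oK that] F0 by blast
    then show "continuous_on (- cball a r) (pd j (F i))"
      by (intro continuous_on_eq[OF continuous_on_const[of "- cball a r" 0]]) (rule sym)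
  qed
  have sF: "F i x = 0" if "x \<notin> cball 0 (norm a + r)" for i x
  proof (rule F0)
    have "norm x \<le> norm a + dist a x"
      using norm_triangle_ineq[of a "x - a"] by (simp add: dist_norm norm_minus_commute)
    then show "x \<in> - cball a r" using that by auto
  qed
  have F_int: "integrable lborel (pd i (F i))" "integral\<^sup>L lborel (pd i (F i)) = 0" for i
    using integral_pd_zero[of "F i" i "norm a + r"] dF cF sF by blast+
  have D_eq: "indicator ?U x * (vol c x * D (chart_inv c x)) = (\<Sum>i\<in>UNIV. pd i (F i) x)" for x
  proof (cases "x \<in> ?U")
    case True
    then show ?thesis
      using C.dvg_sqrt_det[OF True C.differentiable[OF X True]] c by (simp add: FU D_def vol_def)
  next
    case False
    then have "x \<in> - cball a r" using un by blast
    then have "pd i (F i) x = 0" for i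
      using pd_zero_open(1)[OF oK] F0 by blast
    then show ?thesis using False by simp
  qed
  have "continuous_on (fst c) (\<lambda>p. C.dvg X (snd c p))"
  proof (rule continuous_on_compose2[OF _ chart_continuous[OF c]])
    show "continuous_on ?U (C.dvg X)"
      unfolding C.dvg_def[abs_def] by (intro smooth_on_continuous smooth_intros C.smooth_nab C.openU X)
  qed auto
  then have "(\<lambda>p. indicator (fst c) p *\<^sub>R C.dvg X (snd c p)) \<in> borel_measurable borel"
    using chart_open[OF c] by (intro borel_measurable_continuous_on_indicator) auto
  moreover have "(\<lambda>p. indicator (fst c) p *\<^sub>R C.dvg X (snd c p)) = D"
    by (auto simp: D_def fun_eq_iff)
  ultimately have Dm: "D \<in> borel_measurable borel" by simp
  have D0: "D p = 0" if "p \<notin> fst c" for p using that by (simp add: D_def)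
  have "integrable lborel (\<lambda>x. \<Sum>i\<in>UNIV. pd i (F i) x)"
    by (intro Bochner_Integration.integrable_sum F_int(1))
  moreover have "integrable (riemannian_measure A g) D \<longleftrightarrow>
      integrable lborel (\<lambda>x. indicator ?U x * (vol c x * D (chart_inv c x)))"
    by (rule integral_riemannian_measure_chart(1)[OF comp c Dm]) (rule D0)
  ultimately show "integrable (riemannian_measure A g) D"
    by (simp only: D_eq)
  have "integral\<^sup>L lborel (\<lambda>x. \<Sum>i\<in>UNIV. pd i (F i) x) = 0"
    by (subst Bochner_Integration.integral_sum) (simp_all add: F_int)
  moreover have "integral\<^sup>L (riemannian_measure A g) D =
      integral\<^sup>L lborel (\<lambda>x. indicator ?U x * (vol c x * D (chart_inv c x)))"
    by (rule integral_riemannian_measure_chart(2)[OF comp c Dm]) (rule D0)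
  ultimately show "integral\<^sup>L (riemannian_measure A g) D = 0"
    by (simp only: D_eq)
qed

end

context manifold
begin

text \<open>The open balls on which the bumps are positive cover the compact manifold. Dividing
  these bumps by their sum will give a partition of unity.\<close>

lemma chart_bump_cover:
  assumes "compact (UNIV :: 'a set)"
  obtains P :: "'a set" and r :: "'a \<Rightarrow> real" where "finite P"
    and "\<And>q. r q > 0" and "\<And>q. cball (snd (chart_at A q) q) (r q) \<subseteq> cdom (chart_at A q)"
    and "\<And>p. \<exists>q\<in>P. chart_bump (chart_at A q) (snd (chart_at A q) q) (r q) p > 0"
proof -
  have cA: "chart_at A q \<in> A" "q \<in> fst (chart_at A q)" for q
    using chart_at[of q] by (auto simp: charts_at_iff)
  have "\<exists>r>0. cball (snd (chart_at A q) q) r \<subseteq> cdom (chart_at A q)" for q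
    using cdom_open[OF cA(1)] cA(2) open_contains_cball by blast
  then obtain r where r: "\<And>q. r q > 0" "\<And>q. cball (snd (chart_at A q) q) (r q) \<subseteq> cdom (chart_at A q)"
    by metis
  define V where "V q = fst (chart_at A q) \<inter> snd (chart_at A q) -` ball (snd (chart_at A q) q) (r q)" for q
  have "open (V q)" for q
    unfolding V_def using chart_continuous[OF cA(1)] chart_open[OF cA(1)]
    by (intro continuous_open_preimage) auto
  moreover have "UNIV \<subseteq> (\<Union>q\<in>UNIV. V q)"
    using cA(2) r(1) by (auto simp: V_def)
  ultimately obtain P where P: "finite P" "UNIV \<subseteq> (\<Union>q\<in>P. V q)"
    using compactE_image[OF assms, of UNIV V] by metis
  have "\<exists>q\<in>P. chart_bump (chart_at A q) (snd (chart_at A q) q) (r q) p > 0" for p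
  proof -
    obtain q where "q \<in> P" "p \<in> V q" using P(2) by blast
    then show ?thesis
      using r(1) by (intro bexI[of _ q]) (auto simp: V_def chart_bump_def bump_pos dist_commute)
  qed
  with P(1) r show ?thesis by (rule that)
qed

lemma chart_bump_nonneg: "0 \<le> chart_bump c a r p"
  by (simp add: chart_bump_def bump_nonneg)

end

section \<open>The Yamabe quotient of a Hermitian manifold\<close>

context hermitian_manifold
begin

text \<open>With a partition of unity z_q and V = 2 u^2 W, the divergence of z_q V is z_q div V +
  dz_q(V), which is at most z_q f + dz_q(V). Summing over q removes the terms dz_q(V), so f
  dominates a finite sum of functions with integral 0.\<close>

lemma integrand_integral_nonneg:
  assumes comp: "compact (UNIV :: 'a set)" and int: "integrable_acs A J" and u: "smooth_fun A u"
  shows "0 \<le> (\<integral>p. 4 * grad_norm_sq A g u p + holomorphic_d_scalar A g J p * (u p)\<^sup>2 \<partial>riemannian_measure A g)"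
proof -
  define f where "f p = 4 * grad_norm_sq A g u p + holomorphic_d_scalar A g J p * (u p)\<^sup>2" for p
  obtain P r where P: "finite P" and r: "\<And>q. r q > 0" "\<And>q. cball (snd (chart_at A q) q) (r q) \<subseteq> cdom (chart_at A q)"
    and cov: "\<And>p. \<exists>q\<in>P. chart_bump (chart_at A q) (snd (chart_at A q) q) (r q) p > 0"
    using chart_bump_cover[OF comp] by blast
  let ?c = "\<lambda>q. chart_at A q"
  have cA: "?c q \<in> A" "q \<in> fst (?c q)" for q
    using chart_at[of q] by (auto simp: charts_at_iff)
  define b where "b q = chart_bump (?c q) (snd (?c q) q) (r q)" for q
  define s where "s p = (\<Sum>q\<in>P. b q p)" for p
  define z where "z q p = b q p / s p" for q p
  have s: "s p > 0" for p
  proof -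
    obtain q where "q \<in> P" "b q p > 0" using cov by (auto simp: b_def)
    then show ?thesis
      unfolding s_def using P by (intro sum_pos2[of P q]) (auto simp: b_def chart_bump_nonneg)
  qed
  have z_nonneg: "0 \<le> z q p" for q p
    using s[of p] by (simp add: z_def b_def chart_bump_nonneg)
  have z_sum: "(\<Sum>q\<in>P. z q p) = 1" for p
    using s[of p] by (simp add: z_def sum_divide_distrib[symmetric] s_def[symmetric])
  have b_smooth: "smooth_on (cdom d) (\<lambda>x. b q (chart_inv d x))" if "d \<in> A" for q d
    using smooth_chart_bump[OF cA(1) r(1) r(2), of q] that by (simp add: smooth_fun_def b_def o_def)
  have s_smooth: "smooth_on (cdom d) (\<lambda>x. s (chart_inv d x))" if "d \<in> A" for d
    unfolding s_def by (intro smooth_intros b_smooth cdom_open that)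
  have z_smooth: "smooth_on (cdom d) (\<lambda>x. z q (chart_inv d x))" if "d \<in> A" for q d
    unfolding z_def using s by (intro smooth_intros b_smooth s_smooth cdom_open that) (simp add: less_imp_neq[symmetric])
  have z_fun: "smooth_fun A (z q)" for q
    using z_smooth by (simp add: smooth_fun_def o_def)
  have z_out: "z q p = 0" if "p \<notin> chart_inv (?c q) ` cball (snd (?c q) q) (r q)" for q p
    using chart_bump_outside[OF cA(1) r(1) that] by (simp add: z_def b_def)
  define Z where "Z d x = (2 * (u (chart_inv d x))\<^sup>2) *\<^sub>R Wm d x" for d x
  have Z_smooth: "smooth_on (cdom d) (Z d)" if "d \<in> A" for d
  proof -
    interpret C: local_hermitian "cdom d" "gm d" "Jm d" by (rule local_hermitian_chart[OF that])
    have "smooth_on (cdom d) (\<lambda>x. u (chart_inv d x))"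
      using u that by (simp add: smooth_fun_def o_def)
    then show ?thesis
      unfolding Z_def[abs_def] by (intro smooth_intros C.openU C.smooth_W)
  qed
  \<comment> \<open>The chart at \<open>p\<close> is arbitrary; by \<open>Wm_transform\<close> the
    vector has the coordinates \<open>Z d\<close> in every chart around \<open>p\<close>.\<close>
  define V where "V p = tvec_of (?c p) p (Z (?c p) (snd (?c p) p))" for p
  have V_tan: "V p \<in> tangent_space A p" for p
    unfolding V_def by (rule tvec_of_tangent[OF chart_at])
  have V_chart: "V p d = Z d (snd d p)" if d: "d \<in> charts_at A p" for p d
    using d chart_at[of p] Wm_transform[OF chart_at d]
    by (simp add: V_def tvec_of_def Z_def charts_at_iff matrix_vector_simps)
  define X where "X q x = z q (chart_inv (?c q) x) *\<^sub>R Z (?c q) x" for q x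
  define D where "D q = (\<lambda>p. if p \<in> fst (?c q) then local_metric.dvg (gm (?c q)) (X q) (snd (?c q) p) else 0)" for q
  have D_int: "integrable (riemannian_measure A g) (D q)" "integral\<^sup>L (riemannian_measure A g) (D q) = 0" for q
  proof -
    have X1: "smooth_on (cdom (?c q)) (X q)"
      unfolding X_def[abs_def] by (intro smooth_intros cdom_open cA z_smooth Z_smooth)
    have X2: "X q x = 0" if "x \<in> cdom (?c q)" "x \<notin> cball (snd (?c q) q) (r q)" for x
    proof -
      have "chart_inv (?c q) x \<notin> chart_inv (?c q) ` cball (snd (?c q) q) (r q)"
      proof
        assume "chart_inv (?c q) x \<in> chart_inv (?c q) ` cball (snd (?c q) q) (r q)"
        then obtain y where y: "chart_inv (?c q) x = chart_inv (?c q) y" "y \<in> cball (snd (?c q) q) (r q)"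
          by blast
        have "x = snd (?c q) (chart_inv (?c q) x)"
          by (rule chart_inv_right[OF cA(1) that(1), symmetric])
        also have "\<dots> = snd (?c q) (chart_inv (?c q) y)"
          by (simp only: y(1))
        also have "\<dots> = y"
          by (rule chart_inv_right[OF cA(1) subsetD[OF r(2) y(2)]])
        finally have "x = y" .
        with y(2) that(2) show False by simp
      qed
      then show ?thesis by (simp add: X_def z_out)
    qed
    show "integrable (riemannian_measure A g) (D q)" "integral\<^sup>L (riemannian_measure A g) (D q) = 0"
      unfolding D_def using integral_divergence_chart[OF comp cA(1) r(2) X1 X2] by blast+
  qed
  have D_le: "D q p \<le> z q p * f p + differential A (z q) p (V p)" for q p
  proof (cases "p \<in> fst (?c q)")
    case True
    let ?d = "?c q"
    have d: "?d \<in> charts_at A p" using True cA by (simp add: charts_at_iff)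
    have px: "snd ?d p \<in> cdom ?d" using True by blast
    interpret C: local_metric "cdom ?d" "gm ?d" by (rule local_metric_chart[OF cA(1)])
    have "D q p = z q p * C.dvg (Z ?d) (snd ?d p) + (\<Sum>i\<in>UNIV. Z ?d (snd ?d p) $ i * pd i (\<lambda>x. z q (chart_inv ?d x)) (snd ?d p))"
      using True C.dvg_scaleR[OF C.differentiable[OF z_smooth[OF cA(1)] px] C.differentiable[OF Z_smooth[OF cA(1)] px]] cA(1)
      by (simp add: D_def X_def[abs_def])
    also have "(\<Sum>i\<in>UNIV. Z ?d (snd ?d p) $ i * pd i (\<lambda>x. z q (chart_inv ?d x)) (snd ?d p)) = differential A (z q) p (V p)"
      using differential_chart[OF d V_tan smooth_fun_differentiable[OF z_fun d]] by (simp add: V_chart[OF d] o_def)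
    finally show ?thesis
      using mult_left_mono[OF integrand_ge_divergence[OF int u d] z_nonneg[of q p]]
      by (simp add: Z_def[abs_def] f_def)
  next
    case False
    let ?d = "?c p" and ?K = "chart_inv (?c q) ` cball (snd (?c q) q) (r q)"
    \<comment> \<open>Away from its chart \<open>z q\<close> vanishes on a neighbourhood of the
      point, the support being closed, so its differential is 0 and both sides are 0.\<close>
    have pK: "p \<notin> ?K"
      using False chart_inv_cball_subset[OF cA(1) r(2)] by blast
    have oS: "open {x \<in> cdom ?d. chart_inv ?d x \<in> - ?K}"
      using chart_bump_compact[OF cA(1) r(2), of q]
      by (intro chart_preimage_open cA) (simp add: compact_imp_closed open_Compl)
    have "pd i (z q \<circ> chart_inv ?d) (snd ?d p) = 0" for i
      using pK cA[of p] z_out by (intro pd_zero_open(1)[OF oS]) auto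
    then have "differential A (z q) p (V p) = 0"
      using differential_chart[OF chart_at V_tan smooth_fun_differentiable[OF z_fun chart_at]] by simp
    then show ?thesis
      using False z_out[OF pK] by (simp add: D_def)
  qed
  \<comment> \<open>The differentials add up to the differential of the constant 1.\<close>
  have dz: "(\<Sum>q\<in>P. differential A (z q) p (V p)) = 0" for p
  proof -
    let ?d = "?c p"
    have px: "snd ?d p \<in> cdom ?d" using cA(2) by blast
    have dd: "(\<lambda>x. z q (chart_inv ?d x)) differentiable (at (snd ?d p))" for q
      by (rule smooth_on_differentiable[OF z_smooth[OF cA(1)] cdom_open[OF cA(1)] px])
    have "(\<Sum>q\<in>P. differential A (z q) p (V p)) = (\<Sum>q\<in>P. \<Sum>i\<in>UNIV. V p ?d $ i * pd i (\<lambda>x. z q (chart_inv ?d x)) (snd ?d p))"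
      using differential_chart[OF chart_at V_tan smooth_fun_differentiable[OF z_fun chart_at]] by (simp add: o_def)
    also have "\<dots> = (\<Sum>i\<in>UNIV. V p ?d $ i * pd i (\<lambda>x. \<Sum>q\<in>P. z q (chart_inv ?d x)) (snd ?d p))"
      using dd by (subst sum.swap) (simp add: pd_sum sum_distrib_left)
    also have "\<dots> = 0"
      by (simp add: z_sum)
    finally show ?thesis .
  qed
  have le: "(\<Sum>q\<in>P. D q p) \<le> f p" for p
  proof -
    have "(\<Sum>q\<in>P. D q p) \<le> (\<Sum>q\<in>P. z q p * f p + differential A (z q) p (V p))"
      by (intro sum_mono D_le)
    also have "\<dots> = f p"
      by (simp add: sum.distrib dz sum_distrib_right[symmetric] z_sum)
    finally show ?thesis .
  qed
  have "0 \<le> integral\<^sup>L (riemannian_measure A g) f"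
  \<comment> \<open>The Bochner integral of a non-integrable function is 0 by convention, which
    settles that case.\<close>
  proof (cases "integrable (riemannian_measure A g) f")
    case True
    have "integral\<^sup>L (riemannian_measure A g) (\<lambda>p. \<Sum>q\<in>P. D q p) \<le> integral\<^sup>L (riemannian_measure A g) f"
      by (intro integral_mono Bochner_Integration.integrable_sum D_int True le)
    then show ?thesis
      by (subst (asm) Bochner_Integration.integral_sum) (simp_all add: D_int)
  qed (simp add: not_integrable_integral_eq)
  then show ?thesis
    by (simp add: f_def[abs_def])
qed

end

theorem corollary4p4:
  fixes A :: "('a::{t2_space, second_countable_topology}, 'n::finite) chart set"
    and g :: "('a, 'n) metric"
    and J :: "('a, 'n) endo"
  assumes "smooth_atlas A"
    and "compact (UNIV :: 'a set)"
    and "connected (UNIV :: 'a set)"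
    and "almost_hermitian A g J"
    and "CARD('n) \<ge> 6"
    and "yamabe_constant A g J < 0"
  shows "\<not> integrable_acs A J"
proof
  assume int: "integrable_acs A J"
  interpret hermitian_manifold A g J
  proof
    show "smooth_atlas A" by (rule assms(1))
    show "riemannian_metric A g" using assms(4) by (simp add: almost_hermitian_def)
    show "almost_hermitian A g J" by (rule assms(4))
  qed
  obtain u where u: "smooth_fun A u" and neg: "yamabe_quotient A g J u < 0"
    using assms(6) unfolding yamabe_constant_def INF_less_iff by auto
  have "0 \<le> (\<integral>x. 4 * grad_norm_sq A g u x + holomorphic_d_scalar A g J x * (u x)\<^sup>2 \<partial>riemannian_measure A g)"
    by (rule integrand_integral_nonneg[OF assms(2) int u])
  then have "0 \<le> yamabe_quotient A g J u"
    \<comment> \<open>The denominator is a square; even if it were 0, the quotient would be 0 by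
      convention.\<close>
    unfolding yamabe_quotient_def Let_def by (rule divide_nonneg_nonneg) simp
  with neg show False by simp
qed

end
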